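(* Let $X$ be a path-connected smooth manifold. Then the symmetric topological complexity $\mathrm{TC}^S(X)$ equals the smallest possible number of local rules of symmetric motion planners for $X$.
   Context: Genus: for a fibration $p\colon E\to B$, the (normalized) Schwarz genus of $p$ is one less than the smallest number of open sets $U$ covering $B$ such that $p$ admits a continuous section over each $U$ (a trivial fibration has genus $0$). Configuration spaces and path spaces: $F(X,2)=\{(x,y)\in X\times X: x\neq y\}$; $P(X)=X^{[0,1]}$ is the free path space with the compact-open topology; $P_1(X)\subset P(X)$ is the subspace of paths $\gamma$ with $\gamma(0)\neq\gamma(1)$; $\mathrm{ev}_1\colon P_1(X)\to F(X,2)$ is $\gamma\mapsto(\gamma(0),\gamma(1))$. The group $\mathbb{Z}/2$ acts freely on $P_1(X)$ by reversing paths, $\gamma(t)\mapsto\gamma(1-t)$, and on $F(X,2)$ by $(x,y)\mapsto(y,x)$; $\mathrm{ev}_1$ is $\mathbb{Z}/2$-equivariant. Let $P_2(X)$ and $B(X,2)$ be the orbit spaces, and $\mathrm{ev}_2\colon P_2(X)\to B(X,2)$ the fibration induced by $\mathrm{ev}_1$. Symmetric topological complexity: $\mathrm{TC}^S(X)=\mathrm{genus}(\mathrm{ev}_2)+1$. Symmetric motion planner: a symmetric motion planner for $X$ consists of a finite collection $F_1,\dots,F_k$ of subsets of $F(X,2)$ (the local domains) and maps $s_i\colon F_i\to P_1(X)$, $1\le i\le k$ (the local rules), such that: (a) the $F_i$ cover $F(X,2)$ and are pairwise disjoint; (b) each $F_i$ is a $\mathbb{Z}/2$-equivariant neighborhood deformation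 retract of $F(X,2)$, i.e. $F_i$ is stable under the involution and has an open neighborhood $U_i$ in $F(X,2)$, stable under the involution, admitting a $\mathbb{Z}/2$-equivariant retraction $r_i\colon U_i\to F_i$ which, as a map to $F(X,2)$, is $\mathbb{Z}/2$-equivariantly homotopic to the inclusion $U_i\hookrightarrow F(X,2)$; (c) each $s_i$ is a continuous $\mathbb{Z}/2$-equivariant section of $\mathrm{ev}_1$ over $F_i$. The number of local rules is $k$. *)

theory Defs
  imports "HOL-Analysis.Analysis" "HOL-Library.Extended_Nat"
begin

section \<open>Smooth manifolds\<close>

text \<open>
  Smoothness is needed for maps between open subsets of \<^term>\<open>Euclidean_space n\<close>, where n is a
  natural number (0 allowed) and points are functions on \<^typ>\<open>nat\<close> vanishing from n on.
  A function is of class C^k on an open set if its iterated partial derivatives up to order k exist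
  there and are continuous. The i-th partial derivative \<open>g i\<close> is determined on \<open>W\<close> only.
\<close>

primrec Ck_on :: "nat \<Rightarrow> nat \<Rightarrow> (nat \<Rightarrow> real) set \<Rightarrow> ((nat \<Rightarrow> real) \<Rightarrow> real) \<Rightarrow> bool" where
  "Ck_on 0 n W f \<longleftrightarrow> continuous_map (subtopology (Euclidean_space n) W) euclideanreal f"
| "Ck_on (Suc k) n W f \<longleftrightarrow>
     continuous_map (subtopology (Euclidean_space n) W) euclideanreal f \<and>
     (\<exists>g. \<forall>i<n.
        (\<forall>x\<in>W. ((\<lambda>t. f (x(i := t))) has_real_derivative g i x) (at (x i))) \<and>
        Ck_on k n W (g i))"

definition smooth_on ::
  "nat \<Rightarrow> (nat \<Rightarrow> real) set \<Rightarrow> ((nat \<Rightarrow> real) \<Rightarrow> (nat \<Rightarrow> real)) \<Rightarrow> bool" where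
  "smooth_on n W f \<longleftrightarrow> (\<forall>k. \<forall>i<n. Ck_on k n W (\<lambda>x. f x i))"

type_synonym 'a chart = "'a set \<times> ('a \<Rightarrow> nat \<Rightarrow> real)"

definition is_chart :: "nat \<Rightarrow> 'a topology \<Rightarrow> 'a chart \<Rightarrow> bool" where
  "is_chart n X = (\<lambda>(U, \<phi>).
     openin X U \<and> openin (Euclidean_space n) (\<phi> ` U) \<and>
     homeomorphic_map (subtopology X U) (subtopology (Euclidean_space n) (\<phi> ` U)) \<phi>)"

text \<open>Applied in both orders, this makes every transition map a diffeomorphism.\<close>

definition smooth_transition :: "nat \<Rightarrow> 'a chart \<Rightarrow> 'a chart \<Rightarrow> bool" where
  "smooth_transition n = (\<lambda>(U, \<phi>) (V, \<psi>).
     smooth_on n (\<phi> ` (U \<inter> V)) (\<psi> \<circ> inv_into U \<phi>))"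

text \<open>
  Manifolds are Hausdorff, second countable, without boundary and of pure dimension n. The atlas
  is not required to be maximal: every smooth atlas lies in a unique maximal one.
\<close>

definition smooth_manifold :: "nat \<Rightarrow> 'a topology \<Rightarrow> 'a chart set \<Rightarrow> bool" where
  "smooth_manifold n X \<A> \<longleftrightarrow>
     Hausdorff_space X \<and> second_countable X \<and>
     (\<forall>c\<in>\<A>. is_chart n X c) \<and> (\<Union>c\<in>\<A>. fst c) = topspace X \<and>
     (\<forall>c\<in>\<A>. \<forall>d\<in>\<A>. smooth_transition n c d)"


section \<open>Genus\<close>

text \<open>
  A family \<open>U 0, \<dots>, U k\<close> has k + 1 members, so k is already the normalized number, and there is
  always at least one open set: also a fibration over the empty space, being trivial, has genus 0.
  The genus is \<^term>\<open>\<infinity> :: enat\<close> if no finite cover exists.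
\<close>

definition genus :: "'e topology \<Rightarrow> 'b topology \<Rightarrow> ('e \<Rightarrow> 'b) \<Rightarrow> enat" where
  "genus E B p = (INF k \<in> {k. \<exists>U :: nat \<Rightarrow> 'b set.
       (\<Union>i\<le>k. U i) = topspace B \<and>
       (\<forall>i\<le>k. openin B (U i) \<and>
          (\<exists>s. continuous_map (subtopology B (U i)) E s \<and> (\<forall>b\<in>U i. p (s b) = b)))}. enat k)"


section \<open>Path spaces, configuration spaces and their orbit spaces\<close>

text \<open>Maps are taken extensional, so that equality of points is equality of maps on \<open>topspace A\<close>.\<close>

definition compact_open_topology :: "'a topology \<Rightarrow> 'b topology \<Rightarrow> ('a \<Rightarrow> 'b) topology" where
  "compact_open_topology A X = topology_generated_by
     {{f \<in> extensional (topspace A). continuous_map A X f \<and> f ` K \<subseteq> U} | K U.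
        compactin A K \<and> openin X U}"

definition path_space :: "'a topology \<Rightarrow> (real \<Rightarrow> 'a) topology" where
  "path_space X = compact_open_topology (top_of_set {0..1}) X"

definition path_space1 :: "'a topology \<Rightarrow> (real \<Rightarrow> 'a) topology" where
  "path_space1 X = subtopology (path_space X) {\<gamma>. \<gamma> 0 \<noteq> \<gamma> 1}"

definition conf2 :: "'a topology \<Rightarrow> ('a \<times> 'a) topology" where
  "conf2 X = subtopology (prod_topology X X) {(x, y). x \<noteq> y}"

definition ev1 :: "(real \<Rightarrow> 'a) \<Rightarrow> 'a \<times> 'a" where
  "ev1 \<gamma> = (\<gamma> 0, \<gamma> 1)"

definition rev_path :: "(real \<Rightarrow> 'a) \<Rightarrow> (real \<Rightarrow> 'a)" where
  "rev_path \<gamma> = (\<lambda>t\<in>{0..1}. \<gamma> (1 - t))"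

text \<open>
  The quotient of \<open>T\<close> by the action of Z/2 given by an involution \<open>\<sigma>\<close>; its points are the orbits
  \<open>{x, \<sigma> x}\<close>, and a set of orbits is open if its preimage in \<open>T\<close> is.
\<close>

definition orbit_space :: "'a topology \<Rightarrow> ('a \<Rightarrow> 'a) \<Rightarrow> 'a set topology" where
  "orbit_space T \<sigma> = topology (\<lambda>\<O>.
     \<O> \<subseteq> (\<lambda>x. {x, \<sigma> x}) ` topspace T \<and> openin T {x \<in> topspace T. {x, \<sigma> x} \<in> \<O>})"

definition path_space2 :: "'a topology \<Rightarrow> (real \<Rightarrow> 'a) set topology" where
  "path_space2 X = orbit_space (path_space1 X) rev_path"

definition uconf2 :: "'a topology \<Rightarrow> ('a \<times> 'a) set topology" where
  "uconf2 X = orbit_space (conf2 X) prod.swap"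

text \<open>The map induced on orbits is the direct image: it sends the orbit of a path \<open>\<gamma>\<close> to that of \<open>ev1 \<gamma>\<close>.\<close>

definition ev2 :: "(real \<Rightarrow> 'a) set \<Rightarrow> ('a \<times> 'a) set" where
  "ev2 = (`) ev1"

definition symmetric_TC :: "'a topology \<Rightarrow> enat" where
  "symmetric_TC X = genus (path_space2 X) (uconf2 X) ev2 + 1"

lemma openin_orbit_space:
  "openin (orbit_space T \<sigma>) \<O> \<longleftrightarrow>
     \<O> \<subseteq> (\<lambda>x. {x, \<sigma> x}) ` topspace T \<and> openin T {x \<in> topspace T. {x, \<sigma> x} \<in> \<O>}"
proof -
  let ?P = "\<lambda>\<O>. \<O> \<subseteq> (\<lambda>x. {x, \<sigma> x}) ` topspace T \<and> openin T {x \<in> topspace T. {x, \<sigma> x} \<in> \<O>}"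
  have "istopology ?P"
    unfolding istopology_def
  proof (intro conjI allI impI)
    fix S S' assume S: "?P S" and S': "?P S'"
    have "{x \<in> topspace T. {x, \<sigma> x} \<in> S \<inter> S'}
        = {x \<in> topspace T. {x, \<sigma> x} \<in> S} \<inter> {x \<in> topspace T. {x, \<sigma> x} \<in> S'}" by auto
    then show "openin T {x \<in> topspace T. {x, \<sigma> x} \<in> S \<inter> S'}"
      using S S' by auto
    show "S \<inter> S' \<subseteq> (\<lambda>x. {x, \<sigma> x}) ` topspace T" using S by auto
  next
    fix \<K> assume K: "\<forall>S\<in>\<K>. ?P S"
    have "{x \<in> topspace T. {x, \<sigma> x} \<in> \<Union>\<K>}
        = \<Union>((\<lambda>S. {x \<in> topspace T. {x, \<sigma> x} \<in> S}) ` \<K>)" by auto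
    then show "openin T {x \<in> topspace T. {x, \<sigma> x} \<in> \<Union>\<K>}"
      using K by auto
    show "\<Union>\<K> \<subseteq> (\<lambda>x. {x, \<sigma> x}) ` topspace T" using K by blast
  qed
  then show ?thesis
    by (simp add: orbit_space_def topology_inverse')
qed

lemma topspace_orbit_space [simp]:
  "topspace (orbit_space T \<sigma>) = (\<lambda>x. {x, \<sigma> x}) ` topspace T"
proof -
  have "{x \<in> topspace T. {x, \<sigma> x} \<in> (\<lambda>x. {x, \<sigma> x}) ` topspace T} = topspace T" by auto
  then have "openin (orbit_space T \<sigma>) ((\<lambda>x. {x, \<sigma> x}) ` topspace T)"
    by (simp add: openin_orbit_space)
  moreover have "topspace (orbit_space T \<sigma>) \<subseteq> (\<lambda>x. {x, \<sigma> x}) ` topspace T"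
    using openin_topspace[of "orbit_space T \<sigma>"] unfolding openin_orbit_space by (rule conjunct1)
  ultimately show ?thesis
    using openin_subset by blast
qed

lemma quotient_map_orbit_space:
  "quotient_map T (orbit_space T \<sigma>) (\<lambda>x. {x, \<sigma> x})"
  unfolding quotient_map_def by (auto simp: openin_orbit_space)

lemma topspace_compact_open_topology:
  "topspace (compact_open_topology A X) = {f \<in> extensional (topspace A). continuous_map A X f}"
proof -
  have "\<exists>K U. compactin A K \<and> openin X U \<and> f ` K \<subseteq> U" for f
    by (rule exI[of _ "{}"], rule exI[of _ "{}"]) auto
  then show ?thesis
    unfolding compact_open_topology_def topology_generated_by_topspace
    by blast
qed

lemma topspace_path_space1:
  "topspace (path_space1 X) = {\<gamma> \<in> extensional {0..1}. pathin X \<gamma> \<and> \<gamma> 0 \<noteq> \<gamma> 1}"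
  by (auto simp: path_space1_def path_space_def topspace_compact_open_topology pathin_def)

lemma topspace_conf2:
  "topspace (conf2 X) = {(x, y). x \<in> topspace X \<and> y \<in> topspace X \<and> x \<noteq> y}"
  by (auto simp: conf2_def)

lemma rev_path_in_path_space1:
  assumes "\<gamma> \<in> topspace (path_space1 X)"
  shows "rev_path \<gamma> \<in> topspace (path_space1 X)"
    and "rev_path (rev_path \<gamma>) = \<gamma>"
    and "rev_path \<gamma> \<noteq> \<gamma>"
    and "ev1 (rev_path \<gamma>) = prod.swap (ev1 \<gamma>)"
proof -
  have \<gamma>: "\<gamma> \<in> extensional {0..1}" "pathin X \<gamma>" "\<gamma> 0 \<noteq> \<gamma> 1"
    using assms by (auto simp: topspace_path_space1)
  have "continuous_map (top_of_set {0..1::real}) (top_of_set {0..1}) (\<lambda>t. 1 - t)"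
    by (auto simp: continuous_map_in_subtopology intro!: continuous_intros)
  then have "continuous_map (top_of_set {0..1}) X (\<gamma> \<circ> (\<lambda>t. 1 - t))"
    using \<gamma>(2) continuous_map_compose unfolding pathin_def by blast
  then have "pathin X (rev_path \<gamma>)"
    unfolding pathin_def by (rule continuous_map_eq) (auto simp: rev_path_def)
  then show "rev_path \<gamma> \<in> topspace (path_space1 X)"
    using \<gamma>(3) by (auto simp: topspace_path_space1 rev_path_def)
  show "rev_path (rev_path \<gamma>) = \<gamma>"
    using \<gamma>(1) by (auto simp: rev_path_def extensional_def fun_eq_iff)
  have "rev_path \<gamma> 0 = \<gamma> 1" by (simp add: rev_path_def)
  then show "rev_path \<gamma> \<noteq> \<gamma>" using \<gamma>(3) by auto
  show "ev1 (rev_path \<gamma>) = prod.swap (ev1 \<gamma>)"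
    by (simp add: ev1_def rev_path_def)
qed


section \<open>Symmetric motion planners\<close>

definition swap_equivariant_on :: "('a \<times> 'a) set \<Rightarrow> ('a \<times> 'a \<Rightarrow> 'a \<times> 'a) \<Rightarrow> bool" where
  "swap_equivariant_on U f \<longleftrightarrow> (\<forall>z\<in>U. f (prod.swap z) = prod.swap (f z))"

definition equivariant_ndr :: "'a topology \<Rightarrow> ('a \<times> 'a) set \<Rightarrow> bool" where
  "equivariant_ndr X F \<longleftrightarrow>
     F \<subseteq> topspace (conf2 X) \<and> prod.swap ` F \<subseteq> F \<and>
     (\<exists>U r. openin (conf2 X) U \<and> F \<subseteq> U \<and> prod.swap ` U \<subseteq> U \<and>
        retraction_maps (subtopology (conf2 X) U) (subtopology (conf2 X) F) r id \<and>
        swap_equivariant_on U r \<and>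
        homotopic_with (swap_equivariant_on U) (subtopology (conf2 X) U) (conf2 X) r id)"

text \<open>
  The families \<open>F\<close> and \<open>s\<close> matter on the indices 1, ..., k only. Local domains may be empty,
  and \<open>k \<ge> 1\<close>, in accordance with the convention in \<^const>\<open>genus\<close>.
\<close>

definition symmetric_motion_planner ::
  "'a topology \<Rightarrow> nat \<Rightarrow> (nat \<Rightarrow> ('a \<times> 'a) set) \<Rightarrow> (nat \<Rightarrow> 'a \<times> 'a \<Rightarrow> (real \<Rightarrow> 'a)) \<Rightarrow> bool" where
  "symmetric_motion_planner X k F s \<longleftrightarrow>
     k \<ge> 1 \<and>
     (\<Union>i\<in>{1..k}. F i) = topspace (conf2 X) \<and> disjoint_family_on F {1..k} \<and>
     (\<forall>i\<in>{1..k}. equivariant_ndr X (F i)) \<and>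
     (\<forall>i\<in>{1..k}.
        continuous_map (subtopology (conf2 X) (F i)) (path_space1 X) (s i) \<and>
        (\<forall>z\<in>F i. ev1 (s i z) = z \<and> s i (prod.swap z) = rev_path (s i z)))"

end

theory Submission
  imports Defs
begin

text \<open>
  From planners to sections over open sets: on a neighbourhood \<open>U\<close> of a local domain with retraction
  \<open>r\<close>, a homotopy from \<open>r\<close> to the inclusion joins \<open>z\<close> to \<open>r z\<close> in both coordinates, and running along
  it, then along \<open>s (r z)\<close>, then back, gives an equivariant section over \<open>U\<close>.

  Conversely, given open invariant sets \<open>V 0, \<dots>, V k\<close> with equivariant sections, it is enough to
  find, between a closed invariant \<open>C\<close> and an open invariant \<open>U\<close>, a closed invariant neighbourhood
  \<open>A\<close> of \<open>C\<close> in \<open>U\<close> that is an equivariant neighbourhood deformation retract: shrinking one \<open>V i\<close> after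
  the other to such an \<open>A i\<close>, the sets \<open>A i - \<Union>j<i. A j\<close> are the local domains, because the property
  passes to relatively open subsets. We take \<open>A = {g \<le> 0}\<close>, where \<open>g\<close> has
  no critical point on its zero set. Then near a zero some coordinate direction decreases \<open>g\<close> at a
  definite rate, and moving along it for a time proportional to \<open>max 0 g\<close> pushes a neighbourhood into
  \<open>A\<close> while \<open>A\<close> stays fixed. A countable composition of such pushes becomes stationary near every point of
  \<open>A\<close> and gives the retraction together with its homotopy.

  The function \<open>g\<close> is a rapidly converging sum of bump functions times affine functions of the chart
  coordinates. Sard's theorem is not needed for it: the degenerate zeros of a function of m
  variables perturbed by an affine function are excluded by m + 1 parameters, since the bad
  parameters form the Lipschitz image of an m-dimensional cube.
\<close>

section \<open>Paths, orbit spaces and sections\<close>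

text \<open>Closed sets between C and U abound, but an arbitrary one need not be a neighbourhood
  deformation retract; its boundary has to be tame, and a regular zero set is tame enough.
  Regularity must be an open, quantitative condition: infinitely many charts are treated in turn and
  no summand may undo an earlier success. Hence \<open>descent\<close> carries an explicit rate,
  which a perturbation of smaller Lipschitz constant cannot destroy, not even an infinite tail of
  them. Class C^{1,1} is the matching strength: its quadratic remainder is exactly what the counting
  argument consumes, it survives changes of charts, and bumps built from squared positive parts
  possess it. The involution is free, and that removes the equivariance problem: charts of the
  configuration space are chosen so small that they miss their mirror images. A bump plus its mirror
  image is then invariant, yet on its own chart it is still the plain bump, so the perturbation
  argument runs there as if no symmetry were present. The pushes are made equivariant in the same
  way, by copying them to the mirror chart.\<close>

lemma openin_compact_open_topology:
  assumes "compactin A K" "openin X U"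
  shows "openin (compact_open_topology A X) {f \<in> extensional (topspace A). continuous_map A X f \<and> f ` K \<subseteq> U}"
  unfolding compact_open_topology_def using assms by (intro topology_generated_by_Basis) blast

text \<open>Evaluation is continuous because [0,1] is locally compact: a small closed interval
  around t on which the path stays in U defines a subbasic open set of the compact-open
  topology.\<close>

lemma continuous_map_uncurry_path:
  assumes s: "continuous_map S (path_space X) s"
  shows "continuous_map (prod_topology S (top_of_set {0..1})) X (\<lambda>(z, t). s z t)"
proof -
  have sp: "s z \<in> extensional {0..1}" "continuous_map (top_of_set {0..1}) X (s z)" if "z \<in> topspace S" for z
    using continuous_map_image_subset_topspace[OF s] that
    by (auto simp: path_space_def topspace_compact_open_topology)
  show ?thesis
    unfolding continuous_map_def
  proof (intro conjI allI impI)
    show "(\<lambda>(z, t). s z t) \<in> topspace (prod_topology S (top_of_set {0..1})) \<rightarrow> topspace X"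
      using sp(2) continuous_map_image_subset_topspace by fastforce
    fix U assume U: "openin X U"
    let ?P = "{p \<in> topspace (prod_topology S (top_of_set {0..1})). (case p of (z, t) \<Rightarrow> s z t) \<in> U}"
    show "openin (prod_topology S (top_of_set {0..1})) ?P"
    proof (subst openin_subopen, intro ballI)
      fix p assume p: "p \<in> ?P"
      then obtain z t where zt: "p = (z, t)" "z \<in> topspace S" "t \<in> {0..1}" "s z t \<in> U" by auto
      have "openin (top_of_set {0..1}) {t \<in> topspace (top_of_set {0..1}). s z t \<in> U}"
        by (rule openin_continuous_map_preimage[OF sp(2)[OF zt(2)] U])
      then obtain e where e: "0 < e" "\<And>t'. t' \<in> {0..1} \<Longrightarrow> dist t' t < e \<Longrightarrow> s z t' \<in> U"
        using zt unfolding openin_euclidean_subtopology_iff by force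
      \<comment> \<open>The radius e / 2 keeps the closed ball inside the e-ball where
        \<open>s z\<close> stays in U; the open ball of the same radius then lies in
        \<open>K\<close>.\<close>
      define K where "K = {0..1} \<inter> cball t (e / 2)"
      have K: "compactin (top_of_set {0..1}) K"
        by (simp add: K_def compactin_subtopology compact_Int)
      define V where "V = {z' \<in> topspace S. s z' \<in> {f \<in> extensional (topspace (top_of_set {0..1::real})).
          continuous_map (top_of_set {0..1}) X f \<and> f ` K \<subseteq> U}}"
      have V: "openin S V"
        unfolding V_def using s unfolding path_space_def
        by (rule openin_continuous_map_preimage) (rule openin_compact_open_topology[OF K U])
      have "openin (top_of_set {0..1}) ({0..1} \<inter> ball t (e / 2))" by (simp add: openin_open_Int)
      then have "openin (prod_topology S (top_of_set {0..1})) (V \<times> ({0..1} \<inter> ball t (e / 2)))"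
        using V by (simp add: openin_prod_Times_iff)
      moreover have "z \<in> V"
        using zt(2) sp[OF zt(2)] e by (auto simp: V_def K_def dist_commute)
      then have "p \<in> V \<times> ({0..1} \<inter> ball t (e / 2))"
        using zt e by auto
      moreover have "V \<times> ({0..1} \<inter> ball t (e / 2)) \<subseteq> ?P"
        by (auto simp: V_def K_def)
      ultimately show "\<exists>T. openin (prod_topology S (top_of_set {0..1})) T \<and> p \<in> T \<and> T \<subseteq> ?P"
        by blast
    qed
  qed
qed

text \<open>The converse adjunction rests on compactness of K: the preimage of U contains {z}
  \<times> K and hence, by the tube lemma, a strip around it.\<close>

lemma continuous_map_curry_path:
  assumes h: "continuous_map (prod_topology S (top_of_set {0..1})) X h"
  shows "continuous_map S (path_space X) (\<lambda>z. \<lambda>t\<in>{0..1}. h (z, t))"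
  unfolding path_space_def compact_open_topology_def
proof (rule continuous_on_generated_topo)
  have path: "continuous_map (top_of_set {0..1}) X (\<lambda>t\<in>{0..1}. h (z, t))" if "z \<in> topspace S" for z
  proof -
    have "continuous_map (top_of_set {0..1}) X (h \<circ> Pair z)"
      using h that by (intro continuous_map_compose[OF _ h] continuous_map_pairedI[of _ _ "\<lambda>_. z" _ "\<lambda>t. t", unfolded id_def]) auto
    then show ?thesis by (rule continuous_map_eq) auto
  qed
  let ?B = "\<lambda>K U. {f \<in> extensional (topspace (top_of_set {0..1})). continuous_map (top_of_set {0..1}) X f \<and> f ` K \<subseteq> U}"
  show "openin S ((\<lambda>z. \<lambda>t\<in>{0..1}. h (z, t)) -` O' \<inter> topspace S)"
    if O': "O' \<in> {?B K U |K U. compactin (top_of_set {0..1::real}) K \<and> openin X U}" for O'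
  proof -
    obtain K U where KU: "O' = ?B K U" "compactin (top_of_set {0..1}) K" "openin X U" using O' by blast
    have K01: "K \<subseteq> {0..1}" using compactin_subset_topspace[OF KU(2)] by simp
    let ?W = "{p \<in> topspace (prod_topology S (top_of_set {0..1})). h p \<in> U}"
    have W: "openin (prod_topology S (top_of_set {0..1})) ?W"
      by (rule openin_continuous_map_preimage[OF h KU(3)])
    show ?thesis
    proof (subst openin_subopen, intro ballI)
      fix z assume z: "z \<in> (\<lambda>z. \<lambda>t\<in>{0..1}. h (z, t)) -` O' \<inter> topspace S"
      then have "(\<lambda>t\<in>{0..1}. h (z, t)) t \<in> U" if "t \<in> K" for t
        using that unfolding KU(1) by blast
      then have "h (z, t) \<in> U" if "t \<in> K" for t
        using that subsetD[OF K01 that] by force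
      then have zK: "{z} \<times> K \<subseteq> ?W" using z K01 by auto
      have zS: "z \<in> topspace S" using z by simp
      from tube_lemma_right[OF W KU(2) zS zK]
      obtain A B where AB: "openin S A" "z \<in> A" "K \<subseteq> B" "A \<times> B \<subseteq> ?W"
        by (elim exE conjE) (rule that)
      have "A \<subseteq> (\<lambda>z. \<lambda>t\<in>{0..1}. h (z, t)) -` O' \<inter> topspace S"
        proof
        fix w assume w: "w \<in> A"
        then have wS: "w \<in> topspace S" using openin_subset[OF AB(1)] by blast
        have "h (w, t) \<in> U" if "t \<in> K" for t using AB(3,4) w that by blast
        then have "(\<lambda>t\<in>{0..1}. h (w, t)) ` K \<subseteq> U"
          using K01 by (auto simp: restrict_def subset_iff)
        then show "w \<in> (\<lambda>z. \<lambda>t\<in>{0..1}. h (z, t)) -` O' \<inter> topspace S"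
          unfolding KU(1) using path[OF wS] wS by simp
      qed
      then show "\<exists>T. openin S T \<and> z \<in> T \<and> T \<subseteq> (\<lambda>z. \<lambda>t\<in>{0..1}. h (z, t)) -` O' \<inter> topspace S"
        using AB by blast
    qed
  qed
  \<comment> \<open>For K = U = {} the subbasic set is the whole path space.\<close>
  have "(\<lambda>z. \<lambda>t\<in>{0..1}. h (z, t)) ` topspace S \<subseteq> ?B {} {}" using path by auto
  then show "(\<lambda>z. \<lambda>t\<in>{0..1}. h (z, t)) ` topspace S \<subseteq> \<Union>{?B K U |K U. compactin (top_of_set {0..1::real}) K \<and> openin X U}"
    by blast
qed

lemma continuous_map_into_path_space1:
  assumes "continuous_map (prod_topology S (top_of_set {0..1})) X h"
    and "\<And>z. z \<in> topspace S \<Longrightarrow> h (z, 0) \<noteq> h (z, 1)"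
  shows "continuous_map S (path_space1 X) (\<lambda>z. \<lambda>t\<in>{0..1}. h (z, t))"
  unfolding path_space1_def continuous_map_in_subtopology
  using continuous_map_curry_path[OF assms(1)] assms(2) by auto

lemma continuous_map_uncurry_path1:
  assumes "continuous_map S (path_space1 X) s"
  shows "continuous_map (prod_topology S (top_of_set {0..1})) X (\<lambda>(z, t). s z t)"
  using assms unfolding path_space1_def continuous_map_in_subtopology
  by (intro continuous_map_uncurry_path) auto

text \<open>By adjunction: uncurry, substitute 1 - t, curry again.\<close>

lemma continuous_map_rev_path: "continuous_map (path_space1 X) (path_space1 X) rev_path"
proof -
  have "continuous_map (prod_topology (path_space1 X) (top_of_set {0..1})) (prod_topology (path_space1 X) (top_of_set {0..1::real}))
      (\<lambda>p. (fst p, 1 - snd p))"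
  proof (intro continuous_map_pairedI continuous_map_fst)
    have "continuous_map (top_of_set {0..1::real}) (top_of_set {0..1}) (\<lambda>t. 1 - t)"
      by (auto simp: continuous_map_in_subtopology intro!: continuous_intros)
    from continuous_map_compose[OF continuous_map_snd[of "path_space1 X"] this]
    show "continuous_map (prod_topology (path_space1 X) (top_of_set {0..1})) (top_of_set {0..1::real}) (\<lambda>p. 1 - snd p)"
      by (simp add: o_def)
  qed
  then have "continuous_map (prod_topology (path_space1 X) (top_of_set {0..1})) X ((\<lambda>(z, t). z t) \<circ> (\<lambda>p. (fst p, 1 - snd p)))"
    using continuous_map_uncurry_path1[OF continuous_map_id[unfolded id_def]] by (rule continuous_map_compose)
  then have "continuous_map (path_space1 X) (path_space1 X) (\<lambda>z. \<lambda>t\<in>{0..1}. ((\<lambda>(z, t). z t) \<circ> (\<lambda>p. (fst p, 1 - snd p))) (z, t))"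
    by (rule continuous_map_into_path_space1) (auto simp: topspace_path_space1)
  then show ?thesis
    by (rule continuous_map_eq) (simp add: rev_path_def)
qed

lemma continuous_map_path_eval:
  assumes "t \<in> {0..1}"
  shows "continuous_map (path_space1 X) X (\<lambda>\<gamma>. \<gamma> t)"
proof -
  have "continuous_map (path_space1 X) X ((\<lambda>(z, t). z t) \<circ> (\<lambda>\<gamma>. (\<gamma>, t)))"
  proof (rule continuous_map_compose)
    show "continuous_map (path_space1 X) (prod_topology (path_space1 X) (top_of_set {0..1})) (\<lambda>\<gamma>. (\<gamma>, t))"
      using assms by (intro continuous_map_pairedI) auto
  qed (use continuous_map_uncurry_path1[OF continuous_map_id[unfolded id_def]] in auto)
  then show ?thesis by (simp add: o_def)
qed

lemma continuous_map_ev1: "continuous_map (path_space1 X) (conf2 X) ev1"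
proof -
  have "continuous_map (path_space1 X) (prod_topology X X) (\<lambda>\<gamma>. (\<gamma> 0, \<gamma> 1))"
    by (intro continuous_map_pairedI continuous_map_path_eval) auto
  then show ?thesis
    unfolding conf2_def continuous_map_in_subtopology
    by (auto simp: ev1_def[abs_def] topspace_path_space1)
qed

lemma continuous_map_swap_conf2: "continuous_map (conf2 X) (conf2 X) prod.swap"
proof -
  have "continuous_map (prod_topology X X) (prod_topology X X) (\<lambda>z. (snd z, fst z))"
    by (intro continuous_map_pairedI continuous_map_fst continuous_map_snd)
  then have "continuous_map (conf2 X) (prod_topology X X) (\<lambda>z. (snd z, fst z))"
    unfolding conf2_def by (rule continuous_map_from_subtopology)
  then show ?thesis
    unfolding conf2_def continuous_map_in_subtopology
    by (auto simp: prod.swap_def[abs_def])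
qed

lemma orbit_eq_iff:
  assumes "\<sigma> (\<sigma> x) = x" "\<sigma> (\<sigma> y) = y"
  shows "{x, \<sigma> x} = {y, \<sigma> y} \<longleftrightarrow> x = y \<or> x = \<sigma> y"
  using assms by (auto simp: doubleton_eq_iff)

text \<open>The saturation of an open U is U together with its preimage under
  \<open>\<sigma>\<close>, which is open again.\<close>

lemma open_map_orbit_space:
  assumes \<sigma>: "continuous_map T T \<sigma>" and inv: "\<And>x. x \<in> topspace T \<Longrightarrow> \<sigma> (\<sigma> x) = x"
  shows "open_map T (orbit_space T \<sigma>) (\<lambda>x. {x, \<sigma> x})"
  unfolding open_map_def
proof (intro allI impI)
  fix U assume U: "openin T U"
  have sub: "U \<subseteq> topspace T" using openin_subset[OF U] .
  have "{x \<in> topspace T. {x, \<sigma> x} \<in> (\<lambda>x. {x, \<sigma> x}) ` U} = U \<union> {x \<in> topspace T. \<sigma> x \<in> U}"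
  proof (intro set_eqI iffI)
    fix x assume "x \<in> {x \<in> topspace T. {x, \<sigma> x} \<in> (\<lambda>x. {x, \<sigma> x}) ` U}"
    then obtain y where y: "x \<in> topspace T" "y \<in> U" "{x, \<sigma> x} = {y, \<sigma> y}" by blast
    then have "x = y \<or> x = \<sigma> y" using orbit_eq_iff[of \<sigma> x y] inv sub by blast
    then show "x \<in> U \<union> {x \<in> topspace T. \<sigma> x \<in> U}" using y inv sub by auto
  next
    fix x assume x: "x \<in> U \<union> {x \<in> topspace T. \<sigma> x \<in> U}"
    then have "{x, \<sigma> x} = {\<sigma> x, \<sigma> (\<sigma> x)}" using inv sub by auto
    then show "x \<in> {x \<in> topspace T. {x, \<sigma> x} \<in> (\<lambda>x. {x, \<sigma> x}) ` U}" using x sub by blast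
  qed
  moreover have "openin T {x \<in> topspace T. \<sigma> x \<in> U}"
    by (rule openin_continuous_map_preimage[OF \<sigma> U])
  ultimately show "openin (orbit_space T \<sigma>) ((\<lambda>x. {x, \<sigma> x}) ` U)"
    using U sub by (auto simp: openin_orbit_space)
qed

text \<open>By equivariance the orbit of \<open>s z\<close> depends only on the orbit of z, and the
  quotient map restricted to the saturated open set V is still a quotient map; hence the induced map
  on orbits is continuous.\<close>

lemma equivariant_section_descends:
  assumes V: "openin (conf2 X) V" "prod.swap ` V \<subseteq> V"
    and s: "continuous_map (subtopology (conf2 X) V) (path_space1 X) s"
      "\<And>z. z \<in> V \<Longrightarrow> ev1 (s z) = z" "\<And>z. z \<in> V \<Longrightarrow> s (prod.swap z) = rev_path (s z)"
  defines "U \<equiv> (\<lambda>z. {z, prod.swap z}) ` V"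
  shows "openin (uconf2 X) U"
    and "\<exists>\<sigma>. continuous_map (subtopology (uconf2 X) U) (path_space2 X) \<sigma> \<and> (\<forall>b\<in>U. ev2 (\<sigma> b) = b)"
proof -
  let ?q = "\<lambda>z. {z, prod.swap z}" and ?q' = "\<lambda>\<gamma>. {\<gamma>, rev_path \<gamma>}"
  show oU: "openin (uconf2 X) U"
    using open_map_orbit_space[OF continuous_map_swap_conf2[of X]] V(1)
    unfolding U_def uconf2_def open_map_def by simp
  have Vsub: "V \<subseteq> topspace (conf2 X)" using openin_subset[OF V(1)] .
  have pre: "{z \<in> topspace (conf2 X). ?q z \<in> U} = V"
  proof (intro set_eqI iffI)
    fix z assume "z \<in> {z \<in> topspace (conf2 X). ?q z \<in> U}"
    then obtain w where w: "w \<in> V" "?q z = ?q w" by (auto simp: U_def)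
    then have "z = w \<or> z = prod.swap w" using orbit_eq_iff[of prod.swap z w] by simp
    then show "z \<in> V" using w V(2) by blast
  qed (use Vsub in \<open>auto simp: U_def\<close>)
  have quo: "quotient_map (subtopology (conf2 X) V) (subtopology (uconf2 X) U) ?q"
    using quotient_map_restriction[OF quotient_map_orbit_space pre[unfolded uconf2_def]] oU
    by (simp add: uconf2_def)
  have sp: "s z \<in> topspace (path_space1 X)" if "z \<in> V" for z
    using continuous_map_image_subset_topspace[OF s(1)] that Vsub by auto
  have orb: "?q' (s (prod.swap z)) = ?q' (s z)" if "z \<in> V" for z
    using rev_path_in_path_space1(2)[OF sp[OF that]] s(3)[OF that] by auto
  \<comment> \<open>Some representative of the orbit b is chosen; \<open>orb\<close> shows that the
    other one would give the same orbit of paths.\<close>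
  define \<sigma> where "\<sigma> b = ?q' (s (SOME z. z \<in> b))" for b
  have \<sigma>q: "\<sigma> (?q z) = ?q' (s z)" if "z \<in> V" for z
  proof -
    have "(SOME w. w \<in> ?q z) \<in> ?q z" by (rule someI[of _ z]) simp
    then consider "(SOME w. w \<in> ?q z) = z" | "(SOME w. w \<in> ?q z) = prod.swap z" by blast
    then show ?thesis
      by cases (simp_all only: \<sigma>_def orb[OF that])
  qed
  have "continuous_map (subtopology (conf2 X) V) (path_space2 X) (?q' \<circ> s)"
    unfolding path_space2_def
    by (rule continuous_map_compose[OF s(1) quotient_imp_continuous_map[OF quotient_map_orbit_space]])
  then have "continuous_map (subtopology (conf2 X) V) (path_space2 X) (\<sigma> \<circ> ?q)"
    by (rule continuous_map_eq) (use \<sigma>q in auto)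
  then have "continuous_map (subtopology (uconf2 X) U) (path_space2 X) \<sigma>"
    by (rule continuous_compose_quotient_map[OF quo])
  moreover have "ev2 (\<sigma> b) = b" if b: "b \<in> U" for b
  proof -
    obtain z where z: "z \<in> V" "b = ?q z" using b by (auto simp: U_def)
    have "ev1 (rev_path (s z)) = prod.swap z"
      using rev_path_in_path_space1(4)[OF sp[OF z(1)]] s(2)[OF z(1)] by simp
    then show ?thesis using \<sigma>q[OF z(1)] s(2)[OF z(1)] z(2) by (simp add: ev2_def)
  qed
  ultimately show "\<exists>\<sigma>. continuous_map (subtopology (uconf2 X) U) (path_space2 X) \<sigma> \<and> (\<forall>b\<in>U. ev2 (\<sigma> b) = b)"
    by blast
qed

text \<open>Disjoint neighbourhoods of the two coordinates do it. The result tells the two lifts of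
  an orbit of paths apart, uniformly near z.\<close>

lemma separated_swap_nbhd:
  assumes X: "Hausdorff_space X" and z: "z \<in> topspace (conf2 X)"
  obtains N where "openin (conf2 X) N" "z \<in> N" "\<And>w. w \<in> N \<Longrightarrow> prod.swap w \<notin> N"
proof -
  obtain x y where xy: "z = (x, y)" "x \<in> topspace X" "y \<in> topspace X" "x \<noteq> y"
    using z by (auto simp: topspace_conf2)
  obtain A B where AB: "openin X A" "openin X B" "x \<in> A" "y \<in> B" "disjnt A B"
    using X xy unfolding Hausdorff_space_def by metis
  have "openin (prod_topology X X) (A \<times> B)" using AB by (simp add: openin_prod_Times_iff)
  then have "openin (conf2 X) ((A \<times> B) \<inter> {(x, y). x \<noteq> y})"
    unfolding conf2_def openin_subtopology by blast
  then show ?thesis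
    by (rule that) (use xy AB in \<open>auto simp: disjnt_iff\<close>)
qed

text \<open>Of the two paths in the orbit over {z, swap z} exactly one has the endpoints z in this
  order, because swap fixes no pair of distinct points; it is the lift. Uniqueness gives
  equivariance. Continuity is local: over N the condition \<open>ev1 \<gamma> \<in> N\<close>
  singles out the right path of each orbit.\<close>

lemma section_lifts:
  assumes X: "Hausdorff_space X" and U: "openin (uconf2 X) U"
    and \<sigma>: "continuous_map (subtopology (uconf2 X) U) (path_space2 X) \<sigma>" "\<And>b. b \<in> U \<Longrightarrow> ev2 (\<sigma> b) = b"
  defines "V \<equiv> {z \<in> topspace (conf2 X). {z, prod.swap z} \<in> U}"
  shows "openin (conf2 X) V" "prod.swap ` V \<subseteq> V"
    "\<exists>s. continuous_map (subtopology (conf2 X) V) (path_space1 X) s \<and>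
       (\<forall>z\<in>V. ev1 (s z) = z \<and> s (prod.swap z) = rev_path (s z))"
proof -
  let ?q = "\<lambda>z. {z, prod.swap z}" and ?q' = "\<lambda>\<gamma>. {\<gamma>, rev_path \<gamma>}"
  show oV: "openin (conf2 X) V"
    using U unfolding V_def uconf2_def openin_orbit_space by blast
  show sV: "prod.swap ` V \<subseteq> V"
    by (auto simp: V_def topspace_conf2 insert_commute)
  have Vsub: "V \<subseteq> topspace (conf2 X)" by (auto simp: V_def)
  have Usub: "U \<subseteq> topspace (uconf2 X)" using openin_subset[OF U] .
  have ex: "\<exists>\<gamma>. \<gamma> \<in> topspace (path_space1 X) \<and> \<sigma> (?q z) = ?q' \<gamma> \<and> ev1 \<gamma> = z" if z: "z \<in> V" for z
  proof -
    have "?q z \<in> topspace (subtopology (uconf2 X) U)" using z Usub by (auto simp: V_def)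
    then have "\<sigma> (?q z) \<in> topspace (path_space2 X)"
      using continuous_map_image_subset_topspace[OF \<sigma>(1)] by blast
    then obtain \<gamma> where g: "\<gamma> \<in> topspace (path_space1 X)" "\<sigma> (?q z) = ?q' \<gamma>"
      by (auto simp: path_space2_def)
    note r = rev_path_in_path_space1[OF g(1)]
    have "ev2 (?q' \<gamma>) = ?q z" using \<sigma>(2)[of "?q z"] z g(2) by (simp add: V_def)
    then have "{ev1 \<gamma>, prod.swap (ev1 \<gamma>)} = {z, prod.swap z}" using r(4) by (simp add: ev2_def)
    then have "ev1 \<gamma> = z \<or> ev1 \<gamma> = prod.swap z" by (simp add: orbit_eq_iff)
    then show ?thesis
    proof
      assume "ev1 \<gamma> = prod.swap z"
      then have "ev1 (rev_path \<gamma>) = z" using r(4) by simp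
      moreover have "\<sigma> (?q z) = ?q' (rev_path \<gamma>)" using g(2) r(2) by auto
      ultimately show ?thesis using r(1) by blast
    qed (use g in blast)
  qed
  then obtain s where s: "\<And>z. z \<in> V \<Longrightarrow> s z \<in> topspace (path_space1 X)"
      "\<And>z. z \<in> V \<Longrightarrow> \<sigma> (?q z) = ?q' (s z)" "\<And>z. z \<in> V \<Longrightarrow> ev1 (s z) = z" by metis
  have uniq: "s z = \<gamma>" if "z \<in> V" "\<sigma> (?q z) = ?q' \<gamma>" "ev1 \<gamma> = z" "\<gamma> \<in> topspace (path_space1 X)" for z \<gamma>
  proof -
    have "s z = \<gamma> \<or> s z = rev_path \<gamma>" using s(2)[OF that(1)] that(2) by auto
    moreover have "s z \<noteq> rev_path \<gamma>"
    proof
      assume "s z = rev_path \<gamma>"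
      then have "z = prod.swap z"
        using s(3)[OF that(1)] rev_path_in_path_space1(4)[OF that(4)] that(3) by simp
      then show False using that(1) Vsub by (auto simp: topspace_conf2 prod.swap_def)
    qed
    ultimately show ?thesis by blast
  qed
  have eqv: "s (prod.swap z) = rev_path (s z)" if z: "z \<in> V" for z
  proof (rule uniq)
    show "prod.swap z \<in> V" using sV z by blast
    show "\<sigma> (?q (prod.swap z)) = ?q' (rev_path (s z))"
      using s(2)[OF z] rev_path_in_path_space1(2)[OF s(1)[OF z]] by (simp add: insert_commute)
    show "ev1 (rev_path (s z)) = prod.swap z"
      using rev_path_in_path_space1(4)[OF s(1)[OF z]] s(3)[OF z] by simp
  qed (use rev_path_in_path_space1(1)[OF s(1)[OF z]] in auto)
  have "continuous_map (subtopology (conf2 X) V) (path_space1 X) s"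
    unfolding continuous_map_def
  proof (intro conjI allI impI)
    show "s \<in> topspace (subtopology (conf2 X) V) \<rightarrow> topspace (path_space1 X)" using s(1) by auto
    fix W assume W: "openin (path_space1 X) W"
    let ?P = "{z \<in> topspace (subtopology (conf2 X) V). s z \<in> W}"
    show "openin (subtopology (conf2 X) V) ?P"
    proof (subst openin_subopen, intro ballI)
      fix z assume z: "z \<in> ?P"
      then have zV: "z \<in> V" "z \<in> topspace (conf2 X)" by auto
      obtain N where N: "openin (conf2 X) N" "z \<in> N" "\<And>w. w \<in> N \<Longrightarrow> prod.swap w \<notin> N"
        using separated_swap_nbhd[OF X zV(2)] by blast
      \<comment> \<open>The image of \<open>?W\<close> in the orbit space is open, and an orbit in
        this image has only one member with endpoints in N, since N never contains both w and its
        swap.\<close>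
      let ?W = "W \<inter> {\<gamma> \<in> topspace (path_space1 X). ev1 \<gamma> \<in> N}"
      have "openin (path_space1 X) ?W"
        using W openin_continuous_map_preimage[OF continuous_map_ev1 N(1)] by blast
      moreover have "open_map (path_space1 X) (path_space2 X) ?q'"
        unfolding path_space2_def
        by (rule open_map_orbit_space[OF continuous_map_rev_path]) (rule rev_path_in_path_space1(2))
      ultimately have "openin (path_space2 X) (?q' ` ?W)"
        unfolding open_map_def by blast
      then have 1: "openin (subtopology (uconf2 X) U) {b \<in> topspace (subtopology (uconf2 X) U). \<sigma> b \<in> ?q' ` ?W}"
        by (rule openin_continuous_map_preimage[OF \<sigma>(1)])
      have "continuous_map (subtopology (conf2 X) V) (uconf2 X) ?q"
        unfolding uconf2_def
        by (rule continuous_map_from_subtopology[OF quotient_imp_continuous_map[OF quotient_map_orbit_space]])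
      then have "continuous_map (subtopology (conf2 X) V) (subtopology (uconf2 X) U) ?q"
        by (auto simp: continuous_map_in_subtopology V_def)
      from openin_continuous_map_preimage[OF this 1]
      have 2: "openin (subtopology (conf2 X) V) {w \<in> topspace (subtopology (conf2 X) V).
          ?q w \<in> {b \<in> topspace (subtopology (uconf2 X) U). \<sigma> b \<in> ?q' ` ?W}}" (is "openin _ ?A") .
      have 3: "openin (subtopology (conf2 X) V) (?A \<inter> (V \<inter> N))"
        using 2 N(1) by (simp add: openin_Int openin_subtopology_Int2)
      have "z \<in> ?A \<inter> (V \<inter> N)"
        using z zV N(2) s[OF zV(1)] Usub by (auto simp: V_def image_iff)
      moreover have "?A \<inter> (V \<inter> N) \<subseteq> ?P"
      proof
        fix w assume w: "w \<in> ?A \<inter> (V \<inter> N)"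
        then obtain \<gamma> where g: "\<gamma> \<in> W" "\<gamma> \<in> topspace (path_space1 X)" "ev1 \<gamma> \<in> N" "\<sigma> (?q w) = ?q' \<gamma>"
          by auto
        have wV: "w \<in> V" "w \<in> N" using w by auto
        have "?q' \<gamma> = ?q' (s w)" using g(4) s(2)[OF wV(1)] by simp
        then have "\<gamma> = s w \<or> \<gamma> = rev_path (s w)" by auto
        moreover have "\<gamma> \<noteq> rev_path (s w)"
        proof
          assume "\<gamma> = rev_path (s w)"
          then have "ev1 \<gamma> = prod.swap w"
            using rev_path_in_path_space1(4)[OF s(1)[OF wV(1)]] s(3)[OF wV(1)] by simp
          then show False using N(3)[OF wV(2)] g(3) by simp
        qed
        ultimately show "w \<in> ?P" using g(1) wV(1) Vsub by auto
      qed
      ultimately show "\<exists>T. openin (subtopology (conf2 X) V) T \<and> z \<in> T \<and> T \<subseteq> ?P"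
        using 3 by blast
    qed
  qed
  then show "\<exists>s. continuous_map (subtopology (conf2 X) V) (path_space1 X) s \<and>
       (\<forall>z\<in>V. ev1 (s z) = z \<and> s (prod.swap z) = rev_path (s z))"
    using s(3) eqv by blast
qed

section \<open>Extending sections over neighbourhoods\<close>

text \<open>The outward journey uses the first coordinate of the homotopy and the return the second,
  so that swapping z reverses the path. Its ends are the two distinct coordinates of z, which is all
  that \<open>path_space1\<close> asks for.\<close>

lemma extend_section_over_ndr:
  assumes F: "equivariant_ndr X F"
    and s: "continuous_map (subtopology (conf2 X) F) (path_space1 X) s"
      "\<And>z. z \<in> F \<Longrightarrow> ev1 (s z) = z" "\<And>z. z \<in> F \<Longrightarrow> s (prod.swap z) = rev_path (s z)"
  shows "\<exists>U s'. openin (conf2 X) U \<and> F \<subseteq> U \<and> prod.swap ` U \<subseteq> U \<and>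
    continuous_map (subtopology (conf2 X) U) (path_space1 X) s' \<and>
    (\<forall>z\<in>U. ev1 (s' z) = z \<and> s' (prod.swap z) = rev_path (s' z))"
proof -
  obtain U r h where U: "openin (conf2 X) U" "F \<subseteq> U" "prod.swap ` U \<subseteq> U"
    and r: "continuous_map (subtopology (conf2 X) U) (subtopology (conf2 X) F) r"
      "swap_equivariant_on U r"
    and h: "continuous_map (prod_topology (top_of_set {0..1::real}) (subtopology (conf2 X) U)) (conf2 X) h"
      "\<And>z. h (0, z) = r z" "\<And>z. h (1, z) = z" "\<And>t. t \<in> {0..1} \<Longrightarrow> swap_equivariant_on U (\<lambda>z. h (t, z))"
    using F unfolding equivariant_ndr_def retraction_maps_def homotopic_with_def id_def by metis
  have Usub: "U \<subseteq> topspace (conf2 X)" using openin_subset[OF U(1)] .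
  have Fsub: "F \<subseteq> topspace (conf2 X)" using U(2) Usub by blast
  let ?S = "subtopology (conf2 X) U" and ?I = "top_of_set {0..1::real}"
  let ?P = "prod_topology ?S ?I"
  have rF: "r z \<in> F" if "z \<in> U" for z
    using continuous_map_image_subset_topspace[OF r(1)] that Usub by auto
  have sp: "s z \<in> topspace (path_space1 X)" if "z \<in> F" for z
    using continuous_map_image_subset_topspace[OF s(1)] that Fsub by auto
  have srs: "s (r (prod.swap z)) = rev_path (s (r z))" if "z \<in> U" for z
    using r(2) s(3)[OF rF[OF that]] that by (simp add: swap_equivariant_on_def)
  have hs: "h (t, prod.swap z) = prod.swap (h (t, z))" if "z \<in> U" "t \<in> {0..1}" for z t
    using h(4)[OF that(2)] that(1) by (simp add: swap_equivariant_on_def)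
  \<comment> \<open>Clocks for the three thirds of the time: \<open>c1\<close> falls from 1 to 0,
    then \<open>c2\<close> and finally \<open>c3\<close> rise from 0 to 1. The homotopy is
    \<open>r\<close> at time 0 and the identity at time 1, so \<open>c1\<close> leads from z to
    \<open>r z\<close> and \<open>c3\<close> leads back.\<close>
  define c1 c2 c3 :: "real \<Rightarrow> real" where
    "c1 t = max 0 (1 - 3 * t)" and "c2 t = max 0 (min 1 (3 * t - 1))" and "c3 t = max 0 (3 * t - 2)" for t
  have c: "continuous_map ?I ?I c1" "continuous_map ?I ?I c2" "continuous_map ?I ?I c3"
    unfolding c1_def c2_def c3_def
    by (auto simp: continuous_map_in_subtopology intro!: continuous_intros)
  have hc: "continuous_map ?P (conf2 X) (\<lambda>p. h (c' (snd p), fst p))" if "continuous_map ?I ?I c'" for c'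
  proof -
    have "continuous_map ?P (prod_topology ?I ?S) (\<lambda>p. (c' (snd p), fst p))"
      using continuous_map_compose[OF continuous_map_snd[of ?S ?I] that]
      by (intro continuous_map_pairedI continuous_map_fst) (simp add: o_def)
    from continuous_map_compose[OF this h(1)] show ?thesis by (simp add: o_def)
  qed
  have coord: "continuous_map (conf2 X) X fst" "continuous_map (conf2 X) X snd"
    unfolding conf2_def by (auto intro: continuous_map_from_subtopology continuous_map_fst continuous_map_snd)
  have k1: "continuous_map ?P X (\<lambda>p. fst (h (c1 (snd p), fst p)))"
    using continuous_map_compose[OF hc[OF c(1)] coord(1)] by (simp add: o_def)
  have k3: "continuous_map ?P X (\<lambda>p. snd (h (c3 (snd p), fst p)))"
    using continuous_map_compose[OF hc[OF c(3)] coord(2)] by (simp add: o_def)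
  have "continuous_map ?P (prod_topology (subtopology (conf2 X) F) ?I) (\<lambda>p. (r (fst p), c2 (snd p)))"
    using continuous_map_compose[OF continuous_map_snd[of ?S ?I] c(2)]
      continuous_map_compose[OF continuous_map_fst[of ?S ?I] r(1)]
    by (intro continuous_map_pairedI) (simp_all add: o_def)
  from continuous_map_compose[OF this continuous_map_uncurry_path1[OF s(1)]]
  have k2: "continuous_map ?P X (\<lambda>p. s (r (fst p)) (c2 (snd p)))" by (simp add: o_def)
  define k where "k p = (if snd p \<le> 1/3 then fst (h (c1 (snd p), fst p))
      else if snd p \<le> 2/3 then s (r (fst p)) (c2 (snd p)) else snd (h (c3 (snd p), fst p)))" for p
  have srz: "s (r z) 0 = fst (r z)" "s (r z) 1 = snd (r z)" if "z \<in> U" for z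
    using s(2)[OF rF[OF that]] by (auto simp: ev1_def prod_eq_iff)
  have sndc: "continuous_map ?P euclideanreal snd"
    by (rule continuous_map_into_fulltopology[OF continuous_map_snd])
  have k23: "continuous_map ?P X
      (\<lambda>p. if snd p \<le> 2/3 then s (r (fst p)) (c2 (snd p)) else snd (h (c3 (snd p), fst p)))"
  proof (rule continuous_map_cases_le[OF sndc _ continuous_map_from_subtopology[OF k2] continuous_map_from_subtopology[OF k3]])
    fix p assume p: "p \<in> topspace ?P" "snd p = 2/3"
    then have z: "fst p \<in> U" by auto
    show "s (r (fst p)) (c2 (snd p)) = snd (h (c3 (snd p), fst p))"
      using p srz[OF z] by (simp add: c2_def c3_def h(2))
  qed simp
  have kcont: "continuous_map ?P X k"
    unfolding k_def
  proof (rule continuous_map_cases_le[OF sndc _ continuous_map_from_subtopology[OF k1] continuous_map_from_subtopology[OF k23]])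
    fix p assume p: "p \<in> topspace ?P" "snd p = 1/3"
    then have z: "fst p \<in> U" by auto
    show "fst (h (c1 (snd p), fst p)) =
        (if snd p \<le> 2/3 then s (r (fst p)) (c2 (snd p)) else snd (h (c3 (snd p), fst p)))"
      using p srz[OF z] by (simp add: c1_def c2_def h(2))
  qed simp
  have k0: "k (z, 0) = fst z" and k1': "k (z, 1) = snd z" for z
    by (simp_all add: k_def c1_def c3_def h(3))
  have ksw: "k (prod.swap z, t) = k (z, 1 - t)" if z: "z \<in> U" and t: "t \<in> {0..1}" for z t
  proof -
    \<comment> \<open>At t = 2/3 the definition of \<open>k\<close> still takes the middle branch.
      Both formulas agree there, so the last one holds on the closed third, as the comparison with
      the closed first third requires.\<close>
    have p: "k (z, t) = snd (h (c3 t, z))" if "2/3 \<le> t" "z \<in> U" for z t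
    proof (cases "t = 2/3")
      case True
      then show ?thesis using srz[OF that(2)] by (simp add: k_def c2_def c3_def h(2))
    next
      case False
      then show ?thesis using that by (simp add: k_def)
    qed
    have sz: "prod.swap z \<in> U" using U(3) z by blast
    consider "t \<le> 1/3" | "1/3 < t" "t < 2/3" | "2/3 \<le> t" by linarith
    then show ?thesis
    proof cases
      case 1
      have e: "c3 (1 - t) = c1 t" by (simp add: c1_def c3_def)
      have "c1 t \<in> {0..1}" using t by (auto simp: c1_def)
      then show ?thesis using 1 p[of "1 - t" z] z hs[OF z] by (simp add: e) (simp add: k_def)
    next
      case 2
      have "s (r (prod.swap z)) (c2 t) = s (r z) (1 - c2 t)"
        using 2 t by (simp add: srs[OF z] rev_path_def c2_def)
      moreover have "1 - c2 t = c2 (1 - t)" using 2 by (simp add: c2_def)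
      ultimately show ?thesis using 2 by (simp add: k_def)
    next
      case 3
      have e: "c1 (1 - t) = c3 t" by (simp add: c1_def c3_def)
      have "c3 t \<in> {0..1}" using t by (auto simp: c3_def)
      then show ?thesis using 3 p[of t "prod.swap z"] sz hs[OF z] by (simp add: k_def[of "(z, 1 - t)"] e)
    qed
  qed
  define s' where "s' z = (\<lambda>t\<in>{0..1}. k (z, t))" for z
  have "continuous_map ?S (path_space1 X) s'"
    unfolding s'_def[abs_def]
    by (rule continuous_map_into_path_space1[OF kcont]) (use Usub k0 k1' in \<open>auto simp: topspace_conf2\<close>)
  moreover have "\<forall>z\<in>U. ev1 (s' z) = z \<and> s' (prod.swap z) = rev_path (s' z)"
    using ksw by (auto simp: s'_def ev1_def k0 k1' rev_path_def fun_eq_iff)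
  ultimately show ?thesis using U by blast
qed

section \<open>Second countability of the configuration space and countable subcovers\<close>

lemma second_countable_prod_topology:
  assumes "second_countable X" "second_countable Y"
  shows "second_countable (prod_topology X Y)"
proof -
  obtain \<B> where B: "countable \<B>" "\<And>V. V \<in> \<B> \<Longrightarrow> openin X V"
      "\<And>U x. openin X U \<Longrightarrow> x \<in> U \<Longrightarrow> \<exists>V\<in>\<B>. x \<in> V \<and> V \<subseteq> U"
    using assms(1) unfolding second_countable_def by metis
  obtain \<C> where C: "countable \<C>" "\<And>V. V \<in> \<C> \<Longrightarrow> openin Y V"
      "\<And>U x. openin Y U \<Longrightarrow> x \<in> U \<Longrightarrow> \<exists>V\<in>\<C>. x \<in> V \<and> V \<subseteq> U"
    using assms(2) unfolding second_countable_def by metis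
  show ?thesis
    unfolding second_countable_def
  proof (intro exI[of _ "(\<lambda>(V, W). V \<times> W) ` (\<B> \<times> \<C>)"] conjI ballI allI impI)
    fix U p assume U: "openin (prod_topology X Y) U \<and> p \<in> U"
    then obtain V W where VW: "openin X V" "openin Y W" "fst p \<in> V" "snd p \<in> W" "V \<times> W \<subseteq> U"
      unfolding openin_prod_topology_alt by (metis prod.collapse)
    obtain V' W' where "V' \<in> \<B>" "fst p \<in> V'" "V' \<subseteq> V" "W' \<in> \<C>" "snd p \<in> W'" "W' \<subseteq> W"
      using B(3)[OF VW(1,3)] C(3)[OF VW(2,4)] by blast
    then show "\<exists>V\<in>(\<lambda>(V, W). V \<times> W) ` (\<B> \<times> \<C>). p \<in> V \<and> V \<subseteq> U"
      using VW(5) by (intro bexI[of _ "V' \<times> W'"]) (auto simp: mem_Times_iff)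
  qed (use B C in \<open>auto simp: openin_prod_Times_iff\<close>)
qed

lemma second_countable_conf2: "second_countable X \<Longrightarrow> second_countable (conf2 X)"
  unfolding conf2_def by (intro second_countable_subtopology second_countable_prod_topology)

text \<open>The Lindelof property for covers indexed by data: the sequence consists of labels
  satisfying \<open>P\<close> rather than of open sets, since charts with signs, or pushes, have to
  be carried along. Each basic set contained in some \<open>N x\<close> selects one label.\<close>

lemma second_countable_sequence:
  assumes T: "second_countable T"
    and P: "\<And>a. a \<in> A \<Longrightarrow> \<exists>x. P x \<and> openin T (N x) \<and> a \<in> N x" and d: "P d"
  obtains s :: "nat \<Rightarrow> 'b" where "\<And>j. P (s j)" "A \<subseteq> (\<Union>j. N (s j))"
proof -
  obtain \<B> where B: "countable \<B>" "\<And>U x. openin T U \<Longrightarrow> x \<in> U \<Longrightarrow> \<exists>V\<in>\<B>. x \<in> V \<and> V \<subseteq> U"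
    using T unfolding second_countable_def by metis
  \<comment> \<open>The default \<open>d\<close> serves basic sets contained in no
    \<open>N x\<close>, and it keeps the set of labels to be enumerated nonempty.\<close>
  define f where "f V = (if \<exists>x. P x \<and> V \<subseteq> N x then SOME x. P x \<and> V \<subseteq> N x else d)" for V
  have f: "P (f V)" "(\<exists>x. P x \<and> V \<subseteq> N x) \<Longrightarrow> V \<subseteq> N (f V)" for V
    using someI_ex[of "\<lambda>x. P x \<and> V \<subseteq> N x"] d by (auto simp: f_def)
  define s where "s = from_nat_into (insert d (f ` \<B>))"
  have rng: "range s = insert d (f ` \<B>)"
    unfolding s_def by (rule range_from_nat_into) (use B(1) in auto)
  show ?thesis
  proof (rule that)
    show "P (s j)" for j
    proof -
      have "s j \<in> insert d (f ` \<B>)" using rng by blast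
      then show ?thesis using f(1) d by (elim insertE imageE) simp_all
    qed
    show "A \<subseteq> (\<Union>j. N (s j))"
    proof
      fix a assume "a \<in> A"
      then obtain x where x: "P x" "openin T (N x)" "a \<in> N x" using P by blast
      then obtain V where V: "V \<in> \<B>" "a \<in> V" "V \<subseteq> N x" using B(2) by blast
      then have "a \<in> N (f V)" using f(2)[of V] x(1) by blast
      moreover have "f V \<in> range s" using rng V(1) by blast
      ultimately show "a \<in> (\<Union>j. N (s j))" by auto
    qed
  qed
qed

section \<open>Functions of class C^{1,1} on Euclidean space\<close>

definition Eu :: "nat \<Rightarrow> (nat \<Rightarrow> real) set" where
  "Eu m = {x. \<forall>i\<ge>m. x i = 0}"

text \<open>The l1-distance in the first m coordinates: a linear form with coefficients at most L is
  bounded by L times this distance, with no factor depending on m.\<close>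

definition dst :: "nat \<Rightarrow> (nat \<Rightarrow> real) \<Rightarrow> (nat \<Rightarrow> real) \<Rightarrow> real" where
  "dst m x y = (\<Sum>l<m. \<bar>x l - y l\<bar>)"

definition dball :: "nat \<Rightarrow> (nat \<Rightarrow> real) \<Rightarrow> real \<Rightarrow> (nat \<Rightarrow> real) set" where
  "dball m p r = {y \<in> Eu m. dst m y p < r}"

text \<open>
  Differentiability is expressed by first-order approximations with a uniform quadratic error.
  This class is closed under composition without any appeal to partial derivatives, and
  it controls both the values and the coefficients of the approximating affine functions.
\<close>

definition jets :: "nat \<Rightarrow> real \<Rightarrow> (nat \<Rightarrow> real) set \<Rightarrow> ((nat \<Rightarrow> real) \<Rightarrow> real) \<Rightarrow> ((nat \<Rightarrow> real) \<Rightarrow> nat \<Rightarrow> real) \<Rightarrow> bool" where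
  "jets m L S f D \<longleftrightarrow> (\<forall>x\<in>S. \<forall>y\<in>S. (\<forall>l<m. \<bar>D x l\<bar> \<le> L) \<and>
     \<bar>f y - f x - (\<Sum>l<m. D x l * (y l - x l))\<bar> \<le> L * (dst m x y)\<^sup>2)"

definition C11_on :: "nat \<Rightarrow> (nat \<Rightarrow> real) set \<Rightarrow> ((nat \<Rightarrow> real) \<Rightarrow> real) \<Rightarrow> bool" where
  "C11_on m S f \<longleftrightarrow> (\<exists>L D. jets m L S f D)"

definition C11_at :: "nat \<Rightarrow> ((nat \<Rightarrow> real) \<Rightarrow> real) \<Rightarrow> (nat \<Rightarrow> real) \<Rightarrow> bool" where
  "C11_at m f p \<longleftrightarrow> (\<exists>r>0. C11_on m (dball m p r) f)"

lemma dst_nonneg [simp]: "0 \<le> dst m x y"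
  by (simp add: dst_def sum_nonneg)

lemma dst_self [simp]: "dst m x x = 0"
  by (simp add: dst_def)

lemma dst_commute: "dst m x y = dst m y x"
  by (simp add: dst_def abs_minus_commute)

lemma dst_triangle: "dst m x z \<le> dst m x y + dst m y z"
  unfolding dst_def sum.distrib[symmetric] by (intro sum_mono) linarith

lemma coord_le_dst: "l < m \<Longrightarrow> \<bar>x l - y l\<bar> \<le> dst m x y"
  unfolding dst_def by (rule member_le_sum) auto

lemma dball_mono: "r \<le> s \<Longrightarrow> dball m p r \<subseteq> dball m p s"
  by (auto simp: dball_def)

lemma dst_in_dball: "x \<in> dball m p r \<Longrightarrow> y \<in> dball m p r \<Longrightarrow> dst m x y < 2 * r"
  using dst_triangle[of m x y p] dst_commute[of m y p] by (auto simp: dball_def)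

lemma jets_nonneg:
  assumes "jets m L S f D" "x \<in> S" "0 < m"
  shows "0 \<le> L"
proof -
  have "\<bar>D x 0\<bar> \<le> L" using assms by (auto simp: jets_def)
  then show ?thesis by linarith
qed

lemma jets_mono:
  assumes "jets m L S f D" "L \<le> L'" "T \<subseteq> S"
  shows "jets m L' T f D"
  unfolding jets_def
proof (intro ballI conjI allI impI)
  fix x y assume xy: "x \<in> T" "y \<in> T"
  then have J: "(\<forall>l<m. \<bar>D x l\<bar> \<le> L)"
      "\<bar>f y - f x - (\<Sum>l<m. D x l * (y l - x l))\<bar> \<le> L * (dst m x y)\<^sup>2"
    using assms unfolding jets_def by blast+
  show "\<bar>f y - f x - (\<Sum>l<m. D x l * (y l - x l))\<bar> \<le> L' * (dst m x y)\<^sup>2"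
    using J(2) mult_right_mono[OF assms(2), of "(dst m x y)\<^sup>2"] by simp
  show "\<bar>D x l\<bar> \<le> L'" if "l < m" for l using J(1) that assms(2) by force
qed

lemma C11_on_jets_pos:
  assumes "C11_on m S f"
  obtains L D where "0 < L" "jets m L S f D"
proof -
  obtain L D where "jets m L S f D" using assms by (auto simp: C11_on_def)
  then have "jets m (max L 1) S f D" by (rule jets_mono) auto
  then show ?thesis by (intro that[of "max L 1"]) auto
qed

lemma C11_on_subset: "C11_on m S f \<Longrightarrow> T \<subseteq> S \<Longrightarrow> C11_on m T f"
  unfolding C11_on_def by (meson jets_mono order_refl)

lemma C11_on_cong:
  assumes "C11_on m S f" "\<And>x. x \<in> S \<Longrightarrow> f x = g x"
  shows "C11_on m S g"
proof -
  obtain L D where "jets m L S f D" using assms(1) by (auto simp: C11_on_def)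
  then have "jets m L S g D" using assms(2) by (simp add: jets_def)
  then show ?thesis by (auto simp: C11_on_def)
qed

lemma C11_at_cong:
  assumes "C11_at m f p" "0 < r" "\<And>x. x \<in> dball m p r \<Longrightarrow> f x = g x"
  shows "C11_at m g p"
proof -
  obtain s where s: "0 < s" "C11_on m (dball m p s) f"
    using assms(1) by (auto simp: C11_at_def)
  have "C11_on m (dball m p (min r s)) f"
    by (rule C11_on_subset[OF s(2)]) (auto simp: dball_def)
  then have "C11_on m (dball m p (min r s)) g"
    by (rule C11_on_cong) (auto simp: dball_def intro: assms(3))
  then show ?thesis
    unfolding C11_at_def using assms(2) s(1) by (intro exI[of _ "min r s"]) auto
qed

lemma C11_on_add:
  assumes "C11_on m S f" "C11_on m S g"
  shows "C11_on m S (\<lambda>x. f x + g x)"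
proof -
  obtain L D where D: "jets m L S f D" using assms(1) by (auto simp: C11_on_def)
  obtain K E where E: "jets m K S g E" using assms(2) by (auto simp: C11_on_def)
  have "jets m (L + K) S (\<lambda>x. f x + g x) (\<lambda>x l. D x l + E x l)"
    unfolding jets_def
  proof (intro ballI conjI allI impI)
    fix x y assume xy: "x \<in> S" "y \<in> S"
    have 1: "\<bar>f y - f x - (\<Sum>l<m. D x l * (y l - x l))\<bar> \<le> L * (dst m x y)\<^sup>2"
      and 2: "\<bar>g y - g x - (\<Sum>l<m. E x l * (y l - x l))\<bar> \<le> K * (dst m x y)\<^sup>2"
      using D E xy by (auto simp: jets_def)
    have "f y + g y - (f x + g x) - (\<Sum>l<m. (D x l + E x l) * (y l - x l))
        = (f y - f x - (\<Sum>l<m. D x l * (y l - x l))) + (g y - g x - (\<Sum>l<m. E x l * (y l - x l)))"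
      by (simp only: distrib_right sum.distrib)
    then show "\<bar>f y + g y - (f x + g x) - (\<Sum>l<m. (D x l + E x l) * (y l - x l))\<bar> \<le> (L + K) * (dst m x y)\<^sup>2"
      using 1 2 by (simp add: ring_distribs)
    fix l assume "l < m"
    then have "\<bar>D x l\<bar> \<le> L" "\<bar>E x l\<bar> \<le> K" using D E xy by (auto simp: jets_def)
    then show "\<bar>D x l + E x l\<bar> \<le> L + K" by linarith
  qed
  then show ?thesis unfolding C11_on_def by blast
qed

lemma jets_scale:
  assumes "jets m L S f D"
  shows "jets m (\<bar>c\<bar> * L) S (\<lambda>x. c * f x) (\<lambda>x l. c * D x l)"
  unfolding jets_def
proof (intro ballI conjI allI impI)
  fix x y assume xy: "x \<in> S" "y \<in> S"
  have 1: "\<bar>f y - f x - (\<Sum>l<m. D x l * (y l - x l))\<bar> \<le> L * (dst m x y)\<^sup>2"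
    using assms xy by (auto simp: jets_def)
  have "c * f y - c * f x - (\<Sum>l<m. c * D x l * (y l - x l))
      = c * (f y - f x - (\<Sum>l<m. D x l * (y l - x l)))"
    by (simp add: right_diff_distrib sum_distrib_left mult.assoc)
  then have "\<bar>c * f y - c * f x - (\<Sum>l<m. c * D x l * (y l - x l))\<bar>
      = \<bar>c\<bar> * \<bar>f y - f x - (\<Sum>l<m. D x l * (y l - x l))\<bar>"
    by (simp only: abs_mult)
  also have "\<dots> \<le> \<bar>c\<bar> * (L * (dst m x y)\<^sup>2)"
    using 1 by (rule mult_left_mono) simp
  finally show "\<bar>c * f y - c * f x - (\<Sum>l<m. c * D x l * (y l - x l))\<bar> \<le> \<bar>c\<bar> * L * (dst m x y)\<^sup>2"
    by (simp add: mult.assoc)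
  fix l assume "l < m"
  then have "\<bar>D x l\<bar> \<le> L" using assms xy by (auto simp: jets_def)
  then show "\<bar>c * D x l\<bar> \<le> \<bar>c\<bar> * L" by (simp add: abs_mult mult_left_mono)
qed

lemma C11_on_scale: "C11_on m S f \<Longrightarrow> C11_on m S (\<lambda>x. c * f x)"
  unfolding C11_on_def using jets_scale by blast

lemma C11_on_zero: "C11_on m S (\<lambda>x. 0)"
  unfolding C11_on_def jets_def by (intro exI[of _ 0] exI[of _ "\<lambda>_ _. 0"]) auto

lemma C11_on_sum:
  "finite I \<Longrightarrow> (\<And>i. i \<in> I \<Longrightarrow> C11_on m S (f i)) \<Longrightarrow> C11_on m S (\<lambda>x. \<Sum>i\<in>I. f i x)"
  by (induction I rule: finite_induct) (auto intro: C11_on_zero C11_on_add)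

lemma jets_Lipschitz:
  assumes "jets m L S f D" "x \<in> S" "y \<in> S" "0 \<le> L"
  shows "\<bar>f y - f x\<bar> \<le> L * (1 + dst m x y) * dst m x y"
proof -
  have 1: "\<bar>f y - f x - (\<Sum>l<m. D x l * (y l - x l))\<bar> \<le> L * (dst m x y)\<^sup>2"
    using assms by (auto simp: jets_def)
  have "\<bar>\<Sum>l<m. D x l * (y l - x l)\<bar> \<le> (\<Sum>l<m. \<bar>D x l * (y l - x l)\<bar>)" by (rule sum_abs)
  also have "\<dots> \<le> (\<Sum>l<m. L * \<bar>x l - y l\<bar>)"
    using assms by (intro sum_mono) (auto simp: jets_def abs_mult abs_minus_commute intro!: mult_right_mono)
  also have "\<dots> = L * dst m x y" by (simp add: dst_def sum_distrib_left)
  finally show ?thesis using 1 by (simp add: power2_eq_square algebra_simps)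
qed

text \<open>Meant for predicates that may also encode radii: with balls of radius
  \<open>1 / max K 1\<close>, enlarging K shrinks the ball, so one monotone parameter controls radii
  and constants together.\<close>

lemma finite_common_bound:
  fixes P :: "nat \<Rightarrow> real \<Rightarrow> bool"
  assumes "\<And>i. i < n \<Longrightarrow> \<exists>L. P i L" "\<And>i L L'. P i L \<Longrightarrow> L \<le> L' \<Longrightarrow> P i L'"
  shows "\<exists>L\<ge>1. \<forall>i<n. P i L"
  using assms(1)
proof (induction n)
  case (Suc n)
  then obtain L where L: "L \<ge> 1" "\<forall>i<n. P i L" by auto
  obtain K where K: "P n K" using Suc.prems by auto
  have "\<forall>i<Suc n. P i (max L K)"
    using L(2) K assms(2) by (metis less_Suc_eq max.cobounded1 max.cobounded2)
  then show ?case using L(1) by (meson max.cobounded1 order_trans)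
qed auto

text \<open>The chain rule with remainders: the outer error is quadratic in the distance of
  \<open>G x\<close> and \<open>G y\<close>, which is at most a constant times that of x and y on a
  set of bounded diameter; the inner errors are weighted by the bounded outer coefficients.\<close>

lemma C11_on_compose:
  assumes f: "C11_on m' T f"
    and G: "\<And>i. i < m' \<Longrightarrow> C11_on m S (\<lambda>y. G y i)"
    and GT: "\<And>y. y \<in> S \<Longrightarrow> G y \<in> T"
    and B: "\<And>x y. x \<in> S \<Longrightarrow> y \<in> S \<Longrightarrow> dst m x y \<le> B"
  shows "C11_on m S (\<lambda>y. f (G y))"
proof -
  obtain K E where K: "0 < K" "jets m' K T f E" using C11_on_jets_pos[OF f] .
  define P where "P i L \<longleftrightarrow> (\<exists>D. jets m L S (\<lambda>y. G y i) D)" for i L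
  have "\<exists>L\<ge>1. \<forall>i<m'. P i L"
  proof (rule finite_common_bound)
    show "\<exists>L. P i L" if "i < m'" for i using G[OF that] by (auto simp: P_def C11_on_def)
    show "P i L'" if "P i L" "L \<le> L'" for i L L'
      using that unfolding P_def by (blast intro: jets_mono)
  qed
  then obtain L where L: "L \<ge> 1" "\<forall>i<m'. P i L" by auto
  then have "\<forall>i. \<exists>D. i < m' \<longrightarrow> jets m L S (\<lambda>y. G y i) D" by (auto simp: P_def)
  then obtain D where D: "\<And>i. i < m' \<Longrightarrow> jets m L S (\<lambda>y. G y i) (D i)" by metis
  define H where "H = (\<lambda>x l. \<Sum>i<m'. E (G x) i * D i x l)"
  \<comment> \<open>A Lipschitz constant of \<open>G\<close> in the l1-distance: m' coordinates,
    each with the constant L (1 + B).\<close>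
  define C where "C = real m' * (L * (1 + B))"
  have "jets m (real m' * K * L + K * C\<^sup>2) S (\<lambda>y. f (G y)) H"
    unfolding jets_def
  proof (intro ballI conjI allI impI)
    fix x y assume xy: "x \<in> S" "y \<in> S"
    have Eb: "\<bar>E (G x) i\<bar> \<le> K" if "i < m'" for i
      using K(2) GT[OF xy(1)] that by (auto simp: jets_def)
    let ?d = "dst m x y"
    define R where "R i = G y i - G x i - (\<Sum>l<m. D i x l * (y l - x l))" for i
    have R: "\<bar>R i\<bar> \<le> L * ?d\<^sup>2" if "i < m'" for i
      using D[OF that] xy by (auto simp: jets_def R_def)
    have "dst m' (G x) (G y) \<le> (\<Sum>i<m'. L * (1 + B) * ?d)"
      unfolding dst_def
    proof (rule sum_mono)
      fix i assume i: "i \<in> {..<m'}"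
      then have "\<bar>G y i - G x i\<bar> \<le> L * (1 + ?d) * ?d"
        using jets_Lipschitz[OF D xy, of i] L(1) by auto
      also have "\<dots> \<le> L * (1 + B) * ?d"
        using B[OF xy] L(1) by (intro mult_right_mono mult_left_mono) auto
      finally show "\<bar>G x i - G y i\<bar> \<le> L * (1 + B) * (\<Sum>l<m. \<bar>x l - y l\<bar>)"
        by (simp add: dst_def abs_minus_commute)
    qed
    then have "dst m' (G x) (G y) \<le> C * ?d" by (simp add: C_def mult.assoc)
    then have "(dst m' (G x) (G y))\<^sup>2 \<le> (C * ?d)\<^sup>2" by (intro power_mono) auto
    then have d2: "K * (dst m' (G x) (G y))\<^sup>2 \<le> K * C\<^sup>2 * ?d\<^sup>2"
      using K(1) by (simp add: power_mult_distrib)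
    have f1: "\<bar>f (G y) - f (G x) - (\<Sum>i<m'. E (G x) i * (G y i - G x i))\<bar> \<le> K * (dst m' (G x) (G y))\<^sup>2"
      using K(2) GT xy by (auto simp: jets_def)
    have "(\<Sum>l<m. H x l * (y l - x l)) = (\<Sum>i<m'. E (G x) i * (\<Sum>l<m. D i x l * (y l - x l)))"
      unfolding H_def sum_distrib_right sum_distrib_left by (subst sum.swap) (simp add: mult.assoc)
    then have "(\<Sum>i<m'. E (G x) i * (G y i - G x i)) - (\<Sum>l<m. H x l * (y l - x l))
        = (\<Sum>i<m'. E (G x) i * R i)"
      unfolding R_def by (simp add: right_diff_distrib sum_subtractf)
    moreover have "\<bar>\<Sum>i<m'. E (G x) i * R i\<bar> \<le> (\<Sum>i<m'. K * (L * ?d\<^sup>2))"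
      using Eb R K(1) by (intro order_trans[OF sum_abs] sum_mono) (auto simp: abs_mult intro!: mult_mono)
    ultimately show "\<bar>f (G y) - f (G x) - (\<Sum>l<m. H x l * (y l - x l))\<bar>
        \<le> (real m' * K * L + K * C\<^sup>2) * ?d\<^sup>2"
      using f1 d2 by (simp add: algebra_simps)
    fix l assume l: "l < m"
    have "\<bar>H x l\<bar> \<le> (\<Sum>i<m'. K * L)"
      unfolding H_def using Eb D xy l K(1)
      by (intro order_trans[OF sum_abs] sum_mono) (auto simp: abs_mult jets_def intro!: mult_mono)
    also have "\<dots> \<le> real m' * K * L + K * C\<^sup>2" using K(1) by simp
    finally show "\<bar>H x l\<bar> \<le> real m' * K * L + K * C\<^sup>2" .
  qed
  then show ?thesis unfolding C11_on_def by blast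
qed

lemma C11_at_compose:
  assumes f: "C11_at m' f (G p)"
    and G: "\<And>i. i < m' \<Longrightarrow> C11_at m (\<lambda>y. G y i) p"
    and E: "0 < r" "\<And>y. y \<in> dball m p r \<Longrightarrow> G y \<in> Eu m'" and p: "p \<in> Eu m"
  shows "C11_at m (\<lambda>y. f (G y)) p"
proof -
  obtain R where R: "0 < R" "C11_on m' (dball m' (G p) R) f" using f by (auto simp: C11_at_def)
  define P where "P i K \<longleftrightarrow> C11_on m (dball m p (1/(max K 1))) (\<lambda>y. G y i) \<and>
      (\<exists>L D. 0 < L \<and> 1 + L \<le> K \<and> jets m L (dball m p (1 / (max K 1))) (\<lambda>y. G y i) D)" for i and K :: real
  have "\<exists>K\<ge>1. \<forall>i<m'. P i K"
  proof (rule finite_common_bound)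
    show "P i L'" if "P i L" "L \<le> L'" for i L L'
    proof -
      have s: "dball m p (1 / max L' 1) \<subseteq> dball m p (1 / max L 1)"
        using that(2) by (intro dball_mono divide_left_mono) auto
      show ?thesis using that s unfolding P_def
        by (meson C11_on_subset dual_order.trans jets_mono order_refl)
    qed
    show "\<exists>L. P i L" if i: "i < m'" for i
    proof -
      obtain s where s: "0 < s" "C11_on m (dball m p s) (\<lambda>y. G y i)"
        using G[OF i] by (auto simp: C11_at_def)
      obtain L D where L: "0 < L" "jets m L (dball m p s) (\<lambda>y. G y i) D"
        using C11_on_jets_pos[OF s(2)] .
      define K where "K = max (1 / s) (1 + L)"
      have "1 / s \<le> max K 1" by (auto simp: K_def)
      then have "1 / max K 1 \<le> s" using s(1) by (simp add: field_simps)
      then have sub: "dball m p (1 / max K 1) \<subseteq> dball m p s" by (rule dball_mono)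
      show ?thesis
        unfolding P_def
        apply (rule exI[of _ K])
        apply (intro conjI exI[of _ L] exI[of _ D])
        subgoal using C11_on_subset[OF s(2) sub] .
        subgoal using L(1) .
        subgoal by (simp add: K_def)
        subgoal using jets_mono[OF L(2) order_refl sub] .
        done
    qed
  qed
  then obtain K where K: "K \<ge> 1" "\<forall>i<m'. P i K" by auto
  \<comment> \<open>Within distance s \<le> 1 of p each coordinate of \<open>G\<close> deviates by
    at most 2 K times the distance; m' + 1 instead of m' keeps the divisor positive and makes the
    final inequality strict.\<close>
  define s where "s = min (min r (1 / K)) (R / (real (m' + 1) * (2 * K)))"
  have s: "0 < s" "s \<le> r" "s \<le> 1 / K" "s \<le> R / (real (m' + 1) * (2 * K))"
    using E(1) K(1) R(1) by (auto simp: s_def)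
  have "s \<le> 1" using s(3) K(1) by (smt (verit) divide_le_eq_1)
  have mK: "max K 1 = K" using K(1) by simp
  have "C11_on m (dball m p s) (\<lambda>y. f (G y))"
  proof (rule C11_on_compose[OF R(2)])
    show "C11_on m (dball m p s) (\<lambda>y. G y i)" if "i < m'" for i
      using K(2) that s(3) unfolding P_def mK by (meson C11_on_subset dball_mono)
    show "dst m x y \<le> 2 * s" if "x \<in> dball m p s" "y \<in> dball m p s" for x y
      using dst_in_dball[OF that] by simp
    fix y assume y: "y \<in> dball m p s"
    have dp: "dst m p y < s" using y by (auto simp: dball_def dst_commute)
    have "\<bar>G y i - G p i\<bar> \<le> 2 * K * dst m p y" if i: "i < m'" for i
    proof -
      obtain L D where L: "0 < L" "1 + L \<le> K" "jets m L (dball m p (1 / K)) (\<lambda>y. G y i) D"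
        using K(2) i unfolding P_def mK by blast
      have "\<bar>G y i - G p i\<bar> \<le> L * (1 + dst m p y) * dst m p y"
        using jets_Lipschitz[OF L(3), of p y] L(1) y s K(1) p
        by (auto simp: dball_def)
      also have "\<dots> \<le> K * 2 * dst m p y"
        using L dp \<open>s \<le> 1\<close> by (intro mult_right_mono mult_mono) auto
      finally show ?thesis by simp
    qed
    then have "dst m' (G y) (G p) \<le> (\<Sum>i<m'. 2 * K * dst m p y)"
      unfolding dst_def[of m'] by (intro sum_mono) auto
    also have "\<dots> \<le> real m' * (2 * K) * s" using dp K(1) by (simp add: mult.assoc mult_left_mono)
    also have "\<dots> < real (m' + 1) * (2 * K) * s" using s K(1) by simp
    also have "\<dots> \<le> R" using s(4) K(1) pos_le_divide_eq[of "real (m' + 1) * (2 * K)" s R]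
      by (simp add: mult.commute)
    finally show "G y \<in> dball m' (G p) R"
      using E(2)[of y] y s(2) by (auto simp: dball_def)
  qed
  then show ?thesis using s(1) by (auto simp: C11_at_def)
qed

lemma C11_at_affine: "C11_at m (\<lambda>y. c + k * y l) p" if "l < m"
proof -
  have "jets m \<bar>k\<bar> (dball m p 1) (\<lambda>y. c + k * y l) (\<lambda>x j. if j = l then k else 0)"
    unfolding jets_def
  proof (intro ballI conjI allI impI)
    fix x y :: "nat \<Rightarrow> real"
    have "(\<Sum>j<m. (if j = l then k else 0) * (y j - x j)) = (\<Sum>j<m. if j = l then k * (y j - x j) else 0)"
      by (intro sum.cong) auto
    also have "\<dots> = k * (y l - x l)" using that by simp
    finally show "\<bar>c + k * y l - (c + k * x l) - (\<Sum>j<m. (if j = l then k else 0) * (y j - x j))\<bar>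
        \<le> \<bar>k\<bar> * (dst m x y)\<^sup>2"
      by (simp add: right_diff_distrib)
  qed auto
  then show ?thesis unfolding C11_at_def C11_on_def by (intro exI[of _ 1]) auto
qed

lemma C11_at_const: "C11_at m (\<lambda>y. c) p"
proof -
  have "jets m 0 (dball m p 1) (\<lambda>y. c) (\<lambda>x j. 0)"
    unfolding jets_def by auto
  then show ?thesis unfolding C11_at_def C11_on_def by (intro exI[of _ 1]) auto
qed

text \<open>All products are obtained by composing this single function of two variables with a
  pair. Its first-order error is exactly the product of the two coordinate differences.\<close>

lemma C11_at_mult_coords: "C11_at 2 (\<lambda>y. y 0 * y 1) p"
proof -
  have "jets 2 (\<bar>p 0\<bar> + \<bar>p 1\<bar> + 1) (dball 2 p 1) (\<lambda>y. y 0 * y 1) (\<lambda>x j. if j = 0 then x 1 else x 0)"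
    unfolding jets_def
  proof (intro ballI conjI allI impI)
    fix x y assume x: "x \<in> dball 2 p 1" and y: "y \<in> dball 2 p 1"
    have c: "\<bar>x l - p l\<bar> \<le> 1" if "l < 2" for l
      using coord_le_dst[of l 2 x p] x that by (auto simp: dball_def)
    show "\<bar>if l = 0 then x 1 else x 0\<bar> \<le> \<bar>p 0\<bar> + \<bar>p 1\<bar> + 1" if "l < 2" for l
      using c[of 0] c[of 1] by auto
    have e: "(\<Sum>l<2. (if l = 0 then x 1 else x 0) * (y l - x l)) = x 1 * (y 0 - x 0) + x 0 * (y 1 - x 1)"
      by (simp add: numeral_2_eq_2)
    have "\<bar>y 0 * y 1 - x 0 * x 1 - (x 1 * (y 0 - x 0) + x 0 * (y 1 - x 1))\<bar> = \<bar>x 0 - y 0\<bar> * \<bar>x 1 - y 1\<bar>"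
      unfolding abs_mult[symmetric] by (simp add: algebra_simps)
    also have "\<dots> \<le> dst 2 x y * dst 2 x y"
      using coord_le_dst[of 0 2 x y] coord_le_dst[of 1 2 x y] by (intro mult_mono) auto
    also have "\<dots> \<le> (\<bar>p 0\<bar> + \<bar>p 1\<bar> + 1) * (dst 2 x y)\<^sup>2"
      using mult_right_mono[of 1 "\<bar>p 0\<bar> + \<bar>p 1\<bar> + 1" "(dst 2 x y)\<^sup>2"] by (simp add: power2_eq_square)
    finally show "\<bar>y 0 * y 1 - x 0 * x 1 - (\<Sum>l<2. (if l = 0 then x 1 else x 0) * (y l - x l))\<bar>
        \<le> (\<bar>p 0\<bar> + \<bar>p 1\<bar> + 1) * (dst 2 x y)\<^sup>2" unfolding e .
  qed
  then show ?thesis unfolding C11_at_def C11_on_def by (intro exI[of _ 1]) auto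
qed

lemma C11_at_mult:
  assumes "C11_at m f p" "C11_at m g p" "p \<in> Eu m"
  shows "C11_at m (\<lambda>y. f y * g y) p"
proof -
  let ?G = "\<lambda>y i. if i = 0 then f y else if i = Suc 0 then g y else 0"
  have "C11_at m (\<lambda>y. ?G y 0 * ?G y 1) p"
  proof (rule C11_at_compose[where f="\<lambda>y. y 0 * y 1" and G="?G" and m'=2 and r=1])
    show "C11_at m (\<lambda>y. ?G y i) p" if "i < 2" for i
      using that assms by (cases "i = 0") (auto simp: less_2_cases_iff)
  qed (use C11_at_mult_coords assms in \<open>auto simp: Eu_def\<close>)
  then show ?thesis by simp
qed

lemma C11_at_prod:
  assumes "finite I" "\<And>i. i \<in> I \<Longrightarrow> C11_at m (f i) p" "p \<in> Eu m"
  shows "C11_at m (\<lambda>y. \<Prod>i\<in>I. f i y) p"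
  using assms(1,2) by (induction I rule: finite_induct) (auto intro: C11_at_const C11_at_mult assms(3))

text \<open>The squared positive part has a Lipschitz derivative, although its second derivative
  jumps at 0. It is the building block of the bumps.\<close>

lemma pos_part_square_bound:
  "\<bar>(max 0 t)\<^sup>2 - (max 0 s)\<^sup>2 - 2 * max 0 s * (t - s)\<bar> \<le> (t - s)\<^sup>2" for s t :: real
proof -
  have sq: "0 \<le> s * s" "0 \<le> t * t" by auto
  have ts: "(t - s)\<^sup>2 = t * t + s * s - 2 * (s * t)"
    by (simp add: power2_eq_square algebra_simps)
  have st: "s * t \<le> 0" if "0 \<le> s \<and> t \<le> 0 \<or> s \<le> 0 \<and> 0 \<le> t"
    using that by (auto simp: mult_le_0_iff)
  consider "0 \<le> s" "0 \<le> t" | "0 \<le> s" "t \<le> 0" | "s \<le> 0" "0 \<le> t" | "s \<le> 0" "t \<le> 0"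
    by linarith
  then show ?thesis
  proof cases
    case 1
    then have "max 0 s = s" "max 0 t = t" by auto
    then have "(max 0 t)\<^sup>2 - (max 0 s)\<^sup>2 - 2 * max 0 s * (t - s) = (t - s)\<^sup>2"
      by (simp add: power2_eq_square algebra_simps)
    then show ?thesis by simp
  next
    case 2
    then have "max 0 s = s" "max 0 t = 0" by auto
    then have "(max 0 t)\<^sup>2 - (max 0 s)\<^sup>2 - 2 * max 0 s * (t - s) = s * s - 2 * (s * t)"
      by (simp add: power2_eq_square algebra_simps)
    then show ?thesis using st 2 sq ts by linarith
  next
    case 3
    then have "max 0 s = 0" "max 0 t = t" by auto
    then have "(max 0 t)\<^sup>2 - (max 0 s)\<^sup>2 - 2 * max 0 s * (t - s) = t * t"
      by (simp add: power2_eq_square)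
    then show ?thesis using st 3 sq ts by linarith
  next
    case 4
    then have "max 0 s = 0" "max 0 t = 0" by auto
    then show ?thesis by simp
  qed
qed

lemma C11_at_pos_part_square: "C11_at 1 (\<lambda>y. (max 0 (y 0))\<^sup>2) p"
proof -
  have "jets 1 (2 * \<bar>p 0\<bar> + 2) (dball 1 p 1) (\<lambda>y. (max 0 (y 0))\<^sup>2) (\<lambda>x j. 2 * max 0 (x 0))"
    unfolding jets_def
  proof (intro ballI conjI allI impI)
    fix x y assume x: "x \<in> dball 1 p 1" and y: "y \<in> dball 1 p 1"
    have c: "\<bar>x 0 - p 0\<bar> \<le> 1"
      using coord_le_dst[of 0 1 x p] x by (auto simp: dball_def)
    then show "\<bar>2 * max 0 (x 0)\<bar> \<le> 2 * \<bar>p 0\<bar> + 2" by auto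
    have "\<bar>(max 0 (y 0))\<^sup>2 - (max 0 (x 0))\<^sup>2 - (\<Sum>l<1. 2 * max 0 (x 0) * (y l - x l))\<bar> \<le> (dst 1 x y)\<^sup>2"
      using pos_part_square_bound[of "y 0" "x 0"] by (simp add: dst_def power2_commute[of "x 0" "y 0"])
    also have "\<dots> \<le> (2 * \<bar>p 0\<bar> + 2) * (dst 1 x y)\<^sup>2"
      using mult_right_mono[of 1 "2 * \<bar>p 0\<bar> + 2" "(dst 1 x y)\<^sup>2"] by simp
    finally show "\<bar>(max 0 (y 0))\<^sup>2 - (max 0 (x 0))\<^sup>2 - (\<Sum>l<1. 2 * max 0 (x 0) * (y l - x l))\<bar>
        \<le> (2 * \<bar>p 0\<bar> + 2) * (dst 1 x y)\<^sup>2" .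
  qed
  then show ?thesis unfolding C11_at_def C11_on_def by (intro exI[of _ 1]) auto
qed

text \<open>Squaring removes the kink of the positive part at the faces of the cube of half-width 2.
  On the cube of half-width 3/2 every factor is at least 1, as 4 - 9/4 > 1.\<close>

definition bump :: "nat \<Rightarrow> (nat \<Rightarrow> real) \<Rightarrow> real" where
  "bump m y = (\<Prod>l<m. (max 0 (4 - (y l)\<^sup>2))\<^sup>2)"

lemma C11_at_bump:
  assumes p: "p \<in> Eu m"
  shows "C11_at m (bump m) p"
  unfolding bump_def[abs_def]
proof (rule C11_at_prod)
  fix l assume "l \<in> {..<m}"
  then have l: "l < m" by simp
  have c: "C11_at m (\<lambda>y. 0 + 1 * y l) p" and n: "C11_at m (\<lambda>y. 0 + (-1) * y l) p"
    by (rule C11_at_affine[OF l])+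
  have 1: "C11_at m (\<lambda>y. (-1) * (y l)\<^sup>2) p"
    using C11_at_mult[OF c n p] by (simp add: power2_eq_square)
  \<comment> \<open>A real number is viewed as a point of \<open>Eu 1\<close>, so that functions of
    one variable can be composed.\<close>
  let ?G = "\<lambda>(y::nat \<Rightarrow> real) (i::nat). if i = 0 then (-1) * (y l)\<^sup>2 else 0"
  have 2: "C11_at m (\<lambda>y. 4 + 1 * ?G y 0) p"
    by (rule C11_at_compose[where f="\<lambda>y. 4 + 1 * y 0" and G="?G" and m'=1 and r=1])
       (use 1 p C11_at_affine[of 0 1 4 1] in \<open>auto simp: Eu_def simp del: One_nat_def\<close>)
  let ?H = "\<lambda>(y::nat \<Rightarrow> real) (i::nat). if i = 0 then 4 - (y l)\<^sup>2 else 0"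
  have "C11_at m (\<lambda>y. (max 0 (?H y 0))\<^sup>2) p"
    by (rule C11_at_compose[where f="\<lambda>y. (max 0 (y 0))\<^sup>2" and G="?H" and m'=1 and r=1])
       (use 2 p C11_at_pos_part_square in \<open>auto simp: Eu_def simp del: One_nat_def\<close>)
  then show "C11_at m (\<lambda>y. (max 0 (4 - (y l)\<^sup>2))\<^sup>2) p" by simp
qed (auto simp: p)

section \<open>Cubes, balls and the topology of \<open>Eu m\<close>\<close>

definition ccub :: "nat \<Rightarrow> real \<Rightarrow> (nat \<Rightarrow> real) set" where
  "ccub m r = {y \<in> Eu m. \<forall>l<m. \<bar>y l\<bar> \<le> r}"

definition ocub :: "nat \<Rightarrow> real \<Rightarrow> (nat \<Rightarrow> real) set" where
  "ocub m r = {y \<in> Eu m. \<forall>l<m. \<bar>y l\<bar> < r}"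

lemma Euclidean_space_eq: "Euclidean_space m = top_of_set (Eu m)"
  by (simp add: Euclidean_space_def Eu_def euclidean_product_topology)

lemma continuous_on_coord [continuous_intros]: "continuous_on S (\<lambda>y::nat \<Rightarrow> real. y l)"
  by (rule continuous_on_subset[OF continuous_on_product_coordinates]) simp

lemma continuous_on_dst [continuous_intros]:
  "continuous_on S f \<Longrightarrow> continuous_on S g \<Longrightarrow> continuous_on S (\<lambda>y. dst m (f y) (g y))"
  unfolding dst_def by (intro continuous_intros) (auto intro: continuous_on_product_then_coordinatewise)

lemma open_dst: "open {y. dst m y p < r}"
  by (intro open_Collect_less continuous_intros)

text \<open>The ambient topology is the product topology on all sequences. Points of
  \<open>Eu m\<close> agree from coordinate m on, so only finitely many factors restrict the
  radius.\<close>

lemma open_contains_dball: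
  assumes W: "open W" "p \<in> W" and p: "p \<in> Eu m"
  obtains r where "0 < r" "dball m p r \<subseteq> W"
proof -
  obtain X where X: "p \<in> (\<Pi>\<^sub>E i\<in>UNIV. X i)" "\<And>i. open (X i)" "(\<Pi>\<^sub>E i\<in>UNIV. X i) \<subseteq> W"
    using product_topology_open_contains_basis[of "\<lambda>_. euclidean" UNIV W p] W
    by (auto simp: open_fun_def)
  have "\<exists>e. 0 < e \<and> (\<forall>t. \<bar>t - p l\<bar> < e \<longrightarrow> t \<in> X l)" for l
  proof -
    have "p l \<in> X l" using X(1) by auto
    then obtain e where "e > 0" "\<forall>t. dist t (p l) < e \<longrightarrow> t \<in> X l"
      using X(2)[of l] unfolding open_dist by blast
    then show ?thesis by (auto simp: dist_real_def)
  qed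
  then obtain e where e: "\<And>l. 0 < e l" "\<And>l t. \<bar>t - p l\<bar> < e l \<Longrightarrow> t \<in> X l" by metis
  \<comment> \<open>The element 1 keeps the minimum defined for m = 0.\<close>
  define r where "r = Min (insert 1 (e ` {..<m}))"
  have r: "0 < r" "\<And>l. l < m \<Longrightarrow> r \<le> e l" using e(1) by (auto simp: r_def)
  have "y l \<in> X l" if y: "y \<in> dball m p r" for y l
  proof (cases "l < m")
    case True
    have "\<bar>y l - p l\<bar> \<le> dst m y p" by (rule coord_le_dst[OF True])
    then show ?thesis using y r(2)[OF True] e(2) by (auto simp: dball_def)
  next
    case False
    then have "y l = p l" using y p by (simp add: dball_def Eu_def)
    then show ?thesis using X(1) by auto
  qed
  then have "dball m p r \<subseteq> W" using X(3) by fastforce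
  then show ?thesis using r(1) that by blast
qed

lemma openin_Eu_contains_dball:
  assumes "openin (top_of_set (Eu m)) W" "p \<in> W"
  obtains r where "0 < r" "dball m p r \<subseteq> W"
proof -
  obtain T where T: "open T" "W = Eu m \<inter> T" using assms(1) by (auto simp: openin_open)
  obtain r where "0 < r" "dball m p r \<subseteq> T"
    using open_contains_dball[OF T(1), of p m] T(2) assms(2) by blast
  then show ?thesis using T(2) by (intro that[of r]) (auto simp: dball_def)
qed

lemma openin_ocub: "openin (top_of_set (Eu m)) (ocub m r)"
proof -
  have "open (\<Inter>l\<in>{..<m}. {y::nat \<Rightarrow> real. \<bar>y l\<bar> < r})"
    by (intro open_INT ballI open_Collect_less continuous_intros) auto
  moreover have "ocub m r = Eu m \<inter> (\<Inter>l\<in>{..<m}. {y. \<bar>y l\<bar> < r})" by (auto simp: ocub_def)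
  ultimately show ?thesis by (auto simp: openin_open)
qed

lemma compact_ccub: "compact (ccub m r)"
proof -
  have "ccub m r = (\<Pi>\<^sub>E l\<in>UNIV. if l < m then {-r..r} else {0})"
  proof (rule set_eqI)
    fix y :: "nat \<Rightarrow> real"
    have "y \<in> ccub m r \<longleftrightarrow> (\<forall>l. (l < m \<longrightarrow> \<bar>y l\<bar> \<le> r) \<and> (\<not> l < m \<longrightarrow> y l = 0))"
      unfolding ccub_def Eu_def not_less by blast
    also have "\<dots> \<longleftrightarrow> (\<forall>l. y l \<in> (if l < m then {-r..r} else {0}))"
      by (intro all_cong1) auto
    also have "\<dots> \<longleftrightarrow> y \<in> (\<Pi>\<^sub>E l\<in>UNIV. if l < m then {-r..r} else {0})"
      by (simp only: PiE_iff extensional_UNIV) simp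
    finally show "y \<in> ccub m r \<longleftrightarrow> y \<in> (\<Pi>\<^sub>E l\<in>UNIV. if l < m then {-r..r} else {0})" .
  qed
  moreover have "compactin (product_topology (\<lambda>_. euclidean) UNIV) (\<Pi>\<^sub>E l\<in>UNIV. if l < m then {-r..r} else {0::real})"
    by (subst compactin_PiE) auto
  ultimately show ?thesis by (simp add: euclidean_product_topology)
qed

text \<open>A Lebesgue number argument. Pairs closer than r lie in a common ball with a local
  expansion; for pairs at distance at least r a quadratic bound only costs a constant, since f and
  the coefficients are bounded. The coefficients at x are those of a chosen centre
  \<open>c x\<close>.\<close>

lemma C11_at_subset_compact:
  assumes S: "compact S" "S \<subseteq> Eu m" and f: "\<And>p. p \<in> S \<Longrightarrow> C11_at m f p"
  shows "C11_on m S f"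
proof -
  have "\<exists>r L D. 0 < r \<and> 0 < L \<and> jets m L (dball m p r) f D" if "p \<in> S" for p
    using f[OF that] C11_on_jets_pos unfolding C11_at_def by metis
  then obtain R L D where R: "\<And>p. p \<in> S \<Longrightarrow> 0 < R p" "\<And>p. p \<in> S \<Longrightarrow> 0 < L p"
      "\<And>p. p \<in> S \<Longrightarrow> jets m (L p) (dball m p (R p)) f (D p)" by metis
  have "S \<subseteq> (\<Union>p\<in>S. {y. dst m y p < R p / 2})"
  proof
    fix x assume x: "x \<in> S"
    then have "dst m x x < R x / 2" using R(1) by simp
    then show "x \<in> (\<Union>p\<in>S. {y. dst m y p < R p / 2})" using x by blast
  qed
  then obtain P where P: "P \<subseteq> S" "finite P" "S \<subseteq> (\<Union>p\<in>P. {y. dst m y p < R p / 2})"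
    by (rule compactE_image[OF S(1) open_dst])
  define r where "r = Min (insert 1 ((\<lambda>p. R p / 2) ` P))"
  have r: "r \<le> R p / 2" if "p \<in> P" for p
    unfolding r_def using P(2) that by (intro Min_le) auto
  have r0: "0 < r" using P(1,2) R(1) by (auto simp: r_def subset_iff)
  note r = r0 r
  define K where "K = (\<Sum>p\<in>P. L p)"
  have K: "L p \<le> K" if "p \<in> P" for p
    unfolding K_def using P R(2) that by (intro member_le_sum) (auto simp: less_imp_le subset_iff)
  have K0: "0 \<le> K" unfolding K_def using P R(2) by (intro sum_nonneg) (auto simp: less_imp_le subset_iff)
  define b where "b p = \<bar>f p\<bar> + L p * (1 + R p) * R p" for p
  define B where "B = (\<Sum>p\<in>P. b p)"
  have b0: "0 \<le> b p" if "p \<in> P" for p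
  proof -
    have "0 < L p" "0 < R p" using R that P by auto
    then show ?thesis by (simp add: b_def)
  qed
  have B: "\<bar>f y\<bar> \<le> B" if y: "y \<in> S" for y
  proof -
    obtain p where p: "p \<in> P" "dst m y p < R p / 2" using P(3) y by auto
    have pS: "0 < R p" "0 < L p" "jets m (L p) (dball m p (R p)) f (D p)" "p \<in> S" using R p P by auto
    have d: "dst m p y \<le> R p" using p pS by (simp add: dst_commute)
    have "\<bar>f y - f p\<bar> \<le> L p * (1 + dst m p y) * dst m p y"
      using pS p S y by (intro jets_Lipschitz[OF pS(3)]) (auto simp: dball_def)
    also have "\<dots> \<le> L p * (1 + R p) * R p"
      using d pS by (intro mult_mono mult_left_mono) auto
    finally have "\<bar>f y\<bar> \<le> b p" by (simp add: b_def)
    also have "\<dots> \<le> B" unfolding B_def using p(1) b0 P(2) by (intro member_le_sum) auto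
    finally show ?thesis .
  qed
  have "\<forall>x. \<exists>p. x \<in> S \<longrightarrow> p \<in> P \<and> dst m x p < R p / 2" using P(3) by auto
  then obtain c where c: "\<And>x. x \<in> S \<Longrightarrow> c x \<in> P \<and> dst m x (c x) < R (c x) / 2" by metis
  \<comment> \<open>K serves close pairs; for distant ones \<open>2 * B / r\<^sup>2\<close> pays for
    the values of f and \<open>K / r\<close> for the linear part.\<close>
  have "jets m (K + 2 * B / r\<^sup>2 + K / r) S f (\<lambda>x. D (c x) x)"
    unfolding jets_def
  proof (intro ballI conjI allI impI)
    fix x y assume xy: "x \<in> S" "y \<in> S"
    let ?p = "c x" and ?d = "dst m x y"
    have p: "?p \<in> P" "dst m x ?p < R ?p / 2" using c[OF xy(1)] by auto
    have J: "jets m (L ?p) (dball m ?p (R ?p)) f (D ?p)" "0 < L ?p" "0 < R ?p" using R p P by auto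
    have xin: "x \<in> dball m ?p (R ?p)" using p J xy S by (auto simp: dball_def)
    have B0: "0 \<le> B" using B[OF xy(1)] by linarith
    have Db: "\<bar>D ?p x l\<bar> \<le> K" if "l < m" for l
      using J(1) xin that K[OF p(1)] unfolding jets_def by (meson order_trans)
    then show "\<bar>D ?p x l\<bar> \<le> K + 2 * B / r\<^sup>2 + K / r" if "l < m" for l
      using that K0 B0 r(1) by (smt (verit) divide_nonneg_nonneg zero_le_power2)
    show "\<bar>f y - f x - (\<Sum>l<m. D ?p x l * (y l - x l))\<bar> \<le> (K + 2 * B / r\<^sup>2 + K / r) * ?d\<^sup>2"
    proof (cases "?d < r")
      case True
      have "dst m y ?p < R ?p"
        using dst_triangle[of m y ?p x] True p r(2)[OF p(1)] by (simp add: dst_commute)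
      then have yin: "y \<in> dball m ?p (R ?p)" using xy S by (auto simp: dball_def)
      have "\<bar>f y - f x - (\<Sum>l<m. D ?p x l * (y l - x l))\<bar> \<le> L ?p * ?d\<^sup>2"
        using J(1) xin yin by (auto simp: jets_def)
      also have "\<dots> \<le> (K + 2 * B / r\<^sup>2 + K / r) * ?d\<^sup>2"
        using K[OF p(1)] K0 B0 r(1) by (intro mult_right_mono) (auto simp: add_increasing2)
      finally show ?thesis .
    next
      case False
      then have q: "1 \<le> ?d / r" using r(1) by simp
      have "\<bar>\<Sum>l<m. D ?p x l * (y l - x l)\<bar> \<le> (\<Sum>l<m. K * \<bar>x l - y l\<bar>)"
        using Db by (intro order_trans[OF sum_abs] sum_mono)
          (auto simp: abs_mult abs_minus_commute intro!: mult_right_mono)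
      also have "\<dots> = K * ?d" by (simp add: dst_def sum_distrib_left)
      also have "\<dots> \<le> K * ?d * (?d / r)" using q K0 mult_left_mono[OF q, of "K * ?d"] by simp
      also have "\<dots> = K / r * ?d\<^sup>2" by (simp add: power2_eq_square)
      finally have 1: "\<bar>\<Sum>l<m. D ?p x l * (y l - x l)\<bar> \<le> K / r * ?d\<^sup>2" .
      have "2 * B * 1 \<le> 2 * B * (?d / r)\<^sup>2"
        using q B0 by (intro mult_left_mono) auto
      then have "\<bar>f y - f x\<bar> \<le> 2 * B / r\<^sup>2 * ?d\<^sup>2"
        using B[OF xy(1)] B[OF xy(2)] by (simp add: power_divide)
      moreover have "0 \<le> K * ?d\<^sup>2" using K0 by simp
      ultimately show ?thesis using 1 unfolding distrib_right by linarith
    qed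
  qed
  then show ?thesis by (auto simp: C11_on_def)
qed

section \<open>From class C^2 to C^{1,1}\<close>

lemma mean_value_between:
  fixes h :: "real \<Rightarrow> real"
  assumes "\<And>t. min a b \<le> t \<Longrightarrow> t \<le> max a b \<Longrightarrow> (h has_real_derivative h' t) (at t)"
  obtains t where "min a b \<le> t" "t \<le> max a b" "h b - h a = h' t * (b - a)"
proof (cases a b rule: linorder_cases)
  case less
  then obtain t where "a < t" "t < b" "h b - h a = (b - a) * h' t"
    using MVT2[of a b h h'] assms by auto
  then show ?thesis using that[of t] by (auto simp: mult.commute)
next
  case greater
  then obtain t where "b < t" "t < a" "h a - h b = (a - b) * h' t"
    using MVT2[of b a h h'] assms by auto
  then show ?thesis using that[of t] by (auto simp: algebra_simps)
qed (use that in auto)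

text \<open>One coordinate is changed at a time, each time with the one-dimensional mean value
  theorem. An intermediate point takes every coordinate from x, from y or from between them, so it
  may leave the ball of radius r, but not the one of radius 2 r.\<close>

lemma telescoped_mean_value:
  assumes g: "\<And>i x. i < n \<Longrightarrow> x \<in> dball n p (2 * r) \<Longrightarrow>
      ((\<lambda>t. f (x(i := t))) has_real_derivative g i x) (at (x i))"
    and x: "x \<in> dball n p r" and y: "y \<in> dball n p r"
  obtains \<xi> where "\<And>i. i < n \<Longrightarrow> \<xi> i \<in> dball n p (2 * r)" "\<And>i. i < n \<Longrightarrow> dst n x (\<xi> i) \<le> dst n x y"
    "f y - f x = (\<Sum>i<n. g i (\<xi> i) * (y i - x i))"
proof -
  define z where "z k = (\<lambda>l. if l < k then y l else x l)" for k :: nat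
  have z: "(z k)(k := t) \<in> dball n p (2 * r) \<and> dst n x ((z k)(k := t)) \<le> dst n x y"
    if k: "k < n" and t: "min (x k) (y k) \<le> t" "t \<le> max (x k) (y k)" for k t
  proof -
    have "dst n ((z k)(k := t)) p \<le> (\<Sum>l<n. \<bar>x l - p l\<bar> + \<bar>y l - p l\<bar>)"
      unfolding dst_def using t by (intro sum_mono) (auto simp: z_def)
    also have "\<dots> = dst n x p + dst n y p" by (simp add: dst_def sum.distrib)
    also have "\<dots> < 2 * r" using x y by (auto simp: dball_def)
    finally have "dst n ((z k)(k := t)) p < 2 * r" .
    moreover have "(z k)(k := t) \<in> Eu n" using x y k by (auto simp: dball_def Eu_def z_def)
    moreover have "dst n x ((z k)(k := t)) \<le> dst n x y"
      unfolding dst_def using t by (intro sum_mono) (auto simp: z_def)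
    ultimately show ?thesis by (auto simp: dball_def)
  qed
  have "\<exists>w. w \<in> dball n p (2 * r) \<and> dst n x w \<le> dst n x y \<and>
      f (z (Suc k)) - f (z k) = g k w * (y k - x k)" if k: "k < n" for k
  proof -
    have d: "((\<lambda>s. f ((z k)(k := s))) has_real_derivative g k ((z k)(k := t))) (at t)"
      if "min (x k) (y k) \<le> t" "t \<le> max (x k) (y k)" for t
      using g[OF k conjunct1[OF z[OF k that]]] by simp
    obtain t where t: "min (x k) (y k) \<le> t" "t \<le> max (x k) (y k)"
        "f ((z k)(k := y k)) - f ((z k)(k := x k)) = g k ((z k)(k := t)) * (y k - x k)"
      using mean_value_between[of "x k" "y k" "\<lambda>s. f ((z k)(k := s))" "\<lambda>t. g k ((z k)(k := t))"] d
      by metis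
    have "(z k)(k := y k) = z (Suc k)" "(z k)(k := x k) = z k"
      by (auto simp: z_def fun_eq_iff less_Suc_eq)
    then show ?thesis using t z[OF k t(1,2)] by metis
  qed
  then obtain w where w: "\<And>k. k < n \<Longrightarrow> w k \<in> dball n p (2 * r) \<and> dst n x (w k) \<le> dst n x y \<and>
      f (z (Suc k)) - f (z k) = g k (w k) * (y k - x k)" by metis
  have "z n = y" using x y by (auto simp: z_def fun_eq_iff dball_def Eu_def)
  moreover have "z 0 = x" by (simp add: z_def)
  ultimately have "f y - f x = (\<Sum>k<n. f (z (Suc k)) - f (z k))"
    using sum_lessThan_telescope[of "\<lambda>k. f (z k)" n] by simp
  also have "\<dots> = (\<Sum>k<n. g k (w k) * (y k - x k))" using w by (intro sum.cong) auto
  finally show ?thesis using w that by blast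
qed

text \<open>Bounded second derivatives make the first derivatives Lipschitz; the mean value form of
  f y - f x then differs from the linear form at x by a quadratic term.\<close>

lemma C2_imp_C11_at:
  assumes W: "openin (Euclidean_space n) W" "p \<in> W" and f: "Ck_on (Suc (Suc 0)) n W f"
  shows "C11_at n f p"
proof -
  have Wo: "openin (top_of_set (Eu n)) W" using W(1) by (simp add: Euclidean_space_eq)
  obtain g where g: "\<And>i x. i < n \<Longrightarrow> x \<in> W \<Longrightarrow> ((\<lambda>t. f (x(i := t))) has_real_derivative g i x) (at (x i))"
      "\<And>i. i < n \<Longrightarrow> Ck_on (Suc 0) n W (g i)"
    using f unfolding Ck_on.simps(2)[of "Suc 0"] by blast
  have "\<forall>i. \<exists>h. i < n \<longrightarrow> (\<forall>j<n. (\<forall>x\<in>W. ((\<lambda>t. g i (x(j := t))) has_real_derivative h j x) (at (x j))) \<and>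
        Ck_on 0 n W (h j))"
    using g(2) unfolding Ck_on.simps(2)[of 0] by blast
  then obtain h where h: "\<And>i j x. i < n \<Longrightarrow> j < n \<Longrightarrow> x \<in> W \<Longrightarrow>
        ((\<lambda>t. g i (x(j := t))) has_real_derivative h i j x) (at (x j))"
      "\<And>i j. i < n \<Longrightarrow> j < n \<Longrightarrow> Ck_on 0 n W (h i j)"
    by metis
  have loc: "\<exists>r>0. \<forall>y\<in>dball n p r. y \<in> W \<and> \<bar>u y\<bar> \<le> \<bar>u p\<bar> + 1"
    if "continuous_map (subtopology (Euclidean_space n) W) euclideanreal u" for u
  proof -
    have "openin (subtopology (Euclidean_space n) W) {y \<in> topspace (subtopology (Euclidean_space n) W). u y \<in> {z. \<bar>z\<bar> < \<bar>u p\<bar> + 1}}"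
      using that by (rule openin_continuous_map_preimage) (auto intro!: open_Collect_less continuous_intros)
    then have "openin (Euclidean_space n) {y \<in> topspace (subtopology (Euclidean_space n) W). u y \<in> {z. \<bar>z\<bar> < \<bar>u p\<bar> + 1}}"
      using W(1) openin_trans_full by blast
    moreover have "topspace (subtopology (Euclidean_space n) W) = W"
      using openin_subset[OF W(1)] by auto
    ultimately have "openin (top_of_set (Eu n)) {y \<in> W. u y \<in> {z. \<bar>z\<bar> < \<bar>u p\<bar> + 1}}"
      by (simp only: Euclidean_space_eq)
    then obtain r where "0 < r" "dball n p r \<subseteq> {y \<in> W. u y \<in> {z. \<bar>z\<bar> < \<bar>u p\<bar> + 1}}"
      by (rule openin_Eu_contains_dball) (use W(2) in auto)
    then show ?thesis by (intro exI[of _ r]) (auto dest!: subsetD)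
  qed
  have g0: "continuous_map (subtopology (Euclidean_space n) W) euclideanreal (g i)" if "i < n" for i
    using g(2)[OF that] by simp
  have h0: "continuous_map (subtopology (Euclidean_space n) W) euclideanreal (h i j)" if "i < n" "j < n" for i j
    using h(2)[OF that] by simp
  define P where "P i K \<longleftrightarrow> (\<forall>y\<in>dball n p (1 / max K 1). y \<in> W \<and> \<bar>g i y\<bar> \<le> K \<and> (\<forall>j<n. \<bar>h i j y\<bar> \<le> K))" for i K
  define Q where "Q u K \<longleftrightarrow> (\<forall>y\<in>dball n p (1 / max K 1). y \<in> W \<and> \<bar>u y\<bar> \<le> K)" for u K
  have Qmono: "Q u K'" if "Q u K" "K \<le> K'" for u K K'
  proof -
    have "dball n p (1 / max K' 1) \<subseteq> dball n p (1 / max K 1)"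
      using that(2) by (intro dball_mono divide_left_mono) auto
    then show ?thesis using that unfolding Q_def by force
  qed
  have Q: "\<exists>K. Q u K" if u: "continuous_map (subtopology (Euclidean_space n) W) euclideanreal u" for u
  proof -
    obtain r where r: "r > 0" "\<forall>y\<in>dball n p r. y \<in> W \<and> \<bar>u y\<bar> \<le> \<bar>u p\<bar> + 1" using loc[OF u] by blast
    define K where "K = max (1 / r) (\<bar>u p\<bar> + 1)"
    have "1 / r \<le> max K 1" by (auto simp: K_def)
    then have "1 / max K 1 \<le> r" using r(1) by (simp add: field_simps)
    then have "dball n p (1 / max K 1) \<subseteq> dball n p r" by (rule dball_mono)
    then have "Q u K" using r(2) unfolding Q_def by (force simp: K_def)
    then show ?thesis by blast
  qed
  have "\<exists>K\<ge>1. \<forall>i<n. Q (g i) K \<and> (\<forall>j<n. Q (h i j) K)"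
  proof (rule finite_common_bound)
    fix i assume i: "i < n"
    obtain K1 where K1: "Q (g i) K1" using Q[OF g0[OF i]] by blast
    have "\<exists>K\<ge>1. \<forall>j<n. Q (h i j) K"
      by (rule finite_common_bound) (use Q h0 i Qmono in blast)+
    then obtain K2 where K2: "\<forall>j<n. Q (h i j) K2" by blast
    have "Q (g i) (max K1 K2) \<and> (\<forall>j<n. Q (h i j) (max K1 K2))"
      using K1 K2 Qmono by (metis max.cobounded1 max.cobounded2)
    then show "\<exists>K. Q (g i) K \<and> (\<forall>j<n. Q (h i j) K)" by blast
  qed (use Qmono in blast)
  then obtain K where K: "K \<ge> 1" "\<And>i. i < n \<Longrightarrow> Q (g i) K" "\<And>i j. i < n \<Longrightarrow> j < n \<Longrightarrow> Q (h i j) K"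
    by blast
  have "\<exists>r>0. dball n p r \<subseteq> W" using openin_Eu_contains_dball[OF Wo W(2)] by metis
  then obtain r0 where r0: "0 < r0" "dball n p r0 \<subseteq> W" by blast
  \<comment> \<open>Two nested applications of the mean value lemma double the radius twice, hence
    the factor 4.\<close>
  define r where "r = min r0 (1 / K) / 4"
  have r: "0 < r" "4 * r \<le> r0" "4 * r \<le> 1 / K" using r0 K(1) by (auto simp: r_def)
  have mK: "max K 1 = K" using K(1) by simp
  have inW: "dball n p (4 * r) \<subseteq> W" using dball_mono[OF r(2)] r0(2) by blast
  have bnd: "\<bar>g i y\<bar> \<le> K" "\<And>j. j < n \<Longrightarrow> \<bar>h i j y\<bar> \<le> K" if "i < n" "y \<in> dball n p (4 * r)" for i y
    using that K(2,3) dball_mono[OF r(3), of n p] unfolding Q_def mK by blast+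
  have gl: "\<bar>g i y - g i x\<bar> \<le> K * dst n x y"
    if i: "i < n" and xy: "x \<in> dball n p (2 * r)" "y \<in> dball n p (2 * r)" for i x y
  proof -
    obtain \<xi> where xi: "\<And>j. j < n \<Longrightarrow> \<xi> j \<in> dball n p (2 * (2 * r))"
        "g i y - g i x = (\<Sum>j<n. h i j (\<xi> j) * (y j - x j))"
    proof (rule telescoped_mean_value[OF _ xy])
      show "((\<lambda>t. g i (x(j := t))) has_real_derivative h i j x) (at (x j))"
        if "j < n" "x \<in> dball n p (2 * (2 * r))" for j x
        using that inW by (intro h(1)[OF i]) auto
    qed blast
    have "\<bar>g i y - g i x\<bar> \<le> (\<Sum>j<n. K * \<bar>x j - y j\<bar>)"
      unfolding xi(2) using bnd(2)[OF i] xi(1)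
      by (intro order_trans[OF sum_abs] sum_mono) (auto simp: abs_mult abs_minus_commute intro!: mult_right_mono)
    then show ?thesis by (simp add: dst_def sum_distrib_left)
  qed
  have "jets n K (dball n p r) f (\<lambda>x i. g i x)"
    unfolding jets_def
  proof (intro ballI conjI allI impI)
    fix x y assume xy: "x \<in> dball n p r" "y \<in> dball n p r"
    have sub: "dball n p r \<subseteq> dball n p (2 * r)" "dball n p r \<subseteq> dball n p (4 * r)"
      using r(1) by (auto intro!: dball_mono)
    show "\<bar>g i x\<bar> \<le> K" if "i < n" for i using bnd(1)[OF that, of x] xy sub by blast
    obtain \<xi> where xi: "\<And>j. j < n \<Longrightarrow> \<xi> j \<in> dball n p (2 * r)" "\<And>i. i < n \<Longrightarrow> dst n x (\<xi> i) \<le> dst n x y"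
        "f y - f x = (\<Sum>j<n. g j (\<xi> j) * (y j - x j))"
    proof (rule telescoped_mean_value[OF _ xy])
      show "((\<lambda>t. f (x(j := t))) has_real_derivative g j x) (at (x j))"
        if "j < n" "x \<in> dball n p (2 * r)" for j x
        using that inW dball_mono[of "2 * r" "4 * r" n p] r(1) by (intro g(1)) auto
    qed blast
    have "f y - f x - (\<Sum>l<n. g l x * (y l - x l)) = (\<Sum>l<n. (g l (\<xi> l) - g l x) * (y l - x l))"
      unfolding xi(3) by (simp add: sum_subtractf left_diff_distrib)
    also have "\<bar>\<dots>\<bar> \<le> (\<Sum>l<n. (K * dst n x y) * \<bar>x l - y l\<bar>)"
    proof (intro order_trans[OF sum_abs] sum_mono)
      fix l assume "l \<in> {..<n}"
      then have l: "l < n" by simp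
      have "\<bar>g l (\<xi> l) - g l x\<bar> \<le> K * dst n x (\<xi> l)" using gl[OF l] xy sub xi(1)[OF l] by blast
      also have "\<dots> \<le> K * dst n x y" using xi(2)[OF l] K(1) by (intro mult_left_mono) auto
      finally show "\<bar>(g l (\<xi> l) - g l x) * (y l - x l)\<bar> \<le> (K * dst n x y) * \<bar>x l - y l\<bar>"
        by (simp add: abs_mult abs_minus_commute mult_right_mono)
    qed
    also have "\<dots> = K * (dst n x y)\<^sup>2"
      by (simp add: sum_distrib_left[symmetric] dst_def power2_eq_square)
    finally show "\<bar>f y - f x - (\<Sum>l<n. g l x * (y l - x l))\<bar> \<le> K * (dst n x y)\<^sup>2" .
  qed
  then show ?thesis unfolding C11_at_def C11_on_def using r(1) by blast
qed

section \<open>Generic affine perturbations\<close>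

text \<open>Difference quotients over a step \<open>\<eta>\<close> turn a bound of order
  \<open>\<eta>\<^sup>2\<close> on the values into one of order \<open>\<eta>\<close> on the slopes,
  namely \<open>2 * K * \<eta>\<close> each. The constant term follows because the coordinates of x
  are at most 1; it collects m slopes and one value, which the factor 2 m + 2 covers.\<close>

lemma affine_coeff_bound:
  assumes x: "x \<in> ccub m 1" and \<eta>: "0 < \<eta>" "\<eta> \<le> 1" and K: "0 \<le> K"
    and c: "\<And>y. y \<in> insert x ((\<lambda>l. x(l := x l + \<eta>)) ` {..<m}) \<Longrightarrow>
      \<bar>c m + (\<Sum>l<m. c l * y l)\<bar> \<le> K * \<eta>\<^sup>2"
    and l: "l \<le> m"
  shows "\<bar>c l\<bar> \<le> (2 * real m + 2) * K * \<eta>"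
proof -
  have cl: "\<bar>c l\<bar> \<le> 2 * K * \<eta>" if l: "l < m" for l
  proof -
    have "(\<Sum>j<m. c j * (x(l := x l + \<eta>)) j) = (\<Sum>j<m. c j * x j + (if j = l then c l * \<eta> else 0))"
      by (intro sum.cong) (auto simp: distrib_left)
    also have "\<dots> = (\<Sum>j<m. c j * x j) + c l * \<eta>" using l by (simp add: sum.distrib)
    finally have "c l * \<eta> = (c m + (\<Sum>j<m. c j * (x(l := x l + \<eta>)) j)) - (c m + (\<Sum>j<m. c j * x j))"
      by simp
    moreover have "\<bar>c m + (\<Sum>j<m. c j * (x(l := x l + \<eta>)) j)\<bar> \<le> K * \<eta>\<^sup>2"
      using l by (intro c insertI2 imageI) simp
    moreover have "\<bar>c m + (\<Sum>j<m. c j * x j)\<bar> \<le> K * \<eta>\<^sup>2" by (intro c) auto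
    ultimately have "\<bar>c l * \<eta>\<bar> \<le> 2 * K * \<eta>\<^sup>2" by linarith
    then have "\<bar>c l\<bar> * \<eta> \<le> (2 * K * \<eta>) * \<eta>" using \<eta>(1) by (simp add: abs_mult power2_eq_square)
    then show ?thesis using \<eta>(1) by (rule mult_right_le_imp_le)
  qed
  have m0: "0 \<le> real m * (2 * K * \<eta>)" using K \<eta> by simp
  show ?thesis
  proof (cases "l < m")
    case True
    then show ?thesis using cl[OF True] m0 by (simp add: algebra_simps)
  next
    case False
    then have lm: "l = m" using l by simp
    have "\<bar>\<Sum>j<m. c j * x j\<bar> \<le> (\<Sum>j<m. 2 * K * \<eta> * 1)"
    proof (intro order_trans[OF sum_abs] sum_mono)
      fix j assume j: "j \<in> {..<m}"
      have "\<bar>x j\<bar> \<le> 1" using x j by (auto simp: ccub_def)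
      then show "\<bar>c j * x j\<bar> \<le> 2 * K * \<eta> * 1"
        unfolding abs_mult using cl j K \<eta> by (intro mult_mono) auto
    qed
    moreover have "\<bar>c m + (\<Sum>j<m. c j * x j)\<bar> \<le> K * \<eta>\<^sup>2" by (intro c) auto
    moreover have "K * \<eta>\<^sup>2 \<le> K * \<eta>"
      using \<eta> K mult_left_le[of \<eta> \<eta>] by (intro mult_left_mono) (auto simp: power2_eq_square)
    moreover have "0 \<le> K * \<eta>" using \<eta> K by simp
    ultimately show ?thesis using lm by (simp add: algebra_simps)
  qed
qed

text \<open>
  Pigeonhole argument: cut the cube into about N^m cells of width \<open>\<eta>\<close>. If two parameters in a grid
  of T^(m + 1) points have degenerate zeros in the same cell, they differ by O(\<open>\<eta>\<close>), which is below the
  grid spacing when N is a large constant multiple of T; but then T^(m + 1) exceeds N^m for large T.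
\<close>

lemma generic_affine_perturbation:
  fixes G \<beta> :: "(nat \<Rightarrow> real) \<Rightarrow> real" and lo :: "nat \<Rightarrow> real"
  assumes b: "0 < b" "\<And>y. y \<in> ccub m (3/2) \<Longrightarrow> b \<le> \<beta> y" and w: "0 < w" and L: "0 \<le> L"
  shows "\<exists>a \<delta>. (\<forall>l\<le>m. lo l \<le> a l \<and> a l \<le> lo l + w) \<and> 0 < \<delta> \<and>
    (\<forall>x\<in>ccub m 1. \<exists>y\<in>ccub m (3/2).
       \<delta> + \<delta> * dst m x y + L * (dst m x y)\<^sup>2 < \<bar>G y + \<beta> y * (a m + (\<Sum>l<m. a l * y l))\<bar>)"
proof (rule ccontr)
  assume neg: "\<not> ?thesis"
  \<comment> \<open>Twice the degeneracy bound at distance (m + 1) \<open>\<eta>\<close>, divided by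
    the lower bound b of \<open>\<beta>\<close>: this controls the difference of two parameters, as
    an affine function, near a common cell.\<close>
  define C where "C = 2 * (1 + (real m + 1) + L * (real m + 1)\<^sup>2) / b"
  have C0: "0 < C" using b L by (auto simp: C_def intro!: divide_pos_pos add_pos_nonneg)
  define C3 where "C3 = (2 * real m + 2) * C"
  \<comment> \<open>More than 2 C3 / w, so that \<open>C3 * \<eta>\<close>, which is 2 C3 / (q T),
    stays below the grid spacing w / T. The summand 4 yields \<open>\<eta> \<le> 1 / 2\<close>,
    which keeps the test points in the cube of half-width 3/2.\<close>
  define q where "q = nat \<lceil>2 * C3 / w\<rceil> + 4"
  \<comment> \<open>With T = q^m the number of cells is at most (q (T + 1))^m = T (T + 1)^m, less
    than the (T + 1)^(m + 1) parameters.\<close>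
  define T where "T = q ^ m"
  define N where "N = q * T"
  define \<eta> where "\<eta> = 2 / real N"
  have q4: "4 \<le> q" by (simp add: q_def)
  have T1: "1 \<le> T" using q4 by (simp add: T_def)
  have N4: "4 \<le> N" using q4 T1 mult_mono[of 4 q 1 T] by (simp add: N_def)
  have \<eta>: "0 < \<eta>" "\<eta> \<le> 1 / 2" using N4 by (auto simp: \<eta>_def field_simps)
  have "2 * C3 / w < real q" by (simp add: q_def) linarith
  then have "2 * C3 < real q * w" using w by (simp add: field_simps)
  then have sep: "C3 * \<eta> < w / real T"
    using T1 q4 by (simp add: \<eta>_def N_def field_simps)
  define gr where "gr k = (\<lambda>l. lo l + w * real (k l) / real T)" for k :: "nat \<Rightarrow> nat"
  let ?F = "\<lambda>a y. G y + \<beta> y * (a m + (\<Sum>l<m. a l * y l))"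
  let ?K = "{..m} \<rightarrow>\<^sub>E {..T}"
  \<comment> \<open>The negated claim for \<open>\<delta> = \<eta>\<^sup>2\<close>: x is a
    degenerate zero, up to this error, of the function with parameter \<open>gr k\<close>.\<close>
  define B where "B k x \<longleftrightarrow> x \<in> ccub m 1 \<and>
      (\<forall>y\<in>ccub m (3/2). \<bar>?F (gr k) y\<bar> \<le> \<eta>\<^sup>2 + \<eta>\<^sup>2 * dst m x y + L * (dst m x y)\<^sup>2)" for k x
  have "\<exists>x. B k x" if k: "k \<in> ?K" for k
  proof -
    have "\<forall>l\<le>m. lo l \<le> gr k l \<and> gr k l \<le> lo l + w"
    proof (intro allI impI)
      fix l assume "l \<le> m"
      then have "k l \<le> T" using k by auto
      then have "real (k l) / real T \<le> 1" using T1 by simp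
      then have "w * (real (k l) / real T) \<le> w * 1" using w by (intro mult_left_mono) auto
      then show "lo l \<le> gr k l \<and> gr k l \<le> lo l + w" using w by (simp add: gr_def)
    qed
    moreover have "0 < \<eta>\<^sup>2" using \<eta> by simp
    ultimately have "\<not> (\<forall>x\<in>ccub m 1. \<exists>y\<in>ccub m (3/2).
        \<eta>\<^sup>2 + \<eta>\<^sup>2 * dst m x y + L * (dst m x y)\<^sup>2 < \<bar>?F (gr k) y\<bar>)"
      using neg by blast
    then show ?thesis unfolding B_def not_less[symmetric] by blast
  qed
  then obtain X where "\<And>k. k \<in> ?K \<Longrightarrow> B k (X k)" by metis
  then have X: "\<And>k. k \<in> ?K \<Longrightarrow> X k \<in> ccub m 1"
      "\<And>k y. k \<in> ?K \<Longrightarrow> y \<in> ccub m (3/2) \<Longrightarrow>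
        \<bar>?F (gr k) y\<bar> \<le> \<eta>\<^sup>2 + \<eta>\<^sup>2 * dst m (X k) y + L * (dst m (X k) y)\<^sup>2"
    unfolding B_def by blast+
  define cell where "cell x = (\<lambda>l\<in>{..<m}. nat \<lfloor>(x l + 1) / \<eta>\<rfloor>)" for x :: "nat \<Rightarrow> real"
  have cellin: "cell x \<in> {..<m} \<rightarrow>\<^sub>E {..N}" if "x \<in> ccub m 1" for x
  proof -
    have "nat \<lfloor>(x l + 1) / \<eta>\<rfloor> \<le> N" if l: "l < m" for l
    proof -
      have "\<bar>x l\<bar> \<le> 1" using \<open>x \<in> ccub m 1\<close> l by (auto simp: ccub_def)
      then have "(x l + 1) / \<eta> \<le> 2 / \<eta>" using \<eta> by (intro divide_right_mono) auto
      also have "\<dots> = real N" using N4 by (simp add: \<eta>_def)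
      finally show ?thesis by linarith
    qed
    then show ?thesis by (auto simp: cell_def)
  qed
  have "\<not> inj_on (\<lambda>k. cell (X k)) ?K"
  proof (rule pigeonhole)
    have "card ((\<lambda>k. cell (X k)) ` ?K) \<le> card ({..<m} \<rightarrow>\<^sub>E {..N})"
      using X(1) cellin by (intro card_mono finite_PiE) auto
    also have "\<dots> = (q * T + 1) ^ m" by (simp add: card_PiE N_def)
    also have "\<dots> \<le> (q * (T + 1)) ^ m" using q4 by (intro power_mono) auto
    also have "\<dots> = q ^ m * (T + 1) ^ m" by (rule power_mult_distrib)
    also have "\<dots> < (T + 1) * (T + 1) ^ m" unfolding T_def by (intro mult_strict_right_mono) auto
    also have "\<dots> = card ?K" by (simp add: card_PiE)
    finally show "card ((\<lambda>k. cell (X k)) ` ?K) < card ?K" .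
  qed
  then obtain k k' where k: "k \<in> ?K" "k' \<in> ?K" "k \<noteq> k'" "cell (X k) = cell (X k')"
    by (auto simp: inj_on_def)
  have close: "\<bar>X k l - X k' l\<bar> \<le> \<eta>" if l: "l < m" for l
  proof -
    have "\<bar>X k l\<bar> \<le> 1" "\<bar>X k' l\<bar> \<le> 1" using X(1) k l by (auto simp: ccub_def)
    then have "0 \<le> (X k l + 1) / \<eta>" "0 \<le> (X k' l + 1) / \<eta>" using \<eta> by auto
    moreover have "nat \<lfloor>(X k l + 1) / \<eta>\<rfloor> = nat \<lfloor>(X k' l + 1) / \<eta>\<rfloor>"
      using fun_cong[OF k(4), of l] l by (simp add: cell_def)
    ultimately have "\<bar>(X k l + 1) / \<eta> - (X k' l + 1) / \<eta>\<bar> \<le> 1" by linarith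
    moreover have "(X k l + 1) / \<eta> - (X k' l + 1) / \<eta> = (X k l - X k' l) / \<eta>"
      by (simp add: diff_divide_distrib add_divide_distrib)
    ultimately show ?thesis using \<eta> by (simp add: abs_divide divide_le_eq)
  qed
  have dX: "dst m (X k) (X k') \<le> real m * \<eta>"
    unfolding dst_def using sum_bounded_above[of "{..<m}" "\<lambda>l. \<bar>X k l - X k' l\<bar>" \<eta>] close by simp
  define c where "c l = gr k l - gr k' l" for l
  have bound: "\<bar>c m + (\<Sum>l<m. c l * y l)\<bar> \<le> C * \<eta>\<^sup>2"
    if y: "y \<in> insert (X k) ((\<lambda>l. (X k)(l := X k l + \<eta>)) ` {..<m})" for y
  proof -
    have d1: "dst m (X k) y \<le> \<eta>"
      using y \<eta> by (auto simp: dst_def if_distrib[of abs] if_distrib[of "\<lambda>a. x - a" for x] cong: if_cong)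
    have y32: "y \<in> ccub m (3/2)"
    proof -
      have e: "X k \<in> Eu m" "\<And>l. l < m \<Longrightarrow> \<bar>X k l\<bar> \<le> 1"
        using X(1)[OF k(1)] by (auto simp: ccub_def)
      have "\<bar>y l\<bar> \<le> 3/2" if l: "l < m" for l
      proof -
        have "y l = X k l \<or> y l = X k l + \<eta>" using y by auto
        then show ?thesis using e(2)[OF l] \<eta> by linarith
      qed
      moreover have "y \<in> Eu m" using y e(1) by (auto simp: Eu_def)
      ultimately show ?thesis by (simp add: ccub_def)
    qed
    have d2: "dst m (X k') y \<le> (real m + 1) * \<eta>"
      using dst_triangle[of m "X k'" y "X k"] d1 dX by (simp add: dst_commute algebra_simps)
    have est: "\<eta>\<^sup>2 + \<eta>\<^sup>2 * d + L * d\<^sup>2 \<le> (1 + (real m + 1) + L * (real m + 1)\<^sup>2) * \<eta>\<^sup>2"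
      if d: "0 \<le> d" "d \<le> (real m + 1) * \<eta>" for d
    proof -
      have "(real m + 1) * \<eta> \<le> (real m + 1) * 1" using \<eta> by (intro mult_left_mono) auto
      from order_trans[OF d(2) this] have "d \<le> real m + 1" by (simp only: mult_1_right)
      then have "\<eta>\<^sup>2 * d \<le> \<eta>\<^sup>2 * (real m + 1)" by (intro mult_left_mono) auto
      moreover have "L * d\<^sup>2 \<le> L * ((real m + 1) * \<eta>)\<^sup>2"
        using d L by (intro mult_left_mono power_mono) auto
      moreover have "L * ((real m + 1) * \<eta>)\<^sup>2 = L * (real m + 1)\<^sup>2 * \<eta>\<^sup>2"
        by algebra
      moreover have "(1 + (real m + 1) + L * (real m + 1)\<^sup>2) * \<eta>\<^sup>2
          = \<eta>\<^sup>2 + \<eta>\<^sup>2 * (real m + 1) + L * (real m + 1)\<^sup>2 * \<eta>\<^sup>2"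
        by algebra
      ultimately show ?thesis by linarith
    qed
    have "(real m + 1) * \<eta> \<ge> \<eta>" using \<eta> by simp
    then have "\<bar>?F (gr k) y\<bar> \<le> (1 + (real m + 1) + L * (real m + 1)\<^sup>2) * \<eta>\<^sup>2"
      "\<bar>?F (gr k') y\<bar> \<le> (1 + (real m + 1) + L * (real m + 1)\<^sup>2) * \<eta>\<^sup>2"
      using est[of "dst m (X k) y"] est[of "dst m (X k') y"] d1 d2 X(2)[OF k(1) y32] X(2)[OF k(2) y32]
      by auto
    then have "\<bar>?F (gr k) y - ?F (gr k') y\<bar> \<le> 2 * ((1 + (real m + 1) + L * (real m + 1)\<^sup>2) * \<eta>\<^sup>2)"
      by linarith
    moreover have "?F (gr k) y - ?F (gr k') y = \<beta> y * (c m + (\<Sum>l<m. c l * y l))"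
      by (simp add: c_def right_diff_distrib left_diff_distrib distrib_left sum_subtractf)
    moreover have "b * \<bar>c m + (\<Sum>l<m. c l * y l)\<bar> \<le> \<bar>\<beta> y * (c m + (\<Sum>l<m. c l * y l))\<bar>"
      unfolding abs_mult using b(2)[OF y32] b(1) by (intro mult_right_mono) auto
    ultimately have "b * \<bar>c m + (\<Sum>l<m. c l * y l)\<bar> \<le> 2 * ((1 + (real m + 1) + L * (real m + 1)\<^sup>2) * \<eta>\<^sup>2)"
      by simp
    then show ?thesis using b(1) by (simp add: C_def field_simps)
  qed
  obtain l where l: "l \<le> m" "k l \<noteq> k' l"
    using k by (metis PiE_ext atMost_iff)
  have "\<bar>c l\<bar> \<le> C3 * \<eta>"
    using affine_coeff_bound[OF X(1)[OF k(1)] \<eta>(1) _ _ bound l(1)] \<eta> C0 by (simp add: C3_def)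
  moreover have "w / real T \<le> \<bar>c l\<bar>"
  proof -
    have "c l = w / real T * (real (k l) - real (k' l))"
      by (simp add: c_def gr_def right_diff_distrib)
    moreover have "1 \<le> \<bar>real (k l) - real (k' l)\<bar>" using l(2) by linarith
    then have "w / real T * 1 \<le> w / real T * \<bar>real (k l) - real (k' l)\<bar>"
      using w T1 by (intro mult_left_mono) auto
    ultimately show ?thesis using w T1 by (simp add: abs_mult)
  qed
  ultimately show False using sep by linarith
qed

section \<open>Retractions from local pushes\<close>

text \<open>The push is defined on the whole configuration space and fixes A at all times, so that
  pushes can be composed without care for domains; only points of N have to reach A.\<close>

definition equivariant_push ::
  "'a topology \<Rightarrow> ('a \<times> 'a) set \<Rightarrow> (real \<times> 'a \<times> 'a \<Rightarrow> 'a \<times> 'a) \<Rightarrow> ('a \<times> 'a) set \<Rightarrow> bool" where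
  "equivariant_push X A h N \<longleftrightarrow>
     continuous_map (prod_topology (top_of_set {0..1}) (conf2 X)) (conf2 X) h \<and>
     (\<forall>z\<in>topspace (conf2 X). h (0, z) = z) \<and>
     (\<forall>t\<in>{0..1}. \<forall>z\<in>topspace (conf2 X). h (t, prod.swap z) = prod.swap (h (t, z))) \<and>
     (\<forall>t\<in>{0..1}. \<forall>a\<in>A. h (t, a) = a) \<and>
     openin (conf2 X) N \<and> prod.swap ` N \<subseteq> N \<and> (\<forall>z\<in>N. h (1, z) \<in> A)"

text \<open>
  The pushes run one after the other, the j-th one during the time interval from 1 - 2^(-j) to
  1 - 2^(-j - 1). Once a point has reached \<open>A\<close>, all later pushes fix it, so near \<open>A\<close> the infinite
  composition is locally a finite one.
\<close>

lemma equivariant_ndr_of_local_pushes: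
  assumes M: "second_countable (conf2 X)"
    and A: "A \<subseteq> topspace (conf2 X)" "prod.swap ` A \<subseteq> A"
    and push: "\<And>a. a \<in> A \<Longrightarrow> \<exists>h N. equivariant_push X A h N \<and> a \<in> N"
    and W: "openin (conf2 X) W" "prod.swap ` W \<subseteq> W"
  shows "equivariant_ndr X (A \<inter> W)"
proof -
  let ?M = "conf2 X" and ?I = "top_of_set {0..1::real}"
  \<comment> \<open>The constant push is the default of the enumeration.\<close>
  have 1: "equivariant_push X A snd {}"
    using continuous_map_snd[of ?I ?M] by (simp add: equivariant_push_def)
  have 2: "\<exists>x. (case x of (h, N) \<Rightarrow> equivariant_push X A h N) \<and> openin ?M (snd x) \<and> a \<in> snd x"
    if "a \<in> A" for a
    using push[OF that] by (auto simp: equivariant_push_def)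
  obtain s :: "nat \<Rightarrow> _" where s: "\<And>j. case s j of (h, N) \<Rightarrow> equivariant_push X A h N" "A \<subseteq> (\<Union>j. snd (s j))"
    by (rule second_countable_sequence[OF M 2, where d = "(snd, {})"]) (use 1 in auto)
  define H N where "H j = fst (s j)" and "N j = snd (s j)" for j
  have p: "equivariant_push X A (H j) (N j)" for j
    using s(1)[of j] by (simp add: H_def N_def split_beta)
  have cov: "A \<subseteq> (\<Union>j. N j)" using s(2) by (simp add: N_def)
  \<comment> \<open>The j-th clock: 0 until 1 - t = 2^(-j), then linear, and 1 from 1 - t = 2^(-j-1)
    on.\<close>
  define c where "c j t = max 0 (min 1 (2 - 2 ^ Suc j * (1 - t)))" for j :: nat and t :: real
  have c01: "c j t \<in> {0..1}" for j t by (simp add: c_def)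
  have c1: "c j 1 = 1" for j by (simp add: c_def)
  have c0: "c j 0 = 0" for j
  proof -
    have "(1::real) \<le> 2 ^ j" by simp
    then have "2 - 2 ^ Suc j * (1 - 0) \<le> (0::real)" by simp
    then show ?thesis unfolding c_def by linarith
  qed
  have c_cont: "continuous_map ?I ?I (c j)" for j
    unfolding c_def[abs_def] by (auto simp: continuous_map_in_subtopology intro!: continuous_intros)
  \<comment> \<open>The clocks run one after the other: clock j + 1 does not start before clock j
    has finished.\<close>
  have c_split: "(\<forall>l\<le>j. c l t = 1) \<or> (\<forall>l>j. c l t = 0)" if t: "t \<in> {0..1}" for j t
  proof (cases "2 ^ Suc j * (1 - t) \<le> 1")
    case True
    have "c l t = 1" if "l \<le> j" for l
    proof -
      have "(2::real) ^ Suc l * (1 - t) \<le> 2 ^ Suc j * (1 - t)"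
        using that t by (intro mult_right_mono power_increasing) auto
      then show ?thesis using True by (simp add: c_def)
    qed
    then show ?thesis by blast
  next
    case False
    have "c l t = 0" if "j < l" for l
    proof -
      have "(2::real) ^ Suc (Suc j) * (1 - t) \<le> 2 ^ Suc l * (1 - t)"
        using that t by (intro mult_right_mono power_increasing) auto
      moreover have "(2::real) ^ Suc (Suc j) * (1 - t) = 2 * (2 ^ Suc j * (1 - t))" by simp
      ultimately have "2 - 2 ^ Suc l * (1 - t) \<le> 0" using False by linarith
      then show ?thesis unfolding c_def by linarith
    qed
    then show ?thesis by blast
  qed
  \<comment> \<open>\<open>Q j\<close> performs the pushes with numbers below j. A point that it
    carries into \<open>N j\<close> therefore arrives in A under \<open>Q (Suc j)\<close>.\<close>
  define Q where "Q = rec_nat snd (\<lambda>j q p. H j (c j (fst p), q p))"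
  have Q0: "Q 0 = snd" and QS: "Q (Suc j) p = H j (c j (fst p), Q j p)" for j p
    by (simp_all add: Q_def)
  have Qc: "continuous_map (prod_topology ?I ?M) ?M (Q j)" for j
  proof (induction j)
    case (Suc j)
    have "continuous_map (prod_topology ?I ?M) (prod_topology ?I ?M) (\<lambda>p. (c j (fst p), Q j p))"
      using continuous_map_compose[OF continuous_map_fst[of ?I ?M] c_cont] Suc
      by (intro continuous_map_pairedI) (simp_all add: o_def)
    from continuous_map_compose[OF this, of ?M "H j"] show ?case
      using p[of j] by (simp add: equivariant_push_def QS[abs_def] o_def)
  qed (simp add: Q0 continuous_map_snd)
  have Qtop: "Q j (t, z) \<in> topspace ?M" if "t \<in> {0..1}" "z \<in> topspace ?M" for j t z
    using continuous_map_image_subset_topspace[OF Qc[of j]] that by (auto simp: image_subset_iff)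
  have Qsw: "Q j (t, prod.swap z) = prod.swap (Q j (t, z))" if "t \<in> {0..1}" "z \<in> topspace ?M" for j t z
  proof (induction j)
    case (Suc j)
    then show ?case
      using p[of j] c01[of j t] Qtop[OF that, of j] by (simp add: QS equivariant_push_def)
  qed (simp add: Q0)
  have QA: "Q j (t, a) = a" if "a \<in> A" for j t a
  proof (induction j)
    case (Suc j)
    then show ?case using p[of j] c01[of j t] that by (simp add: QS equivariant_push_def)
  qed (simp add: Q0)
  have Qid: "Q j (0, z) = z" if "z \<in> topspace ?M" for j z
  proof (induction j)
    case (Suc j)
    then show ?case using p[of j] that by (simp add: QS equivariant_push_def c0)
  qed (simp add: Q0)
  have Qend: "Q k (t, z) = Q k (1, z)" if "\<forall>l<k. c l t = 1" for k t z
    using that by (induction k) (auto simp: Q0 QS c1)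
  define V where "V j = {z \<in> topspace ?M. Q j (1, z) \<in> N j}" for j
  have oV: "openin ?M (V j)" for j
  proof -
    have "continuous_map ?M (prod_topology ?I ?M) (\<lambda>z. (1, z))"
      by (intro continuous_map_pairedI) auto
    from continuous_map_compose[OF this Qc[of j]] have "continuous_map ?M ?M (\<lambda>z. Q j (1, z))"
      by (simp add: o_def)
    then show ?thesis
      unfolding V_def using p[of j] by (intro openin_continuous_map_preimage) (auto simp: equivariant_push_def)
  qed
  have swM: "prod.swap z \<in> topspace ?M" if "z \<in> topspace ?M" for z
    using that by (auto simp: topspace_conf2)
  have Vsw: "prod.swap z \<in> V j" if "z \<in> V j" for z j
    using that p[of j] swM Qsw[of 1 z j] by (auto simp: V_def equivariant_push_def)
  have VA: "Q (Suc j) (1, z) \<in> A" if "z \<in> V j" for z j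
    using that p[of j] by (simp add: V_def QS c1 equivariant_push_def)
  \<comment> \<open>At an intermediate time either the clocks up to j are complete, and the point
    has already reached A, which later pushes fix, or the later clocks still stand at 0.\<close>
  have stat: "Q i (t, z) = Q (Suc j) (t, z)" if z: "z \<in> V j" and t: "t \<in> {0..1}" and i: "Suc j \<le> i" for i j t z
    using i
  proof (induction i rule: dec_induct)
    case (step i)
    have zM: "z \<in> topspace ?M" using z by (simp add: V_def)
    consider "\<forall>l\<le>j. c l t = 1" | "c i t = 0" using c_split[OF t, of j] step by auto
    then show ?case
    proof cases
      case 1
      then have "Q (Suc j) (t, z) = Q (Suc j) (1, z)" by (intro Qend) auto
      then have "Q i (t, z) \<in> A" using VA[OF z] step by simp
      then show ?thesis using p[of i] c01[of i t] step by (simp add: QS[of i] equivariant_push_def)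
    next
      case 2
      then show ?thesis using p[of i] Qtop[OF t zM, of i] step by (simp add: QS[of i] equivariant_push_def)
    qed
  qed simp
  define U where "U = (\<Union>j. V j)"
  \<comment> \<open>The least index is only a choice: by \<open>stat\<close> every j with z in
    \<open>V j\<close> gives the same value, and this is what pasting needs for continuity.\<close>
  define J where "J z = (LEAST j. z \<in> V j)" for z
  define K where "K q = (if snd q \<in> U then Q (Suc (J (snd q))) q else snd q)" for q
  have K: "K (t, z) = Q (Suc j) (t, z)" if "z \<in> V j" "t \<in> {0..1}" for t z j
  proof -
    have "z \<in> V (J z)" "J z \<le> j"
      using that(1) unfolding J_def by (auto intro: LeastI Least_le)
    then show ?thesis using stat[of z "J z" t "Suc j"] that by (auto simp: K_def U_def)
  qed
  have oU: "openin ?M U" unfolding U_def using oV by auto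
  have Usub: "U \<subseteq> topspace ?M" using openin_subset[OF oU] .
  have Kc: "continuous_map (prod_topology ?I (subtopology ?M U)) ?M K"
  proof (rule pasting_lemma[where I = UNIV and T = "\<lambda>j. {0..1} \<times> V j" and f = "\<lambda>j. Q (Suc j)"])
    show "openin (prod_topology ?I (subtopology ?M U)) ({0..1} \<times> V j)" for j
    proof -
      have "U \<inter> V j = V j" by (auto simp: U_def)
      then have "openin (subtopology ?M U) (V j)" using openin_subtopology_Int2[OF oV[of j], of U] by simp
      then show ?thesis by (simp add: openin_prod_Times_iff)
    qed
    show "continuous_map (subtopology (prod_topology ?I (subtopology ?M U)) ({0..1} \<times> V j)) ?M (Q (Suc j))" for j
      using Qc[of "Suc j"] by (simp add: prod_topology_subtopology continuous_map_from_subtopology)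
    show "Q (Suc i) x = Q (Suc j) x"
      if "x \<in> topspace (prod_topology ?I (subtopology ?M U)) \<inter> {0..1} \<times> V i \<inter> {0..1} \<times> V j" for i j x
      using that K[of "snd x" i "fst x"] K[of "snd x" j "fst x"] by auto
    show "\<exists>j. j \<in> UNIV \<and> x \<in> {0..1} \<times> V j \<and> K x = Q (Suc j) x"
      if "x \<in> topspace (prod_topology ?I (subtopology ?M U))" for x
      using that K[of "snd x" _ "fst x"] by (cases x) (auto simp: U_def)
  qed
  define r where "r z = K (1, z)" for z
  have rA: "r z \<in> A" if z: "z \<in> U" for z
  proof -
    obtain j where j: "z \<in> V j" using z unfolding U_def by blast
    show ?thesis using VA[OF j] K[OF j, of 1] by (simp add: r_def)
  qed
  have AV: "\<exists>j. a \<in> V j" if a: "a \<in> A" for a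
  proof -
    obtain j where "a \<in> N j" using cov a by blast
    then have "a \<in> V j" using QA[OF a] subsetD[OF A(1) a] by (simp add: V_def)
    then show ?thesis by blast
  qed
  then have AU: "A \<subseteq> U" unfolding U_def by blast
  have KA: "K (t, a) = a" if a: "a \<in> A" and t: "t \<in> {0..1}" for a t
  proof -
    obtain j where "a \<in> V j" using AV[OF a] by blast
    then show ?thesis using K[of a j t] t QA[OF a] by simp
  qed
  have Ksw: "K (t, prod.swap z) = prod.swap (K (t, z))" if z: "z \<in> U" and t: "t \<in> {0..1}" for t z
  proof -
    obtain j where j: "z \<in> V j" using z unfolding U_def by blast
    have "z \<in> topspace ?M" using j by (simp add: V_def)
    then show ?thesis using K[OF j t] K[OF Vsw[OF j] t] Qsw[OF t] by simp
  qed
  have K0: "K (0, z) = z" for z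
  proof (cases "z \<in> U")
    case True
    then have "z \<in> topspace ?M" using Usub by blast
    then show ?thesis using True Qid by (simp add: K_def)
  qed (simp add: K_def)
  have rc: "continuous_map (subtopology ?M U) ?M r"
  proof -
    have "continuous_map (subtopology ?M U) (prod_topology ?I (subtopology ?M U)) (\<lambda>z. (1, z))"
      by (intro continuous_map_pairedI) auto
    from continuous_map_compose[OF this Kc] show ?thesis by (simp add: o_def r_def[abs_def])
  qed
  \<comment> \<open>The passage to a relatively open subset: only points whose retraction lands in W
    are kept. The homotopy may leave this set, as its target is the whole configuration
    space.\<close>
  define U' where "U' = {z \<in> U. r z \<in> W}"
  have oU': "openin ?M U'"
  proof -
    have "openin (subtopology ?M U) {z \<in> topspace (subtopology ?M U). r z \<in> W}"
      by (rule openin_continuous_map_preimage[OF rc W(1)])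
    moreover have "{z \<in> topspace (subtopology ?M U). r z \<in> W} = U'" using Usub by (auto simp: U'_def)
    ultimately show ?thesis using oU openin_trans_full by metis
  qed
  have U'U: "U' \<subseteq> U" by (auto simp: U'_def)
  have FU: "A \<inter> W \<subseteq> U'" using AU KA by (auto simp: U'_def r_def)
  have U'sw: "prod.swap ` U' \<subseteq> U'"
  proof
    fix w assume "w \<in> prod.swap ` U'"
    then obtain z where z: "z \<in> U" "r z \<in> W" "w = prod.swap z" by (auto simp: U'_def)
    then have "r w = prod.swap (r z)" using Ksw[of z 1] by (simp add: r_def)
    moreover have "prod.swap z \<in> U" using z(1) Vsw unfolding U_def by blast
    ultimately show "w \<in> U'" using z W(2) by (auto simp: U'_def)
  qed
  have rU': "continuous_map (subtopology ?M U') (subtopology ?M (A \<inter> W)) r"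
    unfolding continuous_map_in_subtopology
    using continuous_map_from_subtopology_mono[OF rc U'U] rA U'U by (auto simp: U'_def)
  have ret: "retraction_maps (subtopology ?M U') (subtopology ?M (A \<inter> W)) r id"
    unfolding retraction_maps_def
    using rU' FU KA[of _ 1] by (auto simp: r_def continuous_map_in_subtopology intro: continuous_map_from_subtopology)
  have eqv: "swap_equivariant_on U' (\<lambda>z. K (t, z))" if "t \<in> {0..1}" for t
    using Ksw that U'U by (auto simp: swap_equivariant_on_def)
  have "homotopic_with (swap_equivariant_on U') (subtopology ?M U') ?M id r"
    unfolding homotopic_with_def
  proof (intro exI[of _ K] conjI allI ballI)
    have "continuous_map (subtopology ?M U') (subtopology ?M U) (\<lambda>z. z)"
      using U'U by (auto simp: continuous_map_in_subtopology intro: continuous_map_from_subtopology)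
    from continuous_map_compose[OF continuous_map_snd[of ?I] this]
    have "continuous_map (prod_topology ?I (subtopology ?M U')) (prod_topology ?I (subtopology ?M U)) (\<lambda>p. (fst p, snd p))"
      by (intro continuous_map_pairedI continuous_map_fst) (simp add: o_def)
    from continuous_map_compose[OF this Kc]
    show "continuous_map (prod_topology ?I (subtopology ?M U')) ?M K"
      by (simp add: o_def)
  qed (use eqv in \<open>auto simp: K0 r_def\<close>)
  then have "homotopic_with (swap_equivariant_on U') (subtopology ?M U') ?M r id"
    by (rule homotopic_with_symD)
  moreover have "swap_equivariant_on U' r"
    using eqv[of 1] by (simp add: r_def[abs_def])
  moreover have "prod.swap ` (A \<inter> W) \<subseteq> A \<inter> W" using A(2) W(2) by blast
  ultimately show ?thesis
    unfolding equivariant_ndr_def using A(1) oU' FU U'sw ret by blast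
qed

section \<open>Descent directions\<close>

text \<open>The index m stands for the constant 1, so that l \<le> m runs through a basis of the
  affine functions, cut off by the bump.\<close>

definition bump_coord :: "nat \<Rightarrow> nat \<Rightarrow> (nat \<Rightarrow> real) \<Rightarrow> real" where
  "bump_coord m l y = bump m y * (if l < m then y l else 1)"

lemma C11_at_bump_coord:
  assumes "p \<in> Eu m"
  shows "C11_at m (bump_coord m l) p"
proof -
  have "C11_at m (\<lambda>y. if l < m then y l else 1) p"
    using C11_at_affine[of l m 0 1 p] C11_at_const[of m 1 p] by (cases "l < m") auto
  then show ?thesis
    unfolding bump_coord_def[abs_def] by (intro C11_at_mult C11_at_bump assms)
qed

lemma ccub_subset_Eu: "ccub m r \<subseteq> Eu m"
  by (auto simp: ccub_def)

lemma C11_on_bump_coord: "C11_on m (ccub m r) (bump_coord m l)"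
  by (intro C11_at_subset_compact compact_ccub ccub_subset_Eu C11_at_bump_coord)
     (use ccub_subset_Eu in blast)

lemma bump_nonneg: "0 \<le> bump m y"
  by (simp add: bump_def prod_nonneg)

lemma bump_ge_1: "y \<in> ccub m (3/2) \<Longrightarrow> 1 \<le> bump m y"
  unfolding bump_def
proof (rule prod_ge_1)
  fix l assume y: "y \<in> ccub m (3/2)" and l: "l \<in> {..<m}"
  have "\<bar>y l\<bar> \<le> 3/2" using y l by (auto simp: ccub_def)
  then have "(y l)\<^sup>2 \<le> (3/2)\<^sup>2" using abs_le_square_iff[of "y l" "3/2"] by simp
  then have "1 \<le> max 0 (4 - (y l)\<^sup>2)" by (simp add: power2_eq_square)
  then show "1 \<le> (max 0 (4 - (y l)\<^sup>2))\<^sup>2" by (rule one_le_power)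
qed

lemma bump_pos_iff: "0 < bump m y \<longleftrightarrow> (\<forall>l<m. \<bar>y l\<bar> < 2)"
proof -
  have "(y l)\<^sup>2 < 4 \<longleftrightarrow> \<bar>y l\<bar> < 2" for l
    using abs_le_square_iff[of 2 "y l"] by auto
  moreover have "0 < bump m y \<longleftrightarrow> (\<forall>l<m. (y l)\<^sup>2 < 4)"
  proof -
    have "0 < bump m y \<longleftrightarrow> bump m y \<noteq> 0" using bump_nonneg[of m y] by linarith
    also have "\<dots> \<longleftrightarrow> (\<forall>l<m. max 0 (4 - (y l)\<^sup>2) \<noteq> 0)" by (auto simp: bump_def)
    also have "\<dots> \<longleftrightarrow> (\<forall>l<m. (y l)\<^sup>2 < 4)" by (intro all_cong) (auto simp: max_def)
    finally show ?thesis .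
  qed
  ultimately show ?thesis by simp
qed

lemma bump_eq_0: "\<not> (\<forall>l<m. \<bar>y l\<bar> < 2) \<Longrightarrow> bump m y = 0"
  using bump_pos_iff[of m y] bump_nonneg[of m y] by (metis order_le_less)

text \<open>A substitute for a nonzero partial derivative, uniform near y and free of derivatives,
  so that it makes sense for an infinite sum whose differentiability is not established. The limit
  1/2 on \<open>\<eta>\<close> keeps base points and moved points in the cube of half-width 2 when y
  is in that of half-width 1.\<close>

definition descent :: "nat \<Rightarrow> ((nat \<Rightarrow> real) \<Rightarrow> real) \<Rightarrow> (nat \<Rightarrow> real) \<Rightarrow> real \<Rightarrow> bool" where
  "descent m F y \<delta> \<longleftrightarrow> (\<exists>l<m. \<exists>\<sigma>\<in>{1, -1}. \<exists>\<eta>>0. \<eta> \<le> 1/2 \<and>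
     (\<forall>y'\<in>Eu m. dst m y' y \<le> \<eta> \<longrightarrow> (\<forall>s\<in>{0..\<eta>}. F (y'(l := y' l - \<sigma> * s)) \<le> F y' - \<delta> * s)))"

lemma dst_upd: "l < m \<Longrightarrow> dst m y (y(l := t)) = \<bar>y l - t\<bar>"
proof -
  assume l: "l < m"
  have "dst m y (y(l := t)) = (\<Sum>j<m. if j = l then \<bar>y l - t\<bar> else 0)"
    unfolding dst_def by (intro sum.cong) auto
  then show ?thesis using l by simp
qed

lemma sum_upd:
  fixes l m :: nat
  assumes "l < m"
  shows "(\<Sum>j<m. d j * ((y(l := y l + t)) j - x j)) = (\<Sum>j<m. d j * (y j - x j)) + d l * (t::real)"
proof -
  have "(\<Sum>j<m. d j * ((y(l := y l + t)) j - x j)) = (\<Sum>j<m. d j * (y j - x j) + (if j = l then d l * t else 0))"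
    by (intro sum.cong) (auto simp: algebra_simps)
  then show ?thesis using assms by (simp add: sum.distrib)
qed

text \<open>A uniform quadratic remainder forces the coefficients to be Lipschitz: the expansions at
  x and at y are compared at y and at y + t e_l. The constant is 6 = 4 + 1 + 1, from remainders over
  distances at most 2 t, t and t.\<close>

lemma jets_coeff_Lipschitz:
  assumes J: "jets m L S f D" and S: "x \<in> S" "y \<in> S" "y(l := y l + t) \<in> S" and l: "l < m"
    and t: "0 < t" "dst m x y \<le> t"
  shows "\<bar>D x l - D y l\<bar> \<le> 6 * L * t"
proof -
  let ?z = "y(l := y l + t)"
  have L0: "0 \<le> L" using jets_nonneg[OF J S(1)] l by simp
  have dyz: "dst m y ?z = t" using dst_upd[OF l, of y "y l + t"] t by simp
  have "dst m x ?z \<le> 2 * t" using dst_triangle[of m x ?z y] t dyz by simp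
  then have "(dst m x ?z)\<^sup>2 \<le> (2 * t)\<^sup>2" by (intro power_mono) auto
  then have "L * (dst m x ?z)\<^sup>2 \<le> L * (4 * t\<^sup>2)" using L0 by (intro mult_left_mono) auto
  moreover have "\<bar>f ?z - f x - (\<Sum>j<m. D x j * (?z j - x j))\<bar> \<le> L * (dst m x ?z)\<^sup>2"
    using J S unfolding jets_def by blast
  ultimately have 1: "\<bar>f ?z - f x - ((\<Sum>j<m. D x j * (y j - x j)) + D x l * t)\<bar> \<le> 4 * (L * t\<^sup>2)"
    unfolding sum_upd[OF l] by linarith
  have "(dst m x y)\<^sup>2 \<le> t\<^sup>2" using t by (intro power_mono) auto
  then have "L * (dst m x y)\<^sup>2 \<le> L * t\<^sup>2" using L0 by (rule mult_left_mono)
  moreover have "\<bar>f y - f x - (\<Sum>j<m. D x j * (y j - x j))\<bar> \<le> L * (dst m x y)\<^sup>2"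
    using J S unfolding jets_def by blast
  ultimately have 2: "\<bar>f y - f x - (\<Sum>j<m. D x j * (y j - x j))\<bar> \<le> L * t\<^sup>2" by linarith
  have "\<bar>f ?z - f y - (\<Sum>j<m. D y j * (?z j - y j))\<bar> \<le> L * (dst m y ?z)\<^sup>2"
    using J S unfolding jets_def by blast
  then have 3: "\<bar>f ?z - f y - D y l * t\<bar> \<le> L * t\<^sup>2"
    unfolding sum_upd[OF l] dyz by simp
  have "\<bar>D x l * t - D y l * t\<bar> \<le> 6 * (L * t\<^sup>2)" using 1 2 3 by linarith
  then have "\<bar>D x l - D y l\<bar> * t \<le> (6 * L * t) * t"
    using t by (simp add: left_diff_distrib[symmetric] abs_mult power2_eq_square)
  then show ?thesis using t(1) by (rule mult_right_le_imp_le)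
qed

lemma ccub_2_of_near:
  assumes y: "y \<in> ccub m 1" and w: "w \<in> Eu m" "dst m w y \<le> 1"
  shows "w \<in> ccub m 2"
proof -
  have "\<bar>w j\<bar> \<le> 2" if j: "j < m" for j
    using coord_le_dst[OF j, of w y] w(2) y j unfolding ccub_def by force
  then show ?thesis using w(1) by (simp add: ccub_def)
qed

lemma descent_of_jets:
  assumes J: "jets m L (ccub m 2) F D" and L: "0 < L" and y: "y \<in> ccub m 1" and l: "l < m"
    and \<delta>: "0 < \<delta>" "2 * \<delta> \<le> \<bar>D y l\<bar>"
  shows "descent m F y \<delta>"
proof -
  define \<sigma> where "\<sigma> = (if 0 \<le> D y l then 1 else -1 :: real)"
  have \<sigma>: "\<sigma> \<in> {1, -1}" "\<sigma> * D y l = \<bar>D y l\<bar>" "\<bar>\<sigma>\<bar> = 1" by (auto simp: \<sigma>_def)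
  \<comment> \<open>Of the loss \<open>7 * L * \<eta>\<close>, six parts are the variation of the
    coefficient and one is the remainder; half of the slope \<open>2 * \<delta>\<close>
    survives.\<close>
  define \<eta> where "\<eta> = min (1/2) (\<delta> / (7 * L))"
  have \<eta>: "0 < \<eta>" "\<eta> \<le> 1/2" "7 * L * \<eta> \<le> \<delta>"
    using L \<delta> by (auto simp: \<eta>_def min_def field_simps)
  note near = ccub_2_of_near[OF y]
  have yE: "y \<in> Eu m" using y by (simp add: ccub_def)
  have "F (y'(l := y' l - \<sigma> * s)) \<le> F y' - \<delta> * s"
    if y': "y' \<in> Eu m" "dst m y' y \<le> \<eta>" and s: "s \<in> {0..\<eta>}" for y' s
  proof -
    have S: "y' \<in> ccub m 2" "y \<in> ccub m 2" using near y' \<eta> yE by auto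
    have up: "w(l := t) \<in> Eu m" if "w \<in> Eu m" for w t using that l by (auto simp: Eu_def)
    have "y(l := y l + \<eta>) \<in> ccub m 2"
      using \<eta> dst_upd[OF l, of y "y l + \<eta>"] by (intro near up yE) (simp add: dst_commute)
    then have "\<bar>D y' l - D y l\<bar> \<le> 6 * L * \<eta>"
      using jets_coeff_Lipschitz[OF J S(1,2) _ l \<eta>(1) y'(2)] by simp
    then have "\<bar>\<sigma> * D y' l - \<sigma> * D y l\<bar> \<le> 6 * L * \<eta>"
      using \<sigma>(3) by (simp add: right_diff_distrib[symmetric] abs_mult)
    then have lower: "2 * \<delta> - 6 * L * \<eta> \<le> \<sigma> * D y' l" using \<sigma>(2) \<delta>(2) by linarith
    let ?w = "y'(l := y' l + (- \<sigma> * s))"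
    have dw: "dst m y' ?w = s"
      using dst_upd[OF l, of y' "y' l + (- \<sigma> * s)"] \<sigma>(3) s by (simp add: abs_mult)
    have "?w \<in> ccub m 2"
      using dst_triangle[of m ?w y y'] dw y'(2) s \<eta> by (intro near up y'(1)) (simp add: dst_commute)
    then have "\<bar>F ?w - F y' - (\<Sum>j<m. D y' j * (?w j - y' j))\<bar> \<le> L * (dst m y' ?w)\<^sup>2"
      using J S unfolding jets_def by blast
    then have "\<bar>F ?w - F y' + D y' l * (\<sigma> * s)\<bar> \<le> L * s\<^sup>2"
      unfolding sum_upd[OF l] dw by simp
    then have "F ?w \<le> F y' - (\<sigma> * D y' l) * s + L * s * s"
      by (simp add: power2_eq_square algebra_simps)
    also have "\<dots> \<le> F y' - (2 * \<delta> - 6 * L * \<eta>) * s + L * \<eta> * s"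
      using lower s L by (intro add_mono diff_mono mult_right_mono mult_left_mono) auto
    also have "\<dots> = F y' - (2 * \<delta> - 7 * L * \<eta>) * s" by (simp add: algebra_simps)
    also have "\<dots> \<le> F y' - \<delta> * s"
      using \<eta>(3) s by (intro diff_left_mono mult_right_mono) auto
    finally show ?thesis by simp
  qed
  then show ?thesis unfolding descent_def using l \<sigma>(1) \<eta> by blast
qed

text \<open>An \<open>\<epsilon>\<close>-Lipschitz perturbation changes the decrease over a step of
  length s by at most \<open>\<epsilon> * s\<close>. This stability is what makes an infinite sum of
  perturbations manageable.\<close>

lemma descent_perturb:
  assumes d: "descent m F y \<delta>" and y: "y \<in> ccub m 1"
    and v: "\<And>x x'. x \<in> ccub m 2 \<Longrightarrow> x' \<in> ccub m 2 \<Longrightarrow> \<bar>v x' - v x\<bar> \<le> \<epsilon> * dst m x x'"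
    and F': "\<And>x. x \<in> ccub m 2 \<Longrightarrow> F' x = F x + v x"
  shows "descent m F' y (\<delta> - \<epsilon>)"
proof -
  obtain l \<sigma> \<eta> where d: "l < m" "\<sigma> \<in> {1, -1 :: real}" "0 < \<eta>" "\<eta> \<le> 1/2"
    "\<And>y' s. y' \<in> Eu m \<Longrightarrow> dst m y' y \<le> \<eta> \<Longrightarrow> s \<in> {0..\<eta>} \<Longrightarrow> F (y'(l := y' l - \<sigma> * s)) \<le> F y' - \<delta> * s"
    using d unfolding descent_def by blast
  note near = ccub_2_of_near[OF y]
  have "F' (y'(l := y' l - \<sigma> * s)) \<le> F' y' - (\<delta> - \<epsilon>) * s"
    if y': "y' \<in> Eu m" "dst m y' y \<le> \<eta>" and s: "s \<in> {0..\<eta>}" for y' s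
  proof -
    let ?w = "y'(l := y' l - \<sigma> * s)"
    have "\<bar>\<sigma>\<bar> = 1" using d(2) by auto
    then have dw: "dst m y' ?w = s" using s by (simp add: dst_upd[OF d(1)] abs_mult)
    have S: "y' \<in> ccub m 2" using near y' d(4) by auto
    have w: "?w \<in> ccub m 2"
    proof (rule near)
      show "?w \<in> Eu m" using y'(1) d(1) by (auto simp: Eu_def)
      show "dst m ?w y \<le> 1"
        using dst_triangle[of m ?w y y'] dw y'(2) s d(4) by (simp add: dst_commute)
    qed
    have "v ?w - v y' \<le> \<epsilon> * s" using v[OF S w] dw by simp
    then show ?thesis using d(5)[OF y' s] F'[OF S] F'[OF w] by (simp add: algebra_simps)
  qed
  then show ?thesis unfolding descent_def using d(1-4) by blast
qed

lemma sum_bump_coord: "(\<Sum>l\<le>m. a l * bump_coord m l y) = bump m y * (a m + (\<Sum>l<m. a l * y l))"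
proof -
  have "{..m} = insert m {..<m}" by auto
  then have "(\<Sum>l\<le>m. a l * bump_coord m l y) = a m * bump_coord m m y + (\<Sum>l<m. a l * bump_coord m l y)"
    by simp
  also have "(\<Sum>l<m. a l * bump_coord m l y) = bump m y * (\<Sum>l<m. a l * y l)"
    unfolding sum_distrib_left by (intro sum.cong) (auto simp: bump_coord_def)
  finally show ?thesis by (simp add: bump_coord_def algebra_simps)
qed

text \<open>If the value and all coefficients at x were small, the expansion at x would bound the
  function on the whole cube by a quadratic in the distance to x, against the pigeonhole lemma. The
  latter applies with b = 1, since the bump is at least 1 on the cube of half-width 3/2.\<close>

lemma generic_regular_perturbation:
  assumes G: "C11_on m (ccub m 2) G" and w: "0 < w"
  shows "\<exists>a \<delta>. (\<forall>l\<le>m. lo l \<le> a l \<and> a l \<le> lo l + w) \<and> 0 < \<delta> \<and>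
    (\<forall>y\<in>ccub m 1. \<delta> \<le> \<bar>G y + (\<Sum>l\<le>m. a l * bump_coord m l y)\<bar> \<or>
      descent m (\<lambda>y. G y + (\<Sum>l\<le>m. a l * bump_coord m l y)) y \<delta>)"
proof -
  obtain L0 D0 where J0: "0 < L0" "jets m L0 (ccub m 2) G D0" using C11_on_jets_pos[OF G] .
  have "\<exists>L D. 0 < L \<and> jets m L (ccub m 2) (bump_coord m l) D" for l
    using C11_on_jets_pos[OF C11_on_bump_coord] by metis
  then obtain L1 D1 where J1: "\<And>l. 0 < L1 l" "\<And>l. jets m (L1 l) (ccub m 2) (bump_coord m l) (D1 l)"
    by metis
  \<comment> \<open>The constant must be known before the parameter is chosen, so it is taken
    uniformly over the whole box of parameters.\<close>
  define L where "L = L0 + (\<Sum>l\<le>m. (\<bar>lo l\<bar> + w) * L1 l)"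
  have Lpos: "0 < L"
    unfolding L_def using J0(1) J1(1) w by (intro add_pos_nonneg sum_nonneg mult_nonneg_nonneg) (auto simp: less_imp_le)
  have jetF: "\<exists>D. jets m L (ccub m 2) (\<lambda>y. G y + (\<Sum>l\<le>m. a l * bump_coord m l y)) D"
    if a: "\<forall>l\<le>m. lo l \<le> a l \<and> a l \<le> lo l + w" for a
  proof (intro exI)
    let ?D = "\<lambda>x j. D0 x j + (\<Sum>l\<le>m. a l * D1 l x j)"
    have ab: "\<bar>a l\<bar> \<le> \<bar>lo l\<bar> + w" if "l \<le> m" for l
      using a that by (auto simp: abs_le_iff)
    show "jets m L (ccub m 2) (\<lambda>y. G y + (\<Sum>l\<le>m. a l * bump_coord m l y)) ?D"
      unfolding jets_def
    proof (intro ballI conjI allI impI)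
      fix x y assume xy: "x \<in> ccub m 2" "y \<in> ccub m 2"
      have 0: "\<bar>G y - G x - (\<Sum>j<m. D0 x j * (y j - x j))\<bar> \<le> L0 * (dst m x y)\<^sup>2"
        using J0 xy unfolding jets_def by blast
      define R where "R l = bump_coord m l y - bump_coord m l x - (\<Sum>j<m. D1 l x j * (y j - x j))" for l
      have R: "\<bar>R l\<bar> \<le> L1 l * (dst m x y)\<^sup>2" for l
        using J1(2)[of l] xy unfolding jets_def R_def by blast
      have "\<bar>\<Sum>l\<le>m. a l * R l\<bar> \<le> (\<Sum>l\<le>m. (\<bar>lo l\<bar> + w) * (L1 l * (dst m x y)\<^sup>2))"
        using ab R w by (intro order_trans[OF sum_abs] sum_mono) (auto simp: abs_mult intro!: mult_mono)
      also have "\<dots> = (\<Sum>l\<le>m. (\<bar>lo l\<bar> + w) * L1 l) * (dst m x y)\<^sup>2"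
        by (simp add: sum_distrib_right mult.assoc)
      finally have 1: "\<bar>\<Sum>l\<le>m. a l * R l\<bar> \<le> (\<Sum>l\<le>m. (\<bar>lo l\<bar> + w) * L1 l) * (dst m x y)\<^sup>2" .
      have "(\<Sum>j<m. (\<Sum>l\<le>m. a l * D1 l x j) * (y j - x j)) = (\<Sum>l\<le>m. a l * (\<Sum>j<m. D1 l x j * (y j - x j)))"
        unfolding sum_distrib_right sum_distrib_left by (subst sum.swap) (simp add: mult.assoc)
      then have "(\<Sum>l\<le>m. a l * bump_coord m l y) - (\<Sum>l\<le>m. a l * bump_coord m l x)
          - (\<Sum>j<m. (\<Sum>l\<le>m. a l * D1 l x j) * (y j - x j)) = (\<Sum>l\<le>m. a l * R l)"
        unfolding R_def by (simp add: right_diff_distrib sum_subtractf)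
      then show "\<bar>G y + (\<Sum>l\<le>m. a l * bump_coord m l y) - (G x + (\<Sum>l\<le>m. a l * bump_coord m l x))
          - (\<Sum>j<m. ?D x j * (y j - x j))\<bar> \<le> L * (dst m x y)\<^sup>2"
        using 0 1 unfolding distrib_right sum.distrib L_def by linarith
      fix j assume j: "j < m"
      have "\<bar>D0 x j\<bar> \<le> L0" using J0 xy j unfolding jets_def by blast
      moreover have D1b: "\<bar>D1 l x j\<bar> \<le> L1 l" for l using J1(2)[of l] xy j unfolding jets_def by blast
      moreover have "\<bar>\<Sum>l\<le>m. a l * D1 l x j\<bar> \<le> (\<Sum>l\<le>m. (\<bar>lo l\<bar> + w) * L1 l)"
        using ab D1b w by (intro order_trans[OF sum_abs] sum_mono) (auto simp: abs_mult intro!: mult_mono)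
      ultimately show "\<bar>?D x j\<bar> \<le> L" unfolding L_def by linarith
    qed
  qed
  obtain a \<delta> where a: "\<forall>l\<le>m. lo l \<le> a l \<and> a l \<le> lo l + w" and \<delta>: "0 < \<delta>"
    and far: "\<forall>x\<in>ccub m 1. \<exists>y\<in>ccub m (3/2).
       \<delta> + \<delta> * dst m x y + L * (dst m x y)\<^sup>2 < \<bar>G y + bump m y * (a m + (\<Sum>l<m. a l * y l))\<bar>"
    using generic_affine_perturbation[of 1 m "bump m" w L lo G] bump_ge_1 w Lpos by auto
  let ?F = "\<lambda>y. G y + (\<Sum>l\<le>m. a l * bump_coord m l y)"
  have F: "?F y = G y + bump m y * (a m + (\<Sum>l<m. a l * y l))" for y
    by (simp only: sum_bump_coord)
  obtain D where J: "jets m L (ccub m 2) ?F D" using jetF[OF a] by blast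
  have "\<delta> / 2 \<le> \<bar>?F x\<bar> \<or> descent m ?F x (\<delta> / 2)" if x: "x \<in> ccub m 1" for x
  proof (rule ccontr)
    assume neg: "\<not> ?thesis"
    obtain y where y: "y \<in> ccub m (3/2)" "\<delta> + \<delta> * dst m x y + L * (dst m x y)\<^sup>2 < \<bar>?F y\<bar>"
      using far x unfolding F by blast
    have S: "x \<in> ccub m 2" "y \<in> ccub m 2" using x y(1) by (auto simp: ccub_def)
    have Dx: "\<bar>D x l\<bar> \<le> \<delta>" if "l < m" for l
      using descent_of_jets[OF J Lpos x that, of "\<delta> / 2"] neg \<delta> by force
    have "\<bar>\<Sum>l<m. D x l * (y l - x l)\<bar> \<le> (\<Sum>l<m. \<delta> * \<bar>x l - y l\<bar>)"
      using Dx by (intro order_trans[OF sum_abs] sum_mono) (auto simp: abs_mult abs_minus_commute intro!: mult_right_mono)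
    also have "\<dots> = \<delta> * dst m x y" by (simp add: dst_def sum_distrib_left)
    finally have "\<bar>\<Sum>l<m. D x l * (y l - x l)\<bar> \<le> \<delta> * dst m x y" .
    moreover have "\<bar>?F y - ?F x - (\<Sum>l<m. D x l * (y l - x l))\<bar> \<le> L * (dst m x y)\<^sup>2"
      using J S unfolding jets_def by blast
    moreover have "\<bar>?F x\<bar> < \<delta> / 2" using neg by simp
    ultimately show False using y(2) \<delta> by linarith
  qed
  then show ?thesis using a \<delta> by (intro exI[of _ a] exI[of _ "\<delta> / 2"]) auto
qed

section \<open>Generic functions in an atlas of cubes\<close>

text \<open>
  A chart is a pair of mutually inverse maps between an open set and the cube of half-width 3. The cube of
  half-width 2 supports the bump function, and the cubes of half-width 1 cover.
\<close>

locale cube_atlas =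
  fixes m :: nat and T :: "'b topology" and \<tau> :: "'b \<Rightarrow> 'b"
    and \<C> :: "(('b \<Rightarrow> nat \<Rightarrow> real) \<times> ((nat \<Rightarrow> real) \<Rightarrow> 'b)) set"
  assumes second_countable: "second_countable T" and Hausdorff: "Hausdorff_space T"
    and \<tau>_cont: "continuous_map T T \<tau>" and \<tau>_inv: "z \<in> topspace T \<Longrightarrow> \<tau> (\<tau> z) = z"
    and chart_open: "(c, e) \<in> \<C> \<Longrightarrow> openin T (e ` ocub m 3)"
    and chart_homeo: "(c, e) \<in> \<C> \<Longrightarrow>
      homeomorphic_maps (subtopology T (e ` ocub m 3)) (top_of_set (ocub m 3)) c e"
    and chart_free: "(c, e) \<in> \<C> \<Longrightarrow> y \<in> ocub m 3 \<Longrightarrow> \<tau> (e y) \<notin> e ` ocub m 3"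
    and chart_C11: "(c, e) \<in> \<C> \<Longrightarrow> (c', e') \<in> \<C> \<Longrightarrow> y \<in> ocub m 3 \<Longrightarrow> e y \<in> e' ` ocub m 3 \<Longrightarrow> l < m \<Longrightarrow>
      C11_at m (\<lambda>x. c' (e x) l) y"
    and chart_C11_\<tau>: "(c, e) \<in> \<C> \<Longrightarrow> (c', e') \<in> \<C> \<Longrightarrow> y \<in> ocub m 3 \<Longrightarrow> \<tau> (e y) \<in> e' ` ocub m 3 \<Longrightarrow> l < m \<Longrightarrow>
      C11_at m (\<lambda>x. c' (\<tau> (e x)) l) y"
    and chart_cover: "openin T N \<Longrightarrow> z \<in> N \<Longrightarrow> \<exists>(c, e)\<in>\<C>. z \<in> e ` ocub m 1 \<and> e ` ocub m 3 \<subseteq> N"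
begin

lemma ocub_mono: "r \<le> s \<Longrightarrow> ocub m r \<subseteq> ocub m s"
  by (force simp: ocub_def)

lemma ccub_subset_ocub: "r < s \<Longrightarrow> ccub m r \<subseteq> ocub m s"
  by (force simp: ocub_def ccub_def)

lemma \<tau>_top: "z \<in> topspace T \<Longrightarrow> \<tau> z \<in> topspace T"
  using continuous_map_image_subset_topspace[OF \<tau>_cont] by blast

lemma chart_inv: "(c, e) \<in> \<C> \<Longrightarrow> y \<in> ocub m 3 \<Longrightarrow> c (e y) = y"
  using chart_homeo unfolding homeomorphic_maps_def by force

lemma chart_top: "(c, e) \<in> \<C> \<Longrightarrow> y \<in> ocub m 3 \<Longrightarrow> e y \<in> topspace T"
  using openin_subset[OF chart_open] by blast

lemma chart_e_cont: "(c, e) \<in> \<C> \<Longrightarrow> continuous_map (top_of_set (ocub m 3)) T e"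
  using chart_homeo unfolding homeomorphic_maps_def continuous_map_in_subtopology by blast

lemma chart_c_cont: "(c, e) \<in> \<C> \<Longrightarrow> continuous_map (subtopology T (e ` ocub m 3)) euclidean c"
  using chart_homeo unfolding homeomorphic_maps_def continuous_map_in_subtopology by blast

lemma nbhd_in_chart:
  assumes G: "continuous_map (top_of_set (ocub m 3)) T G" and p: "p \<in> ocub m 3" and N: "openin T N" "G p \<in> N"
  obtains r where "0 < r" "\<And>y. y \<in> dball m p r \<Longrightarrow> y \<in> ocub m 3 \<and> G y \<in> N"
proof -
  have "openin (top_of_set (ocub m 3)) {y \<in> topspace (top_of_set (ocub m 3)). G y \<in> N}"
    by (rule openin_continuous_map_preimage[OF G N(1)])
  then have "openin (top_of_set (Eu m)) {y \<in> ocub m 3. G y \<in> N}"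
    using openin_trans[OF _ openin_ocub] by simp
  then obtain r where "0 < r" "dball m p r \<subseteq> {y \<in> ocub m 3. G y \<in> N}"
    by (rule openin_Eu_contains_dball) (use p N in auto)
  then show ?thesis using that by blast
qed

definition chart_bump :: "('b \<Rightarrow> nat \<Rightarrow> real) \<times> ((nat \<Rightarrow> real) \<Rightarrow> 'b) \<Rightarrow> nat \<Rightarrow> 'b \<Rightarrow> real" where
  "chart_bump = (\<lambda>(c, e) l z. if z \<in> e ` ocub m 3 then bump_coord m l (c z) else 0)"

lemma chart_bump_outside:
  assumes "(c, e) \<in> \<C>" "z \<notin> e ` ccub m 2"
  shows "chart_bump (c, e) l z = 0"
proof (cases "z \<in> e ` ocub m 3")
  case True
  then obtain y where y: "y \<in> ocub m 3" "z = e y" by blast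
  then have "y \<notin> ccub m 2" using assms(2) by blast
  then have "\<not> (\<forall>l<m. \<bar>y l\<bar> < 2)" using y(1) by (force simp: ocub_def ccub_def)
  then show ?thesis using bump_eq_0 chart_inv[OF assms(1) y(1)] y(2) by (simp add: chart_bump_def bump_coord_def)
qed (simp add: chart_bump_def)

text \<open>Compactness and the Hausdorff property make the core closed in the whole space, so that
  extending a bump by 0 outside its chart creates no singularity.\<close>

lemma closedin_chart_core:
  assumes "(c, e) \<in> \<C>"
  shows "closedin T (e ` ccub m 2)"
proof (rule compactin_imp_closedin[OF Hausdorff])
  have "compactin (top_of_set (ocub m 3)) (ccub m 2)"
    using compact_ccub ccub_subset_ocub[of 2 3] by (simp add: compactin_subtopology)
  then show "compactin T (e ` ccub m 2)"
    by (rule image_compactin[OF _ chart_e_cont[OF assms]])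
qed

text \<open>Stated for a map \<open>G\<close> in place of a chart, to serve both a parametrization
  and its composition with \<open>\<tau>\<close>. Off the image of the chart the function vanishes
  near the point, as the core is closed.\<close>

lemma C11_at_chart_bump:
  assumes G: "continuous_map (top_of_set (ocub m 3)) T G" and p: "p \<in> ocub m 3" and c: "(c, e) \<in> \<C>"
    and C11: "\<And>l. G p \<in> e ` ocub m 3 \<Longrightarrow> l < m \<Longrightarrow> C11_at m (\<lambda>x. c (G x) l) p"
  shows "C11_at m (\<lambda>y. chart_bump (c, e) l (G y)) p"
proof (cases "G p \<in> e ` ocub m 3")
  case True
  obtain r where r: "0 < r" "\<And>y. y \<in> dball m p r \<Longrightarrow> y \<in> ocub m 3 \<and> G y \<in> e ` ocub m 3"
    using nbhd_in_chart[OF G p chart_open[OF c] True] by blast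
  have cE: "c z \<in> Eu m" if "z \<in> e ` ocub m 3" for z
    using that chart_inv[OF c] by (auto simp: ocub_def)
  have pE: "p \<in> Eu m" using p by (simp add: ocub_def)
  have "C11_at m (\<lambda>y. bump_coord m l (c (G y))) p"
    by (rule C11_at_compose[where f = "bump_coord m l" and G = "\<lambda>y. c (G y)" and m' = m, OF _ C11[OF True] r(1) _ pE])
       (use r cE C11_at_bump_coord[OF cE[OF True]] in auto)
  then show ?thesis
    by (rule C11_at_cong[OF _ r(1)]) (use r in \<open>auto simp: chart_bump_def\<close>)
next
  case False
  have "e ` ccub m 2 \<subseteq> e ` ocub m 3" using ccub_subset_ocub[of 2 3] by auto
  then have "G p \<in> topspace T - e ` ccub m 2"
    using False p continuous_map_image_subset_topspace[OF G] by auto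
  then obtain r where r: "0 < r" "\<And>y. y \<in> dball m p r \<Longrightarrow> y \<in> ocub m 3 \<and> G y \<in> topspace T - e ` ccub m 2"
    using nbhd_in_chart[OF G p openin_diff[OF openin_topspace closedin_chart_core[OF c]]] by blast
  show ?thesis
    by (rule C11_at_cong[OF C11_at_const[of m 0] r(1)]) (use r chart_bump_outside[OF c] in auto)
qed

text \<open>A chart misses its mirror image, so at most one summand is nonzero at any point; on the
  image of the chart itself the sum is the plain bump.\<close>

definition sym_bump :: "('b \<Rightarrow> nat \<Rightarrow> real) \<times> ((nat \<Rightarrow> real) \<Rightarrow> 'b) \<Rightarrow> nat \<Rightarrow> 'b \<Rightarrow> real" where
  "sym_bump x l z = chart_bump x l z + chart_bump x l (\<tau> z)"

definition invariant_C11 :: "('b \<Rightarrow> real) \<Rightarrow> bool" where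
  "invariant_C11 g \<longleftrightarrow> (\<forall>(c, e)\<in>\<C>. C11_on m (ccub m 2) (\<lambda>y. g (e y))) \<and> (\<forall>z\<in>topspace T. g (\<tau> z) = g z)"

lemma invariant_C11_sym_bump:
  assumes x: "x \<in> \<C>"
  shows "invariant_C11 (sym_bump x l)"
proof -
  obtain c' e' where x': "x = (c', e')" "(c', e') \<in> \<C>" using x by (cases x) auto
  have "C11_on m (ccub m 2) (\<lambda>y. sym_bump x l (e y))" if ce: "(c, e) \<in> \<C>" for c e
    unfolding sym_bump_def
  proof (intro C11_on_add C11_at_subset_compact compact_ccub ccub_subset_Eu)
    fix p assume "p \<in> ccub m 2"
    then have p: "p \<in> ocub m 3" using ccub_subset_ocub[of 2 3] by auto
    show "C11_at m (\<lambda>y. chart_bump x l (e y)) p"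
      unfolding x'(1) by (rule C11_at_chart_bump[OF chart_e_cont[OF ce] p x'(2)]) (rule chart_C11[OF ce x'(2) p])
    have "continuous_map (top_of_set (ocub m 3)) T (\<lambda>y. \<tau> (e y))"
      using continuous_map_compose[OF chart_e_cont[OF ce] \<tau>_cont] by (simp add: o_def)
    then show "C11_at m (\<lambda>y. chart_bump x l (\<tau> (e y))) p"
      unfolding x'(1) by (rule C11_at_chart_bump[OF _ p x'(2)]) (rule chart_C11_\<tau>[OF ce x'(2) p])
  qed
  then show ?thesis
    using \<tau>_inv by (auto simp: invariant_C11_def sym_bump_def)
qed

lemma invariant_C11_add: "invariant_C11 f \<Longrightarrow> invariant_C11 g \<Longrightarrow> invariant_C11 (\<lambda>z. f z + g z)"
  by (auto simp: invariant_C11_def intro: C11_on_add)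

lemma invariant_C11_sum:
  "finite I \<Longrightarrow> (\<And>i. i \<in> I \<Longrightarrow> invariant_C11 (f i)) \<Longrightarrow> invariant_C11 (\<lambda>z. \<Sum>i\<in>I. a i * f i z)"
  by (auto simp: invariant_C11_def intro!: C11_on_sum C11_on_scale)

lemma invariant_C11_zero: "invariant_C11 (\<lambda>z. 0)"
  by (auto simp: invariant_C11_def C11_on_zero)

lemma bump_le: "bump m y \<le> 16 ^ m"
proof -
  have "bump m y \<le> (\<Prod>l<m. 16)"
    unfolding bump_def
  proof (rule prod_mono, intro conjI)
    fix l
    have "(max 0 (4 - (y l)\<^sup>2))\<^sup>2 \<le> 4\<^sup>2" by (intro power_mono) auto
    then show "(max 0 (4 - (y l)\<^sup>2))\<^sup>2 \<le> 16" by simp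
  qed simp
  then show ?thesis by simp
qed

lemma bump_coord_le: "\<bar>bump_coord m l y\<bar> \<le> 2 * 16 ^ m"
proof (cases "\<forall>l<m. \<bar>y l\<bar> < 2")
  case True
  then have "\<bar>if l < m then y l else 1\<bar> \<le> 2" by auto
  then have "bump m y * \<bar>if l < m then y l else 1\<bar> \<le> 16 ^ m * 2"
    using bump_le bump_nonneg by (intro mult_mono) auto
  then show ?thesis using bump_nonneg[of m y] by (simp add: bump_coord_def abs_mult)
next
  case False
  then show ?thesis using bump_eq_0 by (simp add: bump_coord_def)
qed

lemma sym_bump_le: "\<bar>sym_bump x l z\<bar> \<le> 4 * 16 ^ m"
proof -
  have "\<bar>chart_bump x l z\<bar> \<le> 2 * 16 ^ m" for z
    using bump_coord_le[of l] by (cases x) (simp add: chart_bump_def)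
  from this[of z] this[of "\<tau> z"] show ?thesis unfolding sym_bump_def by linarith
qed

lemma C11_on_ccub_Lipschitz:
  assumes "C11_on m (ccub m 2) f"
  obtains K where "0 \<le> K" "\<And>x y. x \<in> ccub m 2 \<Longrightarrow> y \<in> ccub m 2 \<Longrightarrow> \<bar>f y - f x\<bar> \<le> K * dst m x y"
proof -
  obtain L D where L: "0 < L" "jets m L (ccub m 2) f D" using C11_on_jets_pos[OF assms] .
  have "\<bar>f y - f x\<bar> \<le> L * (1 + 4 * real m) * dst m x y" if xy: "x \<in> ccub m 2" "y \<in> ccub m 2" for x y
  proof -
    have "dst m x y \<le> (\<Sum>l<m. 4)"
      unfolding dst_def
    proof (rule sum_mono)
      fix l assume "l \<in> {..<m}"
      then have "\<bar>x l\<bar> \<le> 2" "\<bar>y l\<bar> \<le> 2" using xy by (auto simp: ccub_def)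
      then show "\<bar>x l - y l\<bar> \<le> 4" by linarith
    qed
    then have "L * (1 + dst m x y) * dst m x y \<le> L * (1 + 4 * real m) * dst m x y"
      using L(1) by (intro mult_right_mono mult_left_mono) auto
    moreover have "\<bar>f y - f x\<bar> \<le> L * (1 + dst m x y) * dst m x y"
      using jets_Lipschitz[OF L(2) xy] L(1) by simp
    ultimately show ?thesis by linarith
  qed
  then show ?thesis using that[of "L * (1 + 4 * real m)"] L(1) by simp
qed

text \<open>The parameters of the generic perturbation may be confined to any small box. Smallness
  keeps u small, also in its Lipschitz constants on the finitely many charts of \<open>I\<close>;
  placing the box where the constant coefficient dominates fixes the sign of u wherever the bump is
  nonzero.\<close>

lemma generic_step:
  assumes g: "invariant_C11 g" and \<theta>: "0 < \<theta>" and I: "finite I" "I \<subseteq> \<C>" and ce: "(c, e) \<in> \<C>"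
    and \<epsilon>: "\<epsilon> \<in> {1, -1 :: real}"
  shows "\<exists>u \<delta>. invariant_C11 u \<and> (\<forall>z. \<bar>u z\<bar> \<le> \<theta>) \<and>
    (\<forall>(c', e')\<in>I. \<forall>x\<in>ccub m 2. \<forall>y\<in>ccub m 2. \<bar>u (e' y) - u (e' x)\<bar> \<le> \<theta> * dst m x y) \<and>
    (\<forall>z\<in>topspace T. 0 \<le> \<epsilon> * u z) \<and> (\<forall>z\<in>e ` ocub m 1. 0 < \<epsilon> * u z) \<and>
    (\<forall>z. z \<notin> e ` ocub m 3 \<longrightarrow> \<tau> z \<notin> e ` ocub m 3 \<longrightarrow> u z = 0) \<and>
    0 < \<delta> \<and> (\<forall>y\<in>ccub m 1. \<delta> \<le> \<bar>g (e y) + u (e y)\<bar> \<or> descent m (\<lambda>y. g (e y) + u (e y)) y \<delta>)"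
proof -
  let ?\<psi> = "sym_bump (c, e)" and ?D = "e ` ocub m 3"
  have "\<exists>K\<ge>0. \<forall>x\<in>ccub m 2. \<forall>y\<in>ccub m 2. \<bar>?\<psi> l (snd i y) - ?\<psi> l (snd i x)\<bar> \<le> K * dst m x y"
    if "i \<in> I" for i l
  proof -
    obtain c' e' where i: "i = (c', e')" by (cases i)
    then have "C11_on m (ccub m 2) (\<lambda>y. ?\<psi> l (e' y))"
      using invariant_C11_sym_bump[OF ce, of l] that I(2) by (auto simp: invariant_C11_def)
    then show ?thesis using C11_on_ccub_Lipschitz i by (metis snd_conv)
  qed
  then have "\<forall>i l. \<exists>K. i \<in> I \<longrightarrow> 0 \<le> K \<and>
      (\<forall>x\<in>ccub m 2. \<forall>y\<in>ccub m 2. \<bar>?\<psi> l (snd i y) - ?\<psi> l (snd i x)\<bar> \<le> K * dst m x y)"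
    by blast
  then obtain k where k: "\<And>i l. i \<in> I \<Longrightarrow> 0 \<le> k i l"
    "\<And>i l x y. i \<in> I \<Longrightarrow> x \<in> ccub m 2 \<Longrightarrow> y \<in> ccub m 2 \<Longrightarrow> \<bar>?\<psi> l (snd i y) - ?\<psi> l (snd i x)\<bar> \<le> k i l * dst m x y"
    by metis
  define K where "K = (\<Sum>i\<in>I. \<Sum>l\<le>m. k i l)"
  have K0: "0 \<le> K" unfolding K_def using k(1) by (intro sum_nonneg) auto
  have kK: "(\<Sum>l\<le>m. k i l) \<le> K" if "i \<in> I" for i
    unfolding K_def using that I(1) k(1) by (intro member_le_sum) (auto intro: sum_nonneg)
  define B where "B = (real m + 1) * (4 * 16 ^ m)"
  have B0: "0 \<le> B" by (simp add: B_def)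
  \<comment> \<open>\<open>w * B\<close> bounds u, as each of the m + 1 symmetrized bumps is at most
    \<open>4 * 16 ^ m\<close>, and \<open>w * K\<close> bounds its Lipschitz constants on the charts
    of \<open>I\<close>.\<close>
  define w where "w = \<theta> / (B + K + 1)"
  have w: "0 < w" using \<theta> B0 K0 by (simp add: w_def)
  have "w * (B + K + 1) = \<theta>" using B0 K0 by (simp add: w_def)
  then have "w * B + w * K + w = \<theta>" by (simp add: distrib_left)
  then have wB: "w * B \<le> \<theta>" "w * K \<le> \<theta>"
    using w B0 K0 mult_nonneg_nonneg[of w B] mult_nonneg_nonneg[of w K] by linarith+
  \<comment> \<open>On the cube of half-width 2 the linear terms add up to at most 2 m v \<le> w /
    4, half of the least size w / 2 of the constant coefficient.\<close>
  define v where "v = w / (8 * (real m + 1))"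
  have v: "0 < v" "real m * v \<le> w / 8" "v \<le> w / 8"
    using w by (auto simp: v_def field_simps)
  \<comment> \<open>For the sign -1 the interval has to end at - w / 2, hence the shift by its width
    v.\<close>
  define lo where "lo l = (if l = m then (if \<epsilon> = 1 then w / 2 else - w / 2 - v) else 0)" for l
  have gC: "C11_on m (ccub m 2) (\<lambda>y. g (e y))" using g ce by (auto simp: invariant_C11_def)
  obtain a \<delta> where a: "\<forall>l\<le>m. lo l \<le> a l \<and> a l \<le> lo l + v" and \<delta>: "0 < \<delta>"
    and reg: "\<forall>y\<in>ccub m 1. \<delta> \<le> \<bar>g (e y) + (\<Sum>l\<le>m. a l * bump_coord m l y)\<bar> \<or>
      descent m (\<lambda>y. g (e y) + (\<Sum>l\<le>m. a l * bump_coord m l y)) y \<delta>"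
    using generic_regular_perturbation[OF gC v(1), of lo] by blast
  have am: "w / 2 \<le> \<epsilon> * a m" using a[rule_format, of m] \<epsilon> by (auto simp: lo_def)
  have al: "0 \<le> a l \<and> a l \<le> v" if "l < m" for l using a[rule_format, of l] that by (auto simp: lo_def)
  have aw: "\<bar>a l\<bar> \<le> w" if "l \<le> m" for l
    using a[rule_format, OF that] \<epsilon> v w by (auto simp: lo_def split: if_splits)
  define P where "P y = (\<Sum>l\<le>m. a l * bump_coord m l y)" for y
  have P: "P y = bump m y * (a m + (\<Sum>l<m. a l * y l))" for y
    by (simp only: P_def sum_bump_coord)
  have aff: "0 < \<epsilon> * (a m + (\<Sum>l<m. a l * y l))" if y: "\<forall>l<m. \<bar>y l\<bar> < 2" for y
  proof -
    have "\<bar>\<Sum>l<m. a l * y l\<bar> \<le> (\<Sum>l<m. v * 2)"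
    proof (intro order_trans[OF sum_abs] sum_mono)
      fix l assume "l \<in> {..<m}"
      then have "\<bar>a l\<bar> \<le> v" "\<bar>y l\<bar> \<le> 2" using al y by (auto simp: less_imp_le)
      then show "\<bar>a l * y l\<bar> \<le> v * 2" unfolding abs_mult using v by (intro mult_mono) auto
    qed
    then have "\<bar>\<epsilon> * (\<Sum>l<m. a l * y l)\<bar> \<le> w / 4" using v(2) \<epsilon> by auto
    then show ?thesis using am w by (simp add: distrib_left)
  qed
  have Ppos: "0 < \<epsilon> * P y" if "\<forall>l<m. \<bar>y l\<bar> < 2" for y
    using aff[OF that] bump_pos_iff[of m y] that
    unfolding P by (metis mult.left_commute mult_pos_pos)
  have Pnn: "0 \<le> \<epsilon> * P y" for y
    using Ppos[of y] bump_eq_0[of m y] unfolding P by (cases "\<forall>l<m. \<bar>y l\<bar> < 2") auto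
  define u where "u z = (\<Sum>l\<le>m. a l * ?\<psi> l z)" for z
  have u1: "u z = P (c z)" if "z \<in> ?D" for z
  proof -
    have "\<tau> z \<notin> ?D" using that chart_free[OF ce] by blast
    then show ?thesis using that by (simp add: u_def P_def sym_bump_def chart_bump_def)
  qed
  have u2: "u z = P (c (\<tau> z))" if "z \<notin> ?D" "\<tau> z \<in> ?D" for z
    using that by (simp add: u_def P_def sym_bump_def chart_bump_def)
  have u3: "u z = 0" if "z \<notin> ?D" "\<tau> z \<notin> ?D" for z
    using that by (simp add: u_def sym_bump_def chart_bump_def)
  have ue: "u (e y) = P y" if "y \<in> ocub m 3" for y
    using u1[of "e y"] that chart_inv[OF ce that] by auto
  have "invariant_C11 u"
    unfolding u_def[abs_def] by (rule invariant_C11_sum) (auto intro: invariant_C11_sym_bump[OF ce])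
  moreover have "\<bar>u z\<bar> \<le> \<theta>" for z
  proof -
    have "\<bar>u z\<bar> \<le> (\<Sum>l\<le>m. w * (4 * 16 ^ m))"
      unfolding u_def using aw sym_bump_le w
      by (intro order_trans[OF sum_abs] sum_mono) (auto simp: abs_mult intro!: mult_mono)
    also have "\<dots> = w * B" by (simp add: B_def)
    finally show ?thesis using wB(1) by linarith
  qed
  moreover have "\<bar>u (e' y) - u (e' x)\<bar> \<le> \<theta> * dst m x y"
    if i: "(c', e') \<in> I" and xy: "x \<in> ccub m 2" "y \<in> ccub m 2" for c' e' x y
  proof -
    have "u (e' y) - u (e' x) = (\<Sum>l\<le>m. a l * (?\<psi> l (e' y) - ?\<psi> l (e' x)))"
      by (simp add: u_def right_diff_distrib sum_subtractf)
    also have "\<bar>\<dots>\<bar> \<le> (\<Sum>l\<le>m. w * (k (c', e') l * dst m x y))"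
      using aw k(2)[OF i xy] w
      by (intro order_trans[OF sum_abs] sum_mono) (auto simp: abs_mult intro!: mult_mono)
    also have "\<dots> = w * (\<Sum>l\<le>m. k (c', e') l) * dst m x y"
      by (simp add: sum_distrib_left sum_distrib_right mult.assoc)
    also have "\<dots> \<le> w * K * dst m x y"
      using kK[OF i] w by (intro mult_right_mono mult_left_mono) auto
    also have "\<dots> \<le> \<theta> * dst m x y" using wB(2) by (intro mult_right_mono) auto
    finally show ?thesis .
  qed
  moreover have "0 \<le> \<epsilon> * u z" for z
    using u1[of z] u2[of z] u3[of z] Pnn by (metis mult_zero_right order_refl)
  moreover have "0 < \<epsilon> * u z" if z: "z \<in> e ` ocub m 1" for z
  proof -
    obtain y where y: "y \<in> ocub m 1" "z = e y" using z by blast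
    then have "y \<in> ocub m 3" using ocub_mono[of 1 3] by auto
    moreover have "\<forall>l<m. \<bar>y l\<bar> < 2" using y(1) by (force simp: ocub_def)
    ultimately show ?thesis using ue Ppos y(2) by simp
  qed
  moreover have "\<delta> \<le> \<bar>g (e y) + u (e y)\<bar> \<or> descent m (\<lambda>y. g (e y) + u (e y)) y \<delta>" if y: "y \<in> ccub m 1" for y
  proof -
    have eq: "g (e x) + u (e x) = (g (e x) + P x) + 0" if "x \<in> ccub m 2" for x
      using ue[of x] that ccub_subset_ocub[of 2 3] by auto
    have "y \<in> ccub m 2" using y by (force simp: ccub_def)
    \<comment> \<open>A perturbation by 0: u and \<open>P\<close> are compared inside the chart
      only, and \<open>descent_perturb\<close> asks for agreement only on the cube of half-width
      2.\<close>
    moreover have "descent m (\<lambda>y. g (e y) + u (e y)) y (\<delta> - 0)" if "descent m (\<lambda>y. g (e y) + P y) y \<delta>"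
      by (rule descent_perturb[OF that y, of "\<lambda>_. 0"]) (use eq in auto)
    ultimately show ?thesis using reg y eq[of y] unfolding P_def[symmetric] by auto
  qed
  ultimately show ?thesis using u3 \<delta> by (intro exI[of _ u] exI[of _ \<delta>]) auto
qed

end

section \<open>Summing the perturbations over a countable atlas\<close>

lemma descent_mono: "descent m F y \<delta> \<Longrightarrow> \<delta>' \<le> \<delta> \<Longrightarrow> descent m F y \<delta>'"
  unfolding descent_def
  by (elim bexE exE conjE, intro exI bexI conjI ballI impI; assumption?)
     (meson atLeastAtMost_iff diff_left_mono mult_right_mono order_trans)

lemma suminf_half_powers_bound:
  fixes a :: "nat \<Rightarrow> real"
  assumes "\<And>k. \<bar>a k\<bar> \<le> c / 2 ^ k"
  shows "summable a" "\<bar>suminf a\<bar> \<le> 2 * c"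
proof -
  have s: "(\<lambda>k. c * (1/2) ^ k) sums (c * (1 / (1 - 1/2)))"
    by (intro sums_mult geometric_sums) simp
  have b: "norm (a k) \<le> c * (1/2) ^ k" for k using assms[of k] by (simp add: power_divide)
  show "summable a" by (rule summable_comparison_test'[OF sums_summable[OF s], of 0]) (use b in auto)
  have "norm (suminf a) \<le> (\<Sum>k. c * (1/2) ^ k)"
    by (rule norm_suminf_le[OF b sums_summable[OF s]])
  then show "\<bar>suminf a\<bar> \<le> 2 * c" using sums_unique[OF s] by simp
qed

lemma continuous_on_dst_Lipschitz:
  assumes "\<And>x y. x \<in> S \<Longrightarrow> y \<in> S \<Longrightarrow> \<bar>F y - F x\<bar> \<le> K * dst m x y"
  shows "continuous_on S F"
  unfolding continuous_on_def
proof
  fix x assume x: "x \<in> S"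
  have "continuous_on S (\<lambda>y. K * dst m x y)" by (intro continuous_intros)
  then have "((\<lambda>y. K * dst m x y) \<longlongrightarrow> 0) (at x within S)"
    using x unfolding continuous_on_def by force
  then have "((\<lambda>y. F y - F x) \<longlongrightarrow> 0) (at x within S)"
    by (rule Lim_null_comparison[rotated]) (use assms x in \<open>auto simp: eventually_at_filter\<close>)
  then show "(F \<longlongrightarrow> F x) (at x within S)" by (simp add: LIM_zero_iff)
qed

context cube_atlas
begin

lemma openin_chart_image:
  assumes ce: "(c, e) \<in> \<C>" and r: "r \<le> 3"
  shows "openin T (e ` ocub m r)"
proof -
  have "{z \<in> topspace (subtopology T (e ` ocub m 3)). c z \<in> ocub m r} = e ` ocub m r"
    using ocub_mono[OF r] chart_inv[OF ce] chart_top[OF ce] by auto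
  moreover have "openin (top_of_set (ocub m 3)) (ocub m r)"
    using openin_ocub[of m r] ocub_mono[OF r] by (rule openin_subset_trans) (auto simp: ocub_def)
  moreover have "continuous_map (subtopology T (e ` ocub m 3)) (top_of_set (ocub m 3)) c"
    using chart_homeo[OF ce] by (simp add: homeomorphic_maps_def)
  ultimately have "openin (subtopology T (e ` ocub m 3)) (e ` ocub m r)"
    using openin_continuous_map_preimage by fastforce
  then show ?thesis using openin_trans_full chart_open[OF ce] by blast
qed

text \<open>A state consists of the current sum and the size allowed for the next summand. The new
  size is at most half the old one and at most a quarter of the margin just reached. All later
  summands together amount to at most twice the new size, so half of the margin survives.\<close>

definition good_step where
  "good_step \<kappa> \<epsilon> n x x' u \<longleftrightarrow> fst x' = (\<lambda>z. fst x z + u z) \<and> invariant_C11 u \<and> (\<forall>z. \<bar>u z\<bar> \<le> snd x) \<and>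
     (\<forall>k\<le>n. \<forall>p\<in>ccub m 2. \<forall>q\<in>ccub m 2. \<bar>u (snd (\<kappa> k) q) - u (snd (\<kappa> k) p)\<bar> \<le> snd x * dst m p q) \<and>
     (\<forall>z\<in>topspace T. 0 \<le> \<epsilon> n * u z) \<and> (\<forall>z\<in>snd (\<kappa> n) ` ocub m 1. 0 < \<epsilon> n * u z) \<and>
     (\<forall>z. z \<notin> snd (\<kappa> n) ` ocub m 3 \<longrightarrow> \<tau> z \<notin> snd (\<kappa> n) ` ocub m 3 \<longrightarrow> u z = 0) \<and>
     snd x' \<le> snd x / 2 \<and>
     (\<forall>y\<in>ccub m 1. 4 * snd x' \<le> \<bar>fst x' (snd (\<kappa> n) y)\<bar> \<or>
        descent m (\<lambda>y. fst x' (snd (\<kappa> n) y)) y (4 * snd x'))"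
  for \<kappa> :: "nat \<Rightarrow> ('b \<Rightarrow> nat \<Rightarrow> real) \<times> ((nat \<Rightarrow> real) \<Rightarrow> 'b)" and \<epsilon> :: "nat \<Rightarrow> real"
    and x x' :: "('b \<Rightarrow> real) \<times> real"

lemma generic_sequence:
  assumes \<kappa>: "\<And>n. \<kappa> n \<in> \<C>" and \<epsilon>: "\<And>n. \<epsilon> n \<in> {1, -1 :: real}"
  shows "\<exists>x u. \<forall>n. fst (x 0) = (\<lambda>z. 0) \<and> invariant_C11 (fst (x n)) \<and> 0 < snd (x n) \<and>
    good_step \<kappa> \<epsilon> n (x n) (x (Suc n)) (u n)"
proof -
  define P where "P n x \<longleftrightarrow> (n = 0 \<longrightarrow> fst x = (\<lambda>z. 0)) \<and> invariant_C11 (fst x) \<and> 0 < snd x"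
    for n :: nat and x :: "('b \<Rightarrow> real) \<times> real"
  have "\<exists>x. \<forall>n. P n (x n) \<and> (\<exists>u. good_step \<kappa> \<epsilon> n (x n) (x (Suc n)) u)"
  proof (rule dependent_nat_choice)
    show "\<exists>x. P 0 x" by (rule exI[of _ "(\<lambda>z. 0, 1)"]) (simp add: P_def invariant_C11_zero)
    fix x n assume x: "P n x"
    obtain c e where ce: "\<kappa> n = (c, e)" "(c, e) \<in> \<C>" using \<kappa>[of n] by (cases "\<kappa> n") auto
    have I: "finite (\<kappa> ` {..n})" "\<kappa> ` {..n} \<subseteq> \<C>" using \<kappa> by auto
    obtain u \<delta> where u: "invariant_C11 u" "\<forall>z. \<bar>u z\<bar> \<le> snd x"
        "\<forall>(c', e')\<in>\<kappa> ` {..n}. \<forall>p\<in>ccub m 2. \<forall>q\<in>ccub m 2. \<bar>u (e' q) - u (e' p)\<bar> \<le> snd x * dst m p q"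
        "\<forall>z\<in>topspace T. 0 \<le> \<epsilon> n * u z" "\<forall>z\<in>e ` ocub m 1. 0 < \<epsilon> n * u z"
        "\<forall>z. z \<notin> e ` ocub m 3 \<longrightarrow> \<tau> z \<notin> e ` ocub m 3 \<longrightarrow> u z = 0" "0 < \<delta>"
        "\<forall>y\<in>ccub m 1. \<delta> \<le> \<bar>fst x (e y) + u (e y)\<bar> \<or> descent m (\<lambda>y. fst x (e y) + u (e y)) y \<delta>"
      using generic_step[OF _ _ I ce(2) \<epsilon>[of n], of "fst x" "snd x"] x unfolding P_def by blast
    define \<theta> where "\<theta> = min (snd x / 2) (\<delta> / 4)"
    have \<theta>: "0 < \<theta>" "\<theta> \<le> snd x / 2" "4 * \<theta> \<le> \<delta>" using x u(7) by (auto simp: \<theta>_def P_def)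
    let ?x' = "(\<lambda>z. fst x z + u z, \<theta>)"
    have "P (Suc n) ?x'" using x u(1) \<theta>(1) by (simp add: P_def invariant_C11_add)
    moreover have "good_step \<kappa> \<epsilon> n x ?x' u"
      unfolding good_step_def
    proof (intro conjI ballI)
      show "\<forall>k\<le>n. \<forall>p\<in>ccub m 2. \<forall>q\<in>ccub m 2. \<bar>u (snd (\<kappa> k) q) - u (snd (\<kappa> k) p)\<bar> \<le> snd x * dst m p q"
      proof (intro allI impI)
        fix k assume "k \<le> n"
        then have "(fst (\<kappa> k), snd (\<kappa> k)) \<in> \<kappa> ` {..n}" by simp
        from bspec[OF u(3) this] show "\<forall>p\<in>ccub m 2. \<forall>q\<in>ccub m 2. \<bar>u (snd (\<kappa> k) q) - u (snd (\<kappa> k) p)\<bar> \<le> snd x * dst m p q"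
          by (simp only: prod.case)
      qed
      fix y assume "y \<in> ccub m 1"
      then show "4 * snd ?x' \<le> \<bar>fst ?x' (snd (\<kappa> n) y)\<bar> \<or> descent m (\<lambda>y. fst ?x' (snd (\<kappa> n) y)) y (4 * snd ?x')"
        using u(8) \<theta>(3) descent_mono[of m "\<lambda>y. fst x (e y) + u (e y)" y \<delta> "4 * \<theta>"] ce(1) by force
    qed (use u \<theta> ce in auto)
    ultimately show "\<exists>x'. P (Suc n) x' \<and> (\<exists>u. good_step \<kappa> \<epsilon> n x x' u)" by blast
  qed
  then obtain x where x: "\<And>n. P n (x n)" "\<And>n. \<exists>u. good_step \<kappa> \<epsilon> n (x n) (x (Suc n)) u" by blast
  obtain u where "\<And>n. good_step \<kappa> \<epsilon> n (x n) (x (Suc n)) (u n)" using x(2) by metis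
  then show ?thesis using x(1) unfolding P_def by blast
qed

text \<open>
  Each step is so small that all later steps together cannot destroy the regularity achieved on
  the charts treated before.
\<close>

definition generic_sum where
  "generic_sum \<kappa> \<epsilon> g u \<longleftrightarrow> continuous_map T euclideanreal g \<and> (\<forall>z\<in>topspace T. g (\<tau> z) = g z) \<and>
    (\<forall>z. (\<lambda>n. u n z) sums g z) \<and>
    (\<forall>n. \<forall>z\<in>topspace T. 0 \<le> \<epsilon> n * u n z) \<and> (\<forall>n. \<forall>z\<in>snd (\<kappa> n) ` ocub m 1. 0 < \<epsilon> n * u n z) \<and>
    (\<forall>n z. z \<notin> snd (\<kappa> n) ` ocub m 3 \<longrightarrow> \<tau> z \<notin> snd (\<kappa> n) ` ocub m 3 \<longrightarrow> u n z = 0) \<and>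
    (\<forall>n. \<exists>\<delta>>0. \<forall>y\<in>ccub m 1. g (snd (\<kappa> n) y) \<noteq> 0 \<or> descent m (\<lambda>y. g (snd (\<kappa> n) y)) y \<delta>)"
  for \<kappa> :: "nat \<Rightarrow> ('b \<Rightarrow> nat \<Rightarrow> real) \<times> ((nat \<Rightarrow> real) \<Rightarrow> 'b)" and \<epsilon> :: "nat \<Rightarrow> real"

text \<open>By comparison with a geometric series the tail from n on is bounded by
  \<open>2 * \<theta> n\<close> and has this Lipschitz constant on every chart k \<le> n. So the
  margin \<open>4 * \<theta> (Suc n)\<close> reached on chart n leaves
  \<open>2 * \<theta> (Suc n)\<close> for the whole sum.\<close>

lemma generic_limit:
  assumes \<kappa>: "\<And>n. \<kappa> n \<in> \<C>" "topspace T \<subseteq> (\<Union>n. snd (\<kappa> n) ` ocub m 1)"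
    and \<epsilon>: "\<And>n. \<epsilon> n \<in> {1, -1 :: real}"
  shows "\<exists>g u. generic_sum \<kappa> \<epsilon> g u"
proof -
  obtain x u where x: "fst (x 0) = (\<lambda>z. 0)" "\<And>n. invariant_C11 (fst (x n))" "\<And>n. 0 < snd (x n)"
    and step: "\<And>n. good_step \<kappa> \<epsilon> n (x n) (x (Suc n)) (u n)"
    using generic_sequence[of \<kappa> \<epsilon>, OF \<kappa>(1) \<epsilon>] by blast
  define \<theta> where "\<theta> n = snd (x n)" for n
  have \<theta>0: "0 < \<theta> n" for n using x(3) by (simp add: \<theta>_def)
  have u_le: "\<bar>u n z\<bar> \<le> \<theta> n" for n z using step[of n] by (simp add: good_step_def \<theta>_def)
  have u_Lip: "\<bar>u n (snd (\<kappa> k) q) - u n (snd (\<kappa> k) p)\<bar> \<le> \<theta> n * dst m p q"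
    if "k \<le> n" "p \<in> ccub m 2" "q \<in> ccub m 2" for n k p q
    using step[of n] that by (simp add: good_step_def \<theta>_def)
  have half: "\<theta> (Suc n) \<le> \<theta> n / 2" for n using step[of n] by (simp add: good_step_def \<theta>_def)
  have \<theta>k: "\<theta> (k + n) \<le> \<theta> n / 2 ^ k" for k n
  proof (induction k)
    case (Suc k)
    have "\<theta> (Suc k + n) \<le> \<theta> (k + n) / 2" using half[of "k + n"] by simp
    also have "\<dots> \<le> \<theta> n / 2 ^ k / 2" using Suc by (intro divide_right_mono) auto
    finally show ?case by simp
  qed simp
  have partial: "fst (x n) z = (\<Sum>k<n. u k z)" for n z
    by (induction n) (use x(1) step in \<open>auto simp: good_step_def\<close>)
  define g where "g z = (\<Sum>n. u n z)" for z
  have tail: "\<bar>u (k + n) z\<bar> \<le> \<theta> n / 2 ^ k" for k n z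
    using u_le[of "k + n" z] \<theta>k[of k n] by linarith
  have sm: "summable (\<lambda>n. u n z)" for z
    using suminf_half_powers_bound(1)[of "\<lambda>k. u k z" "\<theta> 0"] tail[of _ 0] by simp
  define v where "v n z = (\<Sum>k. u (k + n) z)" for n z
  have gv: "g z = fst (x n) z + v n z" for n z
    unfolding g_def v_def partial using suminf_split_initial_segment[OF sm, of z n] by simp
  have v_le: "\<bar>v n z\<bar> \<le> 2 * \<theta> n" for n z
    unfolding v_def by (rule suminf_half_powers_bound(2)) (rule tail)
  have v_Lip: "\<bar>v n (snd (\<kappa> k) q) - v n (snd (\<kappa> k) p)\<bar> \<le> 2 * \<theta> n * dst m p q"
    if kn: "k \<le> n" and pq: "p \<in> ccub m 2" "q \<in> ccub m 2" for n k p q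
  proof -
    have s: "summable (\<lambda>k. u (k + n) z)" for z using sm summable_ignore_initial_segment by blast
    have "v n (snd (\<kappa> k) q) - v n (snd (\<kappa> k) p) = (\<Sum>j. u (j + n) (snd (\<kappa> k) q) - u (j + n) (snd (\<kappa> k) p))"
      unfolding v_def by (rule suminf_diff[OF s s])
    also have "\<bar>\<dots>\<bar> \<le> 2 * (\<theta> n * dst m p q)"
    proof (rule suminf_half_powers_bound(2))
      fix j
      have "\<bar>u (j + n) (snd (\<kappa> k) q) - u (j + n) (snd (\<kappa> k) p)\<bar> \<le> \<theta> (j + n) * dst m p q"
        using u_Lip[of k "j + n"] kn pq by simp
      also have "\<dots> \<le> \<theta> n / 2 ^ j * dst m p q" using \<theta>k by (intro mult_right_mono) auto
      finally show "\<bar>u (j + n) (snd (\<kappa> k) q) - u (j + n) (snd (\<kappa> k) p)\<bar> \<le> \<theta> n * dst m p q / 2 ^ j" by simp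
    qed
    finally show ?thesis by simp
  qed
  have "\<exists>\<delta>>0. \<forall>y\<in>ccub m 1. g (snd (\<kappa> n) y) \<noteq> 0 \<or> descent m (\<lambda>y. g (snd (\<kappa> n) y)) y \<delta>" for n
  proof (intro exI[of _ "2 * \<theta> (Suc n)"] conjI ballI)
    fix y assume y: "y \<in> ccub m 1"
    have "4 * \<theta> (Suc n) \<le> \<bar>fst (x (Suc n)) (snd (\<kappa> n) y)\<bar> \<or>
        descent m (\<lambda>y. fst (x (Suc n)) (snd (\<kappa> n) y)) y (4 * \<theta> (Suc n))"
      using step[of n] y unfolding good_step_def \<theta>_def by blast
    then show "g (snd (\<kappa> n) y) \<noteq> 0 \<or> descent m (\<lambda>y. g (snd (\<kappa> n) y)) y (2 * \<theta> (Suc n))"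
    proof
      assume "4 * \<theta> (Suc n) \<le> \<bar>fst (x (Suc n)) (snd (\<kappa> n) y)\<bar>"
      then show ?thesis
        using gv[of "snd (\<kappa> n) y" "Suc n"] v_le[of "Suc n" "snd (\<kappa> n) y"] \<theta>0[of "Suc n"] by linarith
    next
      assume "descent m (\<lambda>y. fst (x (Suc n)) (snd (\<kappa> n) y)) y (4 * \<theta> (Suc n))"
      then have "descent m (\<lambda>y. g (snd (\<kappa> n) y)) y (4 * \<theta> (Suc n) - 2 * \<theta> (Suc n))"
        by (rule descent_perturb[OF _ y, where v = "\<lambda>y. v (Suc n) (snd (\<kappa> n) y)"])
           (use v_Lip[of n "Suc n"] gv[of _ "Suc n"] in auto)
      then show ?thesis by simp
    qed
  qed (use \<theta>0 in simp)
  moreover have "continuous_map T euclideanreal g"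
  \<comment> \<open>Continuity is tested chart by chart: on chart n the first n summands form a
    function of class C^{1,1}, and the tail is Lipschitz.\<close>
  proof (rule pasting_lemma[where I = UNIV and T = "\<lambda>n. snd (\<kappa> n) ` ocub m 1" and f = "\<lambda>n. g"])
    fix n
    obtain c e where ce: "\<kappa> n = (c, e)" "(c, e) \<in> \<C>" using \<kappa>(1)[of n] by (cases "\<kappa> n") auto
    show "openin T (snd (\<kappa> n) ` ocub m 1)" using openin_chart_image[OF ce(2), of 1] ce(1) by simp
    have "C11_on m (ccub m 2) (\<lambda>y. fst (x n) (e y))"
      using x(2)[of n] ce(2) by (auto simp: invariant_C11_def)
    then obtain K where K: "\<And>p q. p \<in> ccub m 2 \<Longrightarrow> q \<in> ccub m 2 \<Longrightarrow>
        \<bar>fst (x n) (e q) - fst (x n) (e p)\<bar> \<le> K * dst m p q"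
      using C11_on_ccub_Lipschitz by blast
    have "continuous_on (ccub m 2) (\<lambda>y. g (e y))"
    proof (rule continuous_on_dst_Lipschitz)
      fix p q assume pq: "p \<in> ccub m 2" "q \<in> ccub m 2"
      have "\<bar>g (e q) - g (e p)\<bar> \<le> K * dst m p q + 2 * \<theta> n * dst m p q"
        using K[OF pq] v_Lip[of n n, OF _ pq] ce(1) gv[of "e q" n] gv[of "e p" n] by simp
      then show "\<bar>g (e q) - g (e p)\<bar> \<le> (K + 2 * \<theta> n) * dst m p q" by (simp add: distrib_right)
    qed
    then have "continuous_on (ocub m 1) (\<lambda>y. g (e y))"
      by (rule continuous_on_subset) (force simp: ocub_def ccub_def)
    then have 1: "continuous_map (top_of_set (ocub m 1)) euclideanreal (\<lambda>y. g (e y))" by simp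
    have sub: "e ` ocub m 1 \<subseteq> e ` ocub m 3" using ocub_mono[of 1 3] by auto
    have ci: "c z \<in> ocub m 1 \<and> e (c z) = z" if "z \<in> e ` ocub m 1" for z
      using that chart_inv[OF ce(2)] ocub_mono[of 1 3] by fastforce
    have "continuous_map (subtopology T (e ` ocub m 1)) (top_of_set (ocub m 1)) c"
      using continuous_map_from_subtopology_mono[OF chart_c_cont[OF ce(2)] sub] ci
      by (auto simp: continuous_map_in_subtopology)
    from continuous_map_compose[OF this 1]
    have "continuous_map (subtopology T (e ` ocub m 1)) euclideanreal g"
      by (rule continuous_map_eq) (use ci in auto)
    then show "continuous_map (subtopology T (snd (\<kappa> n) ` ocub m 1)) euclideanreal g" using ce(1) by simp
    show "\<exists>j. j \<in> UNIV \<and> z \<in> snd (\<kappa> j) ` ocub m 1 \<and> g z = g z" if "z \<in> topspace T" for z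
      using \<kappa>(2) that by blast
  qed simp
  moreover have "g (\<tau> z) = g z" if "z \<in> topspace T" for z
    unfolding g_def using step that by (simp add: good_step_def invariant_C11_def)
  moreover have "(\<lambda>n. u n z) sums g z" for z unfolding g_def by (rule summable_sums[OF sm])
  moreover have "0 \<le> \<epsilon> n * u n z" if "z \<in> topspace T" for n z
    using step[of n] that unfolding good_step_def by blast
  moreover have "0 < \<epsilon> n * u n z" if "z \<in> snd (\<kappa> n) ` ocub m 1" for n z
    using step[of n] that unfolding good_step_def by blast
  moreover have "u n z = 0" if "z \<notin> snd (\<kappa> n) ` ocub m 3" "\<tau> z \<notin> snd (\<kappa> n) ` ocub m 3" for n z
    using step[of n] that unfolding good_step_def by blast
  ultimately have "generic_sum \<kappa> \<epsilon> g u" unfolding generic_sum_def by simp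
  then show ?thesis by blast
qed

text \<open>Charts inside U get the sign -1 and charts missing C the sign +1; since C lies in U,
  charts of both kinds together cover. On C the positive summands vanish, because the invariant set
  C avoids their supports, and some negative one does not; outside U the roles are
  exchanged.\<close>

lemma generic_separating_function:
  assumes C: "closedin T C" "\<tau> ` C \<subseteq> C" and U: "openin T U" "\<tau> ` U \<subseteq> U" and CU: "C \<subseteq> U"
  shows "\<exists>g. continuous_map T euclideanreal g \<and> (\<forall>z\<in>topspace T. g (\<tau> z) = g z) \<and>
    (\<forall>z\<in>C. g z < 0) \<and> (\<forall>z\<in>topspace T - U. 0 < g z) \<and>
    (\<forall>z\<in>topspace T. g z = 0 \<longrightarrow>
      (\<exists>(c, e)\<in>\<C>. \<exists>y\<in>ocub m 1. z = e y \<and> (\<exists>\<delta>>0. descent m (\<lambda>y. g (e y)) y \<delta>)))"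
\<comment> \<open>An empty space may offer no chart to serve as the default of the
  enumeration.\<close>
proof (cases "topspace T = {}")
  case True
  then show ?thesis using closedin_subset[OF C(1)]
    by (intro exI[of _ "\<lambda>_. 0"]) auto
next
  case False
  define P where "P = (\<lambda>(x, \<epsilon>). x \<in> \<C> \<and> (\<epsilon> = -1 \<and> snd x ` ocub m 3 \<subseteq> U \<or> \<epsilon> = (1::real) \<and> snd x ` ocub m 3 \<subseteq> topspace T - C))"
  have ex: "\<exists>x. P x \<and> openin T (snd (fst x) ` ocub m 1) \<and> z \<in> snd (fst x) ` ocub m 1" if z: "z \<in> topspace T" for z
  proof (cases "z \<in> U")
    case True
    then obtain c e where "(c, e) \<in> \<C>" "z \<in> e ` ocub m 1" "e ` ocub m 3 \<subseteq> U"
      using chart_cover[OF U(1)] by blast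
    then show ?thesis using openin_chart_image[of c e 1] by (intro exI[of _ "((c, e), -1)"]) (auto simp: P_def)
  next
    case False
    then have "z \<in> topspace T - C" using z CU by blast
    moreover have "openin T (topspace T - C)" using C(1) by blast
    ultimately obtain c e where "(c, e) \<in> \<C>" "z \<in> e ` ocub m 1" "e ` ocub m 3 \<subseteq> topspace T - C"
      using chart_cover by blast
    then show ?thesis using openin_chart_image[of c e 1] by (intro exI[of _ "((c, e), 1)"]) (auto simp: P_def)
  qed
  obtain d where d: "P d" using ex False by blast
  obtain s :: "nat \<Rightarrow> _" where s: "\<And>j. P (s j)" "topspace T \<subseteq> (\<Union>j. snd (fst (s j)) ` ocub m 1)"
    by (rule second_countable_sequence[OF second_countable ex, where d = d]) (use d in auto)
  define \<kappa> where "\<kappa> n = fst (s n)" for n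
  define \<epsilon> where "\<epsilon> n = snd (s n)" for n
  have \<kappa>: "\<kappa> n \<in> \<C>" and \<epsilon>: "\<epsilon> n = -1 \<and> snd (\<kappa> n) ` ocub m 3 \<subseteq> U \<or> \<epsilon> n = 1 \<and> snd (\<kappa> n) ` ocub m 3 \<subseteq> topspace T - C" for n
    using s(1)[of n] by (auto simp: P_def \<kappa>_def \<epsilon>_def split_beta)
  have cov: "topspace T \<subseteq> (\<Union>n. snd (\<kappa> n) ` ocub m 1)" using s(2) by (simp add: \<kappa>_def)
  have \<epsilon>1: "\<epsilon> n \<in> {1, -1}" for n using \<epsilon>[of n] by auto
  obtain g u where gs: "generic_sum \<kappa> \<epsilon> g u"
    using generic_limit[of \<kappa> \<epsilon>, OF \<kappa> cov \<epsilon>1] by blast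
  then have g: "continuous_map T euclideanreal g" "\<And>z. z \<in> topspace T \<Longrightarrow> g (\<tau> z) = g z"
    "\<And>z. (\<lambda>n. u n z) sums g z"
    "\<And>n z. z \<in> topspace T \<Longrightarrow> 0 \<le> \<epsilon> n * u n z" "\<And>n z. z \<in> snd (\<kappa> n) ` ocub m 1 \<Longrightarrow> 0 < \<epsilon> n * u n z"
    "\<And>n z. z \<notin> snd (\<kappa> n) ` ocub m 3 \<Longrightarrow> \<tau> z \<notin> snd (\<kappa> n) ` ocub m 3 \<Longrightarrow> u n z = 0"
    "\<And>n. \<exists>\<delta>>0. \<forall>y\<in>ccub m 1. g (snd (\<kappa> n) y) \<noteq> 0 \<or> descent m (\<lambda>y. g (snd (\<kappa> n) y)) y \<delta>"
    unfolding generic_sum_def by blast+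
  have core: "z \<in> snd (\<kappa> n) ` ocub m 3" if "z \<in> snd (\<kappa> n) ` ocub m 1" for z n
    using that ocub_mono[of 1 3] by auto
  have "g z < 0" if z: "z \<in> C" for z
  proof -
    have zT: "z \<in> topspace T" and \<tau>z: "\<tau> z \<in> C" using z C closedin_subset[OF C(1)] by auto
    have nn: "0 \<le> - u n z" for n
      using \<epsilon>[of n]
    proof (elim disjE conjE)
      assume "\<epsilon> n = 1" "snd (\<kappa> n) ` ocub m 3 \<subseteq> topspace T - C"
      then have "u n z = 0" using z \<tau>z by (intro g(6)) blast+
      then show ?thesis by simp
    qed (use g(4)[OF zT, of n] in simp)
    obtain n where n: "z \<in> snd (\<kappa> n) ` ocub m 1" using cov zT by blast
    then have "\<epsilon> n = -1" using \<epsilon>[of n] core[OF n] z by blast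
    then have "0 < - u n z" using g(5)[OF n] by simp
    moreover have "(\<lambda>n. - u n z) sums (- g z)" by (rule sums_minus[OF g(3)])
    ultimately have "0 < - g z"
      using suminf_pos2[of "\<lambda>n. - u n z" n] nn sums_summable sums_unique by metis
    then show ?thesis by simp
  qed
  moreover have "0 < g z" if z: "z \<in> topspace T - U" for z
  proof -
    have zT: "z \<in> topspace T" using z by simp
    have \<tau>z: "\<tau> z \<notin> U" using z U(2) \<tau>_inv[OF zT] by force
    have nn: "0 \<le> u n z" for n
      using \<epsilon>[of n]
    proof (elim disjE conjE)
      assume "\<epsilon> n = -1" "snd (\<kappa> n) ` ocub m 3 \<subseteq> U"
      then have "u n z = 0" using z \<tau>z by (intro g(6)) blast+
      then show ?thesis by simp
    qed (use g(4)[OF zT, of n] in simp)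
    obtain n where n: "z \<in> snd (\<kappa> n) ` ocub m 1" using cov zT by blast
    then have "\<epsilon> n = 1" using \<epsilon>[of n] core[OF n] z by blast
    then have "0 < u n z" using g(5)[OF n] by simp
    then show ?thesis
      using suminf_pos2[of "\<lambda>n. u n z" n] nn sums_summable[OF g(3)] sums_unique[OF g(3)] by metis
  qed
  moreover have "\<exists>(c, e)\<in>\<C>. \<exists>y\<in>ocub m 1. z = e y \<and> (\<exists>\<delta>>0. descent m (\<lambda>y. g (e y)) y \<delta>)"
    if z: "z \<in> topspace T" "g z = 0" for z
  proof -
    obtain n y where n: "y \<in> ocub m 1" "z = snd (\<kappa> n) y" using cov z(1) by blast
    have "y \<in> ccub m 1" using n(1) by (force simp: ocub_def ccub_def)
    then obtain \<delta> where "0 < \<delta>" "descent m (\<lambda>y. g (snd (\<kappa> n) y)) y \<delta>"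
      using g(7)[of n] z(2) n(2) by auto
    then show ?thesis using n \<kappa>[of n] by (intro bexI[of _ "\<kappa> n"]) (auto simp: split_beta)
  qed
  ultimately show ?thesis using g(1,2) by blast
qed

end

section \<open>Pushing into a sublevel set\<close>

text \<open>
  The push may overshoot into the interior of \<open>A\<close>; only the points with \<open>g > 0\<close> are moved, so no implicit
  function theorem is needed.
\<close>

lemma (in cube_atlas) local_push:
  assumes ce: "(c, e) \<in> \<C>" and y0: "y0 \<in> ocub m 1"
    and g: "continuous_map T euclideanreal g" "\<And>z. z \<in> topspace T \<Longrightarrow> g (\<tau> z) = g z" "g (e y0) = 0"
    and d: "0 < \<delta>" "descent m (\<lambda>y. g (e y)) y0 \<delta>"
  defines "A \<equiv> {z \<in> topspace T. g z \<le> 0}"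
  shows "\<exists>h N. continuous_map (prod_topology (top_of_set {0..1::real}) T) T h \<and>
     (\<forall>z\<in>topspace T. h (0, z) = z) \<and>
     (\<forall>t\<in>{0..1}. \<forall>z\<in>topspace T. h (t, \<tau> z) = \<tau> (h (t, z))) \<and>
     (\<forall>t\<in>{0..1}. \<forall>a\<in>A. h (t, a) = a) \<and>
     openin T N \<and> \<tau> ` N \<subseteq> N \<and> (\<forall>z\<in>N. h (1, z) \<in> A) \<and> e y0 \<in> N"
proof -
  obtain l \<sigma> \<eta> where l: "l < m" and \<sigma>: "\<sigma> \<in> {1, -1 :: real}" and \<eta>: "0 < \<eta>" "\<eta> \<le> 1/2"
    and desc: "\<And>y s. y \<in> Eu m \<Longrightarrow> dst m y y0 \<le> \<eta> \<Longrightarrow> s \<in> {0..\<eta>} \<Longrightarrow>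
      g (e (y(l := y l - \<sigma> * s))) \<le> g (e y) - \<delta> * s"
    using d(2) unfolding descent_def by blast
  let ?I = "top_of_set {0..1::real}" and ?O = "ocub m 3"
  let ?D = "e ` ocub m 3" and ?S = "e ` ccub m 2"
  \<comment> \<open>A cut-off: 1 within distance \<open>\<eta> / 2\<close> of y0, and 0 from
    distance \<open>\<eta>\<close> on.\<close>
  define \<rho> where "\<rho> y = max 0 (min 1 (2 - 2 * dst m y y0 / \<eta>))" for y
  \<comment> \<open>At rate \<open>\<delta>\<close> a step of length
    \<open>max 0 (g (e y)) / \<delta>\<close> suffices to bring g down to 0; the cap
    \<open>\<eta>\<close> keeps the motion where the descent estimate holds. On A the displacement
    is 0.\<close>
  define disp where "disp y = \<rho> y * min (max 0 (g (e y)) / \<delta>) \<eta>" for y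
  define \<phi> where "\<phi> p = (snd p)(l := snd p l - \<sigma> * (fst p * disp (snd p)))" for p :: "real \<times> (nat \<Rightarrow> real)"
  have disp: "0 \<le> disp y" "disp y \<le> \<eta>" for y
  proof -
    have "0 \<le> \<rho> y" "\<rho> y \<le> 1" "0 \<le> min (max 0 (g (e y)) / \<delta>) \<eta>" "min (max 0 (g (e y)) / \<delta>) \<eta> \<le> \<eta>"
      using d(1) \<eta>(1) by (auto simp: \<rho>_def)
    then show "0 \<le> disp y" "disp y \<le> \<eta>"
      unfolding disp_def using mult_mono[of "\<rho> y" 1 "min (max 0 (g (e y)) / \<delta>) \<eta>" \<eta>] \<eta> by auto
  qed
  have far: "disp y = 0" if "\<eta> \<le> dst m y y0" for y
  proof -
    have "2 - 2 * dst m y y0 / \<eta> \<le> 0" using that \<eta>(1) by (simp add: field_simps)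
    then have "\<rho> y = 0" unfolding \<rho>_def by linarith
    then show ?thesis by (simp add: disp_def)
  qed
  have "y0 \<in> ccub m 1" using y0 by (auto simp: ocub_def ccub_def less_imp_le)
  note near = ccub_2_of_near[OF this]
  have OE: "y \<in> Eu m" if "y \<in> ?O" for y using that by (simp add: ocub_def)
  have \<phi>O: "\<phi> (t, y) \<in> ?O" if y: "y \<in> ?O" and t: "t \<in> {0..1}" for t y
  proof (cases "dst m y y0 < \<eta>")
    case False
    then show ?thesis using far y by (simp add: \<phi>_def)
  next
    case True
    have "\<bar>t * disp y\<bar> \<le> 1 * \<eta>" unfolding abs_mult using t disp[of y] by (intro mult_mono) auto
    then have "dst m (\<phi> (t, y)) y \<le> \<eta>"
      using \<sigma> dst_upd[OF l, of y] by (auto simp: \<phi>_def dst_commute[of m _ y])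
    then have "dst m (\<phi> (t, y)) y0 \<le> 1"
      using dst_triangle[of m "\<phi> (t, y)" y0 y] True \<eta>(2) by linarith
    moreover have "\<phi> (t, y) \<in> Eu m" using OE[OF y] l by (auto simp: \<phi>_def Eu_def)
    ultimately show ?thesis using near ccub_subset_ocub[of 2 3] by auto
  qed
  have far': "\<phi> (t, y) = y" if "y \<in> ?O" "y \<notin> ccub m 2" for t y
  proof -
    have "\<eta> \<le> dst m y y0" using near[OF OE[OF that(1)]] that(2) \<eta>(2) by force
    then show ?thesis using far by (simp add: \<phi>_def)
  qed
  have ge: "continuous_on ?O (\<lambda>y. g (e y))"
    using continuous_map_compose[OF chart_e_cont[OF ce] g(1)] by (simp add: o_def)
  have "continuous_on ?O disp"
    unfolding disp_def[abs_def] \<rho>_def using d(1) \<eta>(1) ge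
    by (intro continuous_intros) auto
  then have disp_c: "continuous_on ({0..1::real} \<times> ?O) (\<lambda>p. disp (snd p))"
    using continuous_on_compose2[of ?O disp "{0..1::real} \<times> ?O" snd] continuous_on_snd[OF continuous_on_id] by auto
  have coord_c: "continuous_on ({0..1::real} \<times> ?O) (\<lambda>p. snd p i)" for i
    using continuous_on_compose2[OF continuous_on_coord[of ?O i], of "{0..1::real} \<times> ?O" snd] continuous_on_snd[OF continuous_on_id]
    by auto
  have "continuous_on ({0..1::real} \<times> ?O) (\<lambda>p. \<phi> p i)" for i
  proof (cases "i = l")
    case True
    have "continuous_on ({0..1::real} \<times> ?O) (\<lambda>p. snd p l - \<sigma> * (fst p * disp (snd p)))"
      by (intro continuous_intros coord_c disp_c)
    then show ?thesis using True by (simp add: \<phi>_def)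
  next
    case False
    then show ?thesis using coord_c[of i] by (simp add: \<phi>_def)
  qed
  then have "continuous_on ({0..1::real} \<times> ?O) \<phi>" by (rule continuous_on_coordinatewise_then_product)
  then have \<phi>c: "continuous_map (prod_topology ?I (top_of_set ?O)) (top_of_set ?O) \<phi>"
    using \<phi>O by (auto simp: prod_topology_subtopology_eu continuous_map_in_subtopology)
  define k where "k p = e (\<phi> (fst p, c (snd p)))" for p
  have co: "c z \<in> ?O" "e (c z) = z" if "z \<in> ?D" for z
    using that chart_inv[OF ce] by auto
  have kc: "continuous_map (prod_topology ?I (subtopology T ?D)) T k"
  proof -
    have "continuous_map (subtopology T ?D) (top_of_set ?O) c"
      using chart_homeo[OF ce] by (simp add: homeomorphic_maps_def)
    from continuous_map_compose[OF continuous_map_snd[of ?I "subtopology T ?D"] this]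
    have "continuous_map (prod_topology ?I (subtopology T ?D)) (prod_topology ?I (top_of_set ?O)) (\<lambda>p. (fst p, c (snd p)))"
      by (intro continuous_map_pairedI continuous_map_fst) (simp add: o_def)
    from continuous_map_compose[OF continuous_map_compose[OF this \<phi>c] chart_e_cont[OF ce]]
    show ?thesis by (simp add: o_def k_def[abs_def])
  qed
  have kS: "k (t, z) = z" if "z \<in> ?D" "z \<notin> ?S" for t z
  proof -
    have "c z \<notin> ccub m 2" using that(2) image_eqI[of z e "c z"] co(2)[OF that(1)] by auto
    then show ?thesis using far'[OF co(1)[OF that(1)]] co(2)[OF that(1)] by (simp add: k_def)
  qed
  have ktop: "k (t, z) \<in> topspace T" if "z \<in> ?D" "t \<in> {0..1}" for t z
    unfolding k_def using \<phi>O[OF co(1)[OF that(1)] that(2)] chart_top[OF ce] by simp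
  have \<tau>D: "\<tau> z \<notin> ?D" if "z \<in> ?D" for z using that chart_free[OF ce] by blast
  \<comment> \<open>The push on the chart is copied to its mirror image through
    \<open>\<tau>\<close>. These two regions are disjoint, and \<open>?E\<close>, where nothing
    moves, completes the open cover used for pasting.\<close>
  define h where "h p = (if snd p \<in> ?D then k p else if \<tau> (snd p) \<in> ?D then \<tau> (k (fst p, \<tau> (snd p))) else snd p)" for p
  let ?\<tau>D = "{z \<in> topspace T. \<tau> z \<in> ?D}" and ?E = "topspace T - ?S - {z \<in> topspace T. \<tau> z \<in> ?S}"
  have o\<tau>: "openin T ?\<tau>D" by (rule openin_continuous_map_preimage[OF \<tau>_cont chart_open[OF ce]])
  have oE: "openin T ?E"
    using closedin_chart_core[OF ce] closedin_continuous_map_preimage[OF \<tau>_cont closedin_chart_core[OF ce]]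
    by (intro openin_diff) auto
  have SD: "?S \<subseteq> ?D" using ccub_subset_ocub[of 2 3] by auto
  have k\<tau>c: "continuous_map (prod_topology ?I (subtopology T ?\<tau>D)) T (\<lambda>p. \<tau> (k (fst p, \<tau> (snd p))))"
  proof -
    have "continuous_map (subtopology T ?\<tau>D) (subtopology T ?D) \<tau>"
      using continuous_map_from_subtopology[OF \<tau>_cont] by (auto simp: continuous_map_in_subtopology)
    from continuous_map_compose[OF continuous_map_snd[of ?I "subtopology T ?\<tau>D"] this]
    have "continuous_map (prod_topology ?I (subtopology T ?\<tau>D)) (prod_topology ?I (subtopology T ?D)) (\<lambda>p. (fst p, \<tau> (snd p)))"
      by (intro continuous_map_pairedI continuous_map_fst) (simp add: o_def)
    from continuous_map_compose[OF continuous_map_compose[OF this kc] \<tau>_cont]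
    show ?thesis by (simp add: o_def)
  qed
  have hc: "continuous_map (prod_topology ?I T) T h"
  proof (rule pasting_lemma[where I = "{0, 1, 2::nat}" and T = "\<lambda>i. {0..1} \<times> (if i = 0 then ?D else if i = 1 then ?\<tau>D else ?E)"
        and f = "\<lambda>i. if i = 0 then k else if i = 1 then (\<lambda>p. \<tau> (k (fst p, \<tau> (snd p)))) else snd"])
    show "openin (prod_topology ?I T) ({0..1} \<times> (if i = 0 then ?D else if i = 1 then ?\<tau>D else ?E))" for i :: nat
      using chart_open[OF ce] o\<tau> oE by (simp add: openin_prod_Times_iff)
    show "continuous_map (subtopology (prod_topology ?I T) ({0..1} \<times> (if i = 0 then ?D else if i = 1 then ?\<tau>D else ?E))) T
        (if i = 0 then k else if i = 1 then (\<lambda>p. \<tau> (k (fst p, \<tau> (snd p)))) else snd)" for i :: nat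
    proof -
      have e: "subtopology (prod_topology ?I T) ({0..1} \<times> R) = prod_topology ?I (subtopology T R)" for R
        using prod_topology_subtopology(2)[of ?I T R] by simp
      show ?thesis
        unfolding e using kc k\<tau>c continuous_map_into_fulltopology[OF continuous_map_snd[of ?I "subtopology T ?E"]] by simp
    qed
    show "(if i = 0 then k else if i = 1 then (\<lambda>p. \<tau> (k (fst p, \<tau> (snd p)))) else snd) p =
        (if j = 0 then k else if j = 1 then (\<lambda>p. \<tau> (k (fst p, \<tau> (snd p)))) else snd) p"
      if "i \<in> {0, 1, 2}" "j \<in> {0, 1, 2}" "p \<in> topspace (prod_topology ?I T) \<inter>
        {0..1} \<times> (if i = 0 then ?D else if i = 1 then ?\<tau>D else ?E) \<inter>
        {0..1} \<times> (if j = 0 then ?D else if j = 1 then ?\<tau>D else ?E)" for i j :: nat and p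
    proof -
      obtain t z where p: "p = (t, z)" by (cases p)
      have 1: "\<not> (z \<in> ?D \<and> z \<in> ?\<tau>D)" using \<tau>D by blast
      have 2: "k (t, z) = z" if "z \<in> ?D" "z \<in> ?E" using kS that by blast
      have 3: "\<tau> (k (t, \<tau> z)) = z" if "z \<in> ?\<tau>D" "z \<in> ?E"
      proof -
        have "k (t, \<tau> z) = \<tau> z" using kS that by blast
        then show ?thesis using \<tau>_inv that by simp
      qed
      show ?thesis using that 1 2 3 unfolding p by (auto split: if_splits)
    qed
    show "\<exists>j::nat. j \<in> {0, 1, 2} \<and> p \<in> {0..1} \<times> (if j = 0 then ?D else if j = 1 then ?\<tau>D else ?E) \<and>
        h p = (if j = 0 then k else if j = 1 then (\<lambda>p. \<tau> (k (fst p, \<tau> (snd p)))) else snd) p"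
      if pT: "p \<in> topspace (prod_topology ?I T)" for p
    proof -
      obtain t z where p: "p = (t, z)" "t \<in> {0..1}" "z \<in> topspace T" using pT by (cases p) auto
      consider "z \<in> ?D" | "z \<notin> ?D" "\<tau> z \<in> ?D" | "z \<notin> ?D" "\<tau> z \<notin> ?D" by blast
      then show ?thesis
      proof cases
        case 1
        then show ?thesis using p by (intro exI[of _ 0]) (simp add: h_def)
      next
        case 2
        then show ?thesis using p by (intro exI[of _ 1]) (simp add: h_def)
      next
        case 3
        then have "z \<in> ?E" using p SD by blast
        then show ?thesis using p 3 by (intro exI[of _ 2]) (simp add: h_def)
      qed
    qed
  qed
  have h0: "h (0, z) = z" if "z \<in> topspace T" for z
  proof -
    have "k (0, w) = w" if "w \<in> ?D" for w using co(2)[OF that] by (simp add: k_def \<phi>_def)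
    then show ?thesis using \<tau>_inv[OF that] by (simp add: h_def)
  qed
  have hs: "h (t, \<tau> z) = \<tau> (h (t, z))" if t: "t \<in> {0..1}" and z: "z \<in> topspace T" for t z
    using \<tau>_inv[OF z] \<tau>D[of z] \<tau>D[of "\<tau> z"] \<tau>_inv[OF ktop[OF _ t]] by (auto simp: h_def)
  have kA: "k (t, z) = z" if "z \<in> ?D" "g z \<le> 0" for t z
  proof -
    have "disp (c z) = 0" using that co(2)[OF that(1)] \<eta>(1) by (simp add: disp_def)
    then show ?thesis using co(2)[OF that(1)] by (simp add: k_def \<phi>_def)
  qed
  have hA: "h (t, a) = a" if "a \<in> A" for t a
    using that kA[of a t] kA[of "\<tau> a" t] g(2)[of a] \<tau>_inv[of a] by (auto simp: h_def A_def)
  \<comment> \<open>The first bound makes the cut-off equal to 1, the second makes the cap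
    \<open>\<eta>\<close> inactive, so the full descent into A takes place.\<close>
  define N0 where "N0 = {z \<in> ?D. dst m (c z) y0 < \<eta> / 2 \<and> g z < \<delta> * \<eta>}"
  define N where "N = N0 \<union> {z \<in> topspace T. \<tau> z \<in> N0}"
  have DT: "?D \<subseteq> topspace T" using openin_subset[OF chart_open[OF ce]] .
  have oN0: "openin T N0"
  proof -
    have "openin (subtopology T ?D) {z \<in> topspace (subtopology T ?D). c z \<in> {y. dst m y y0 < \<eta> / 2}}"
      by (rule openin_continuous_map_preimage[OF chart_c_cont[OF ce]]) (rule open_openin[THEN iffD1, OF open_dst])
    then have "openin T {z \<in> topspace (subtopology T ?D). c z \<in> {y. dst m y y0 < \<eta> / 2}}"
      by (rule openin_trans_full[OF _ chart_open[OF ce]])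
    moreover have "openin T {z \<in> topspace T. g z \<in> {..<\<delta> * \<eta>}}"
      by (rule openin_continuous_map_preimage[OF g(1)]) simp
    ultimately have "openin T ({z \<in> topspace (subtopology T ?D). c z \<in> {y. dst m y y0 < \<eta> / 2}} \<inter> {z \<in> topspace T. g z \<in> {..<\<delta> * \<eta>}})"
      by (rule openin_Int)
    moreover have "\<dots> = N0" using DT by (auto simp: N0_def)
    ultimately show ?thesis by simp
  qed
  have oN: "openin T N"
    unfolding N_def by (intro openin_Un oN0 openin_continuous_map_preimage[OF \<tau>_cont oN0])
  have N\<tau>: "\<tau> ` N \<subseteq> N"
    using openin_subset[OF oN0] \<tau>_inv \<tau>_top by (auto simp: N_def)
  have kN: "k (1, z) \<in> A" if z: "z \<in> N0" for z
  proof -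
    have zD: "z \<in> ?D" "dst m (c z) y0 < \<eta> / 2" "g z < \<delta> * \<eta>" using z by (auto simp: N0_def)
    let ?s = "max 0 (g z) / \<delta>"
    have s: "?s \<in> {0..\<eta>}" using zD(3) d(1) \<eta>(1) by (auto simp: field_simps)
    have "2 * dst m (c z) y0 / \<eta> \<le> 1" using zD(2) \<eta>(1) by (simp add: field_simps)
    then have "\<rho> (c z) = 1" unfolding \<rho>_def by linarith
    then have "disp (c z) = ?s" using s co(2)[OF zD(1)] by (simp add: disp_def)
    then have "k (1, z) = e ((c z)(l := c z l - \<sigma> * ?s))" by (simp add: k_def \<phi>_def)
    then have "g (k (1, z)) \<le> g z - \<delta> * ?s"
      using desc[OF OE[OF co(1)[OF zD(1)]] _ s] zD(2) \<eta>(1) co(2)[OF zD(1)] by simp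
    also have "\<dots> \<le> 0" using d(1) by simp
    finally show ?thesis using ktop[OF zD(1), of 1] by (simp add: A_def)
  qed
  have hN: "h (1, z) \<in> A" if z: "z \<in> N" for z
  proof (cases "z \<in> N0")
    case True
    then have "z \<in> ?D" by (simp add: N0_def)
    then show ?thesis using kN[OF True] by (simp add: h_def)
  next
    case False
    then have z': "z \<in> topspace T" "\<tau> z \<in> N0" using z by (auto simp: N_def)
    then have D: "\<tau> z \<in> ?D" by (simp add: N0_def)
    then have "z \<notin> ?D" using \<tau>D by blast
    then have "h (1, z) = \<tau> (k (1, \<tau> z))" using D by (simp add: h_def)
    then show ?thesis using kN[OF z'(2)] g(2) \<tau>_top by (simp add: A_def)
  qed
  have y03: "y0 \<in> ?O" using y0 ocub_mono[of 1 3] by auto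
  then have yN: "e y0 \<in> N" using g(3) d(1) \<eta>(1) chart_inv[OF ce y03] by (auto simp: N_def N0_def)
  show ?thesis
    by (rule exI[of _ h], rule exI[of _ N]) (intro conjI ballI hc h0 hs hA oN N\<tau> hN yN)
qed

section \<open>Product charts on the configuration space\<close>

lemma C11_at_affine_image:
  assumes f: "C11_at m f p" and p: "p \<in> Eu m"
  shows "C11_at m (\<lambda>y. (f y - a) / b) p"
proof -
  let ?G = "\<lambda>y i::nat. if i = 0 then f y else 0"
  have "C11_at 1 (\<lambda>y. - a / b + 1 / b * y 0) (?G p)" by (rule C11_at_affine) simp
  then have "C11_at m (\<lambda>y. - a / b + 1 / b * ?G y 0) p"
    by (rule C11_at_compose[where r = 1 and G = ?G]) (use f p in \<open>auto simp: Eu_def\<close>)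
  then show ?thesis by (rule C11_at_cong[of _ _ _ 1]) (auto simp: diff_divide_distrib)
qed

context
  fixes n :: nat and X :: "'a topology" and \<A> :: "'a chart set"
  assumes M: "smooth_manifold n X \<A>"
begin

lemma chart_facts:
  assumes "(U, \<phi>) \<in> \<A>"
  shows "openin X U" "openin (top_of_set (Eu n)) (\<phi> ` U)" "inj_on \<phi> U"
    "continuous_map (subtopology X U) (top_of_set (Eu n)) \<phi>"
    "continuous_map (top_of_set (\<phi> ` U)) X (inv_into U \<phi>)"
    "\<And>A. openin X A \<Longrightarrow> openin (top_of_set (Eu n)) (\<phi> ` (U \<inter> A))"
proof -
  have c: "openin X U" "openin (Euclidean_space n) (\<phi> ` U)"
    "homeomorphic_map (subtopology X U) (subtopology (Euclidean_space n) (\<phi> ` U)) \<phi>"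
    using M assms unfolding smooth_manifold_def is_chart_def by force+
  show U: "openin X U" by (rule c(1))
  show oV: "openin (top_of_set (Eu n)) (\<phi> ` U)" using c(2) by (simp add: Euclidean_space_eq)
  have VE: "\<phi> ` U \<subseteq> Eu n" using openin_subset[OF oV] by simp
  have topU: "topspace (subtopology X U) = U" using openin_subset[OF U] by auto
  have sub: "subtopology (Euclidean_space n) (\<phi> ` U) = top_of_set (\<phi> ` U)"
    using VE by (simp add: Euclidean_space_eq subtopology_subtopology inf_absorb2)
  show inj: "inj_on \<phi> U"
    using homeomorphic_imp_injective_map[OF c(3)] topU by simp
  show "continuous_map (subtopology X U) (top_of_set (Eu n)) \<phi>"
    using homeomorphic_imp_continuous_map[OF c(3)] unfolding continuous_map_in_subtopology Euclidean_space_eq by blast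
  obtain g where g: "homeomorphic_maps (subtopology X U) (top_of_set (\<phi> ` U)) \<phi> g"
    using c(3) unfolding homeomorphic_map_maps sub by blast
  then have gc: "continuous_map (top_of_set (\<phi> ` U)) X g"
    unfolding homeomorphic_maps_def continuous_map_in_subtopology by blast
  have "g y = inv_into U \<phi> y" if "y \<in> \<phi> ` U" for y
    using g that inj topU unfolding homeomorphic_maps_def by auto
  then show "continuous_map (top_of_set (\<phi> ` U)) X (inv_into U \<phi>)"
    by (intro continuous_map_eq[OF gc]) auto
  show "openin (top_of_set (Eu n)) (\<phi> ` (U \<inter> A))" if A: "openin X A" for A
  proof -
    have "openin (subtopology X U) (U \<inter> A)" using A by (rule openin_subtopology_Int2)
    then have "openin (top_of_set (\<phi> ` U)) (\<phi> ` (U \<inter> A))"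
      using homeomorphic_imp_open_map[OF c(3)] unfolding open_map_def sub by blast
    then show ?thesis using openin_trans oV by blast
  qed
qed

text \<open>Here the smoothness of the atlas enters, as class C^2 of the transition maps. The
  numbers a and b allow for the rescaled coordinates of the product charts.\<close>

lemma transition_C11_at:
  assumes U: "(U, \<phi>) \<in> \<A>" "(V, \<psi>) \<in> \<A>" and i: "i < n" and w: "w \<in> Eu m"
    and G: "\<And>j. j < n \<Longrightarrow> C11_at m (\<lambda>x. G x j) w" "\<And>x. G x \<in> Eu n"
    and Gw: "G w \<in> \<phi> ` U" "inv_into U \<phi> (G w) \<in> V"
  shows "C11_at m (\<lambda>x. (\<psi> (inv_into U \<phi> (G x)) i - a) / b) w"
proof -
  have st: "smooth_transition n (U, \<phi>) (V, \<psi>)" using M U unfolding smooth_manifold_def by blast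
  let ?f = "\<lambda>x. (\<psi> \<circ> inv_into U \<phi>) x i"
  have "Ck_on (Suc (Suc 0)) n (\<phi> ` (U \<inter> V)) ?f"
    using st i unfolding smooth_transition_def smooth_on_def prod.case by blast
  moreover have "openin (Euclidean_space n) (\<phi> ` (U \<inter> V))"
    unfolding Euclidean_space_eq by (rule chart_facts(6)[OF U(1) chart_facts(1)[OF U(2)]])
  moreover have "G w \<in> \<phi> ` (U \<inter> V)"
  proof (rule image_eqI)
    show "G w = \<phi> (inv_into U \<phi> (G w))" using Gw(1) by (simp add: f_inv_into_f)
    show "inv_into U \<phi> (G w) \<in> U \<inter> V" using Gw by (simp add: inv_into_into)
  qed
  ultimately have "C11_at n ?f (G w)" using C2_imp_C11_at by blast
  then have "C11_at m (\<lambda>x. ?f (G x)) w"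
    by (rule C11_at_compose[of n ?f G w m 1]) (use G w in auto)
  then show ?thesis using C11_at_affine_image[OF _ w] by simp
qed

text \<open>Rescaling and translating before splitting into two blocks lets every product chart be
  parametrized by the cube of the same half-width 3, as \<open>cube_atlas\<close> demands.\<close>

definition half1 :: "(nat \<Rightarrow> real) \<Rightarrow> real \<Rightarrow> (nat \<Rightarrow> real) \<Rightarrow> nat \<Rightarrow> real" where
  "half1 q r w = (\<lambda>i. if i < n then q i + r * w i else 0)"

definition half2 :: "(nat \<Rightarrow> real) \<Rightarrow> real \<Rightarrow> (nat \<Rightarrow> real) \<Rightarrow> nat \<Rightarrow> real" where
  "half2 q r w = (\<lambda>i. if i < n then q (n + i) + r * w (n + i) else 0)"

definition pair_coord :: "('a \<Rightarrow> nat \<Rightarrow> real) \<Rightarrow> ('a \<Rightarrow> nat \<Rightarrow> real) \<Rightarrow> (nat \<Rightarrow> real) \<Rightarrow> real \<Rightarrow> 'a \<times> 'a \<Rightarrow> nat \<Rightarrow> real" where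
  "pair_coord \<phi> \<psi> q r z = (\<lambda>l. if l < n then (\<phi> (fst z) l - q l) / r
     else if l < 2 * n then (\<psi> (snd z) (l - n) - q l) / r else 0)"

definition pair_param :: "'a chart \<Rightarrow> 'a chart \<Rightarrow> (nat \<Rightarrow> real) \<Rightarrow> real \<Rightarrow> (nat \<Rightarrow> real) \<Rightarrow> 'a \<times> 'a" where
  "pair_param u v q r w = (inv_into (fst u) (snd u) (half1 q r w), inv_into (fst v) (snd v) (half2 q r w))"

text \<open>The last condition takes independent w and w', so it separates the two factors as sets.
  The image then avoids the diagonal and also its own mirror image, which is
  \<open>chart_free\<close>.\<close>

definition admissible :: "'a chart \<Rightarrow> 'a chart \<Rightarrow> (nat \<Rightarrow> real) \<Rightarrow> real \<Rightarrow> bool" where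
  "admissible u v q r \<longleftrightarrow> u \<in> \<A> \<and> v \<in> \<A> \<and> 0 < r \<and>
     (\<forall>w\<in>ocub (2 * n) 3. half1 q r w \<in> snd u ` fst u \<and> half2 q r w \<in> snd v ` fst v) \<and>
     (\<forall>w\<in>ocub (2 * n) 3. \<forall>w'\<in>ocub (2 * n) 3. fst (pair_param u v q r w) \<noteq> snd (pair_param u v q r w'))"

definition pair_charts :: "(('a \<times> 'a \<Rightarrow> nat \<Rightarrow> real) \<times> ((nat \<Rightarrow> real) \<Rightarrow> 'a \<times> 'a)) set" where
  "pair_charts = {(pair_coord (snd u) (snd v) q r, pair_param u v q r) | u v q r. admissible u v q r}"

lemma half_Eu: "half1 q r w \<in> Eu n" "half2 q r w \<in> Eu n"
  by (auto simp: half1_def half2_def Eu_def)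

lemma C11_at_half:
  assumes "j < n"
  shows "C11_at (2 * n) (\<lambda>x. half1 q r x j) w" "C11_at (2 * n) (\<lambda>x. half2 q r x j) w"
  using assms by (auto simp: half1_def half2_def intro: C11_at_affine)

lemma admissible_facts:
  assumes adm: "admissible (U, \<phi>) (V, \<psi>) q r"
  shows "(U, \<phi>) \<in> \<A>" "(V, \<psi>) \<in> \<A>" "0 < r"
    "\<And>w. w \<in> ocub (2 * n) 3 \<Longrightarrow> half1 q r w \<in> \<phi> ` U \<and> half2 q r w \<in> \<psi> ` V"
    "\<And>w. w \<in> ocub (2 * n) 3 \<Longrightarrow> fst (pair_param (U, \<phi>) (V, \<psi>) q r w) \<in> U \<and> snd (pair_param (U, \<phi>) (V, \<psi>) q r w) \<in> V"
    "\<And>w. w \<in> ocub (2 * n) 3 \<Longrightarrow> pair_coord \<phi> \<psi> q r (pair_param (U, \<phi>) (V, \<psi>) q r w) = w"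
    "\<And>z. z \<in> U \<times> V \<Longrightarrow> pair_param (U, \<phi>) (V, \<psi>) q r (pair_coord \<phi> \<psi> q r z) = z"
proof -
  show u: "(U, \<phi>) \<in> \<A>" and v: "(V, \<psi>) \<in> \<A>" and r: "0 < r" using adm by (auto simp: admissible_def)
  show h: "half1 q r w \<in> \<phi> ` U \<and> half2 q r w \<in> \<psi> ` V" if "w \<in> ocub (2 * n) 3" for w
    using adm that by (auto simp: admissible_def)
  show "fst (pair_param (U, \<phi>) (V, \<psi>) q r w) \<in> U \<and> snd (pair_param (U, \<phi>) (V, \<psi>) q r w) \<in> V" if "w \<in> ocub (2 * n) 3" for w
    using h[OF that] by (simp add: pair_param_def inv_into_into)
  show "pair_coord \<phi> \<psi> q r (pair_param (U, \<phi>) (V, \<psi>) q r w) = w" if w: "w \<in> ocub (2 * n) 3" for w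
  proof
    fix l
    have "\<phi> (inv_into U \<phi> (half1 q r w)) = half1 q r w" "\<psi> (inv_into V \<psi> (half2 q r w)) = half2 q r w"
      using h[OF w] by (simp_all add: f_inv_into_f)
    moreover have "w l = 0" if "\<not> l < 2 * n" using that w by (simp add: ocub_def Eu_def)
    moreover have "l - n < n" if "l < 2 * n" "\<not> l < n" using that by linarith
    ultimately show "pair_coord \<phi> \<psi> q r (pair_param (U, \<phi>) (V, \<psi>) q r w) l = w l"
      using r by (auto simp: pair_coord_def pair_param_def half1_def half2_def)
  qed
  show "pair_param (U, \<phi>) (V, \<psi>) q r (pair_coord \<phi> \<psi> q r z) = z" if z: "z \<in> U \<times> V" for z
  proof -
    have E: "\<phi> (fst z) \<in> Eu n" "\<psi> (snd z) \<in> Eu n"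
      using z openin_subset[OF chart_facts(2)[OF u]] openin_subset[OF chart_facts(2)[OF v]] by auto
    have "half1 q r (pair_coord \<phi> \<psi> q r z) = \<phi> (fst z)"
      using E(1) r by (auto simp: half1_def pair_coord_def Eu_def fun_eq_iff)
    moreover have "half2 q r (pair_coord \<phi> \<psi> q r z) = \<psi> (snd z)"
      using E(2) r by (auto simp: half2_def pair_coord_def Eu_def fun_eq_iff)
    ultimately show ?thesis
      using z chart_facts(3)[OF u] chart_facts(3)[OF v] by (auto simp: pair_param_def)
  qed
qed

lemma continuous_map_pair_coord:
  assumes u: "(U, \<phi>) \<in> \<A>" "(V, \<psi>) \<in> \<A>" and r: "0 < r"
  shows "continuous_map (subtopology (prod_topology X X) (U \<times> V)) euclidean (pair_coord \<phi> \<psi> q r)"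
proof -
  let ?T = "subtopology (prod_topology X X) (U \<times> V)"
  have T: "?T = prod_topology (subtopology X U) (subtopology X V)"
    by (simp add: subtopology_Times)
  have p: "continuous_map ?T euclidean (\<lambda>z. \<phi> (fst z))" "continuous_map ?T euclidean (\<lambda>z. \<psi> (snd z))"
    unfolding T using continuous_map_compose[OF continuous_map_fst chart_facts(4)[OF u(1)]]
      continuous_map_compose[OF continuous_map_snd chart_facts(4)[OF u(2)]]
    by (auto simp: o_def continuous_map_in_subtopology)
  have coord: "continuous_map euclidean euclideanreal (\<lambda>y::nat \<Rightarrow> real. y l)" for l
    using continuous_on_coord[of UNIV l] by simp
  have c: "continuous_map ?T euclideanreal (\<lambda>z. \<phi> (fst z) l)" "continuous_map ?T euclideanreal (\<lambda>z. \<psi> (snd z) l)" for l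
    using continuous_map_compose[OF p(1) coord[of l]] continuous_map_compose[OF p(2) coord[of l]] by (simp_all add: o_def)
  have "continuous_map ?T euclideanreal (\<lambda>z. pair_coord \<phi> \<psi> q r z l)" for l
    unfolding pair_coord_def
    by (cases "l < n"; cases "l < 2 * n") (use r in \<open>auto intro!: continuous_intros c continuous_map_real_divide\<close>)
  then have "continuous_map ?T (product_topology (\<lambda>i. euclideanreal) UNIV) (pair_coord \<phi> \<psi> q r)"
    by (simp add: continuous_map_componentwise_UNIV)
  then show ?thesis by (simp add: euclidean_product_topology)
qed

lemma pair_param_image:
  assumes adm: "admissible (U, \<phi>) (V, \<psi>) q r"
  shows "pair_param (U, \<phi>) (V, \<psi>) q r ` ocub (2 * n) 3 = {z \<in> U \<times> V. pair_coord \<phi> \<psi> q r z \<in> ocub (2 * n) 3}"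
  using admissible_facts(5,6,7)[OF adm] by (force simp: mem_Times_iff image_iff)

lemma pair_param_image_open:
  assumes adm: "admissible (U, \<phi>) (V, \<psi>) q r"
  shows "openin (conf2 X) (pair_param (U, \<phi>) (V, \<psi>) q r ` ocub (2 * n) 3)"
proof -
  let ?e = "pair_param (U, \<phi>) (V, \<psi>) q r" and ?c = "pair_coord \<phi> \<psi> q r"
  note f = admissible_facts[OF adm]
  let ?T = "subtopology (prod_topology X X) (U \<times> V)"
  have UV: "openin (prod_topology X X) (U \<times> V)"
    using chart_facts(1)[OF f(1)] chart_facts(1)[OF f(2)] by (simp add: openin_prod_Times_iff)
  have topT: "topspace ?T = U \<times> V" using openin_subset[OF UV] by auto
  have E: "?c z \<in> Eu (2 * n)" for z by (auto simp: pair_coord_def Eu_def)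
  have cE: "continuous_map ?T (top_of_set (Eu (2 * n))) ?c"
    using continuous_map_pair_coord[OF f(1-3)] E by (auto simp: continuous_map_in_subtopology)
  have "openin ?T {z \<in> topspace ?T. ?c z \<in> ocub (2 * n) 3}"
    by (rule openin_continuous_map_preimage[OF cE openin_ocub])
  then have o: "openin (prod_topology X X) (?e ` ocub (2 * n) 3)"
    using openin_trans_full UV unfolding topT pair_param_image[OF adm] by blast
  moreover have "?e ` ocub (2 * n) 3 \<subseteq> {(x, y). x \<noteq> y}"
  proof
    fix p assume "p \<in> ?e ` ocub (2 * n) 3"
    then have "fst p \<noteq> snd p" using adm unfolding admissible_def by blast
    then show "p \<in> {(x, y). x \<noteq> y}" by (cases p) simp
  qed
  ultimately have "?e ` ocub (2 * n) 3 = ?e ` ocub (2 * n) 3 \<inter> {(x, y). x \<noteq> y}" by blast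
  then show ?thesis using o unfolding conf2_def openin_subtopology by blast
qed

lemma continuous_map_half: "continuous_map (top_of_set S) euclidean (half1 q r)" "continuous_map (top_of_set S) euclidean (half2 q r)"
proof -
  have "continuous_on S (\<lambda>w. half1 q r w i)" "continuous_on S (\<lambda>w. half2 q r w i)" for i
    unfolding half1_def half2_def by (cases "i < n"; auto intro!: continuous_intros)+
  then show "continuous_map (top_of_set S) euclidean (half1 q r)" "continuous_map (top_of_set S) euclidean (half2 q r)"
    by (auto intro!: continuous_on_coordinatewise_then_product)
qed

lemma pair_chart_homeo:
  assumes adm: "admissible (U, \<phi>) (V, \<psi>) q r"
  shows "homeomorphic_maps (subtopology (conf2 X) (pair_param (U, \<phi>) (V, \<psi>) q r ` ocub (2 * n) 3))
    (top_of_set (ocub (2 * n) 3)) (pair_coord \<phi> \<psi> q r) (pair_param (U, \<phi>) (V, \<psi>) q r)"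
proof -
  let ?e = "pair_param (U, \<phi>) (V, \<psi>) q r" and ?c = "pair_coord \<phi> \<psi> q r" and ?O = "ocub (2 * n) 3"
  note f = admissible_facts[OF adm]
  have D: "?e ` ?O \<subseteq> topspace (conf2 X)" using openin_subset[OF pair_param_image_open[OF adm]] .
  have DUV: "?e ` ?O \<subseteq> U \<times> V" using pair_param_image[OF adm] by blast
  have "continuous_map (subtopology (prod_topology X X) (?e ` ?O)) euclidean ?c"
    using continuous_map_from_subtopology_mono[OF continuous_map_pair_coord[OF f(1-3)] DUV] .
  then have "continuous_map (subtopology (conf2 X) (?e ` ?O)) euclidean ?c"
    unfolding conf2_def subtopology_subtopology by (rule continuous_map_from_subtopology_mono) auto
  then have 1: "continuous_map (subtopology (conf2 X) (?e ` ?O)) (top_of_set ?O) ?c"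
    using f(6) by (auto simp: continuous_map_in_subtopology)
  have h: "continuous_map (top_of_set ?O) (top_of_set (\<phi> ` U)) (half1 q r)"
    "continuous_map (top_of_set ?O) (top_of_set (\<psi> ` V)) (half2 q r)"
    using continuous_map_half[of ?O q r] f(4) by (auto simp: continuous_map_in_subtopology)
  have "continuous_map (top_of_set ?O) (prod_topology X X) ?e"
    unfolding pair_param_def[abs_def]
    using continuous_map_compose[OF h(1) chart_facts(5)[OF f(1)]] continuous_map_compose[OF h(2) chart_facts(5)[OF f(2)]]
    by (intro continuous_map_pairedI) (simp_all add: o_def)
  then have 2: "continuous_map (top_of_set ?O) (subtopology (conf2 X) (?e ` ?O)) ?e"
    using D unfolding conf2_def continuous_map_in_subtopology by auto
  show ?thesis
    unfolding homeomorphic_maps_def using 1 2 f(6) by auto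
qed

text \<open>Charts at x and y are cut down to disjoint open sets whose product lies in N;
  disjointness of the factors is what \<open>admissible\<close> needs. A small enough r then fits
  the whole cube into them.\<close>

lemma pair_chart_cover:
  assumes N: "openin (conf2 X) N" "z \<in> N"
  shows "\<exists>(c, e)\<in>pair_charts. z \<in> e ` ocub (2 * n) 1 \<and> e ` ocub (2 * n) 3 \<subseteq> N"
proof -
  obtain P where P: "openin (prod_topology X X) P" "N = P \<inter> {(x, y). x \<noteq> y}"
    using N(1) unfolding conf2_def openin_subtopology by blast
  obtain x y where z: "z = (x, y)" by (cases z)
  have xy: "x \<noteq> y" "(x, y) \<in> P" using N(2) P(2) z by auto
  then have top: "x \<in> topspace X" "y \<in> topspace X" using openin_subset[OF P(1)] by auto
  from P(1)[unfolded openin_prod_topology_alt, rule_format, OF xy(2)]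
  obtain A1 B1 where A1: "openin X A1" "openin X B1" "x \<in> A1" "y \<in> B1" "A1 \<times> B1 \<subseteq> P"
    by (elim exE conjE) (rule that)
  have H: "Hausdorff_space X" and cov: "(\<Union>c\<in>\<A>. fst c) = topspace X"
    using M by (auto simp: smooth_manifold_def)
  obtain A2 B2 where A2: "openin X A2" "openin X B2" "x \<in> A2" "y \<in> B2" "disjnt A2 B2"
    using H[unfolded Hausdorff_space_def, rule_format, of x y] top xy(1) by blast
  have ch: "\<exists>U \<phi>. (U, \<phi>) \<in> \<A> \<and> p \<in> U" if p: "p \<in> topspace X" for p
  proof -
    have "p \<in> (\<Union>c\<in>\<A>. fst c)" using p cov by simp
    then obtain c where "c \<in> \<A>" "p \<in> fst c" by blast
    then show ?thesis by (intro exI[of _ "fst c"] exI[of _ "snd c"]) simp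
  qed
  obtain U \<phi> where U: "(U, \<phi>) \<in> \<A>" "x \<in> U" using ch[OF top(1)] by blast
  obtain V \<psi> where V: "(V, \<psi>) \<in> \<A>" "y \<in> V" using ch[OF top(2)] by blast
  define A where "A = U \<inter> (A1 \<inter> A2)"
  define B where "B = V \<inter> (B1 \<inter> B2)"
  have "openin (top_of_set (Eu n)) (\<phi> ` A)" "openin (top_of_set (Eu n)) (\<psi> ` B)"
    unfolding A_def B_def using chart_facts(6)[OF U(1)] chart_facts(6)[OF V(1)] A1 A2 by blast+
  moreover have xA: "x \<in> A" "y \<in> B" using U V A1 A2 by (auto simp: A_def B_def)
  ultimately have "\<exists>r1>0. dball n (\<phi> x) r1 \<subseteq> \<phi> ` A" "\<exists>r2>0. dball n (\<psi> y) r2 \<subseteq> \<psi> ` B"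
    by (metis imageI openin_Eu_contains_dball)+
  then obtain r1 r2 where r12: "0 < r1" "dball n (\<phi> x) r1 \<subseteq> \<phi> ` A" "0 < r2" "dball n (\<psi> y) r2 \<subseteq> \<psi> ` B"
    by blast
  \<comment> \<open>In l1-distance a block of the cube of half-width 3 moves by at most 3 r n; n + 1
    makes this strictly smaller than the radii and keeps the divisor positive for n = 0.\<close>
  define k where "k = 3 * (real n + 1)"
  define r where "r = min r1 r2 / k"
  have k0: "0 < k" by (simp add: k_def)
  have r0: "0 < r" using r12 k0 by (simp add: r_def)
  have "r * k = min r1 r2" using k0 by (simp add: r_def)
  moreover have "r * k = 3 * r * real n + 3 * r" by (simp add: k_def algebra_simps)
  ultimately have rn: "3 * r * real n < r1" "3 * r * real n < r2" using r0 by linarith+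
  define q where "q l = (if l < n then \<phi> x l else \<psi> y (l - n))" for l
  have h1: "half1 q r w \<in> \<phi> ` A" and h2: "half2 q r w \<in> \<psi> ` B" if w: "w \<in> ocub (2 * n) 3" for w
  proof -
    have "dst n (half1 q r w) (\<phi> x) \<le> (\<Sum>l<n. 3 * r)"
      unfolding dst_def
    proof (rule sum_mono)
      fix l assume l: "l \<in> {..<n}"
      have "\<bar>w l\<bar> \<le> 3" using w l by (auto simp: ocub_def less_imp_le)
      then show "\<bar>half1 q r w l - \<phi> x l\<bar> \<le> 3 * r" using l r0 by (simp add: half1_def q_def abs_mult)
    qed
    then show "half1 q r w \<in> \<phi> ` A" using rn(1) r12(2) half_Eu(1)[of q r w] by (auto simp: dball_def algebra_simps)
    have "dst n (half2 q r w) (\<psi> y) \<le> (\<Sum>l<n. 3 * r)"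
      unfolding dst_def
    proof (rule sum_mono)
      fix l assume l: "l \<in> {..<n}"
      have "\<bar>w (n + l)\<bar> \<le> 3" using w l by (auto simp: ocub_def less_imp_le)
      then show "\<bar>half2 q r w l - \<psi> y l\<bar> \<le> 3 * r" using l r0 by (simp add: half2_def q_def abs_mult)
    qed
    then show "half2 q r w \<in> \<psi> ` B" using rn(2) r12(4) half_Eu(2)[of q r w] by (auto simp: dball_def algebra_simps)
  qed
  let ?e = "pair_param (U, \<phi>) (V, \<psi>) q r"
  have eAB: "?e w \<in> A \<times> B" if "w \<in> ocub (2 * n) 3" for w
  proof -
    have "inv_into U \<phi> (half1 q r w) \<in> A"
      using h1[OF that] chart_facts(3)[OF U(1)] by (auto simp: A_def)
    moreover have "inv_into V \<psi> (half2 q r w) \<in> B"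
      using h2[OF that] chart_facts(3)[OF V(1)] by (auto simp: B_def)
    ultimately show ?thesis by (simp add: pair_param_def)
  qed
  have disj: "a \<noteq> b" if "a \<in> A" "b \<in> B" for a b using that A2(5) by (auto simp: A_def B_def disjnt_iff)
  have "half1 q r w \<in> \<phi> ` U \<and> half2 q r w \<in> \<psi> ` V" if "w \<in> ocub (2 * n) 3" for w
    using h1[OF that] h2[OF that] by (auto simp: A_def B_def)
  moreover have "fst (?e w) \<noteq> snd (?e w')" if "w \<in> ocub (2 * n) 3" "w' \<in> ocub (2 * n) 3" for w w'
    using eAB[OF that(1)] eAB[OF that(2)] disj by (auto simp: mem_Times_iff)
  ultimately have adm: "admissible (U, \<phi>) (V, \<psi>) q r" unfolding admissible_def using U V r0 by simp
  have "?e ` ocub (2 * n) 3 \<subseteq> N"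
  proof
    fix p assume "p \<in> ?e ` ocub (2 * n) 3"
    then have "p \<in> A \<times> B" using eAB by blast
    then show "p \<in> N" using A1(5) disj P(2) by (cases p) (auto simp: A_def B_def)
  qed
  moreover have "z \<in> ?e ` ocub (2 * n) 1"
  proof (rule image_eqI)
    have "(\<lambda>l. 0) = pair_coord \<phi> \<psi> q r z"
      by (auto simp: pair_coord_def q_def z fun_eq_iff)
    then show "z = ?e (\<lambda>l. 0)" using admissible_facts(7)[OF adm, of z] U V z by simp
    show "(\<lambda>l. 0) \<in> ocub (2 * n) 1" by (simp add: ocub_def Eu_def)
  qed
  moreover have "(pair_coord \<phi> \<psi> q r, ?e) \<in> pair_charts" using adm unfolding pair_charts_def by force
  ultimately show ?thesis by blast
qed

text \<open>The two source charts are kept independent of the target pair, so that one statement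
  covers the change of charts and, with the source factors exchanged, its composition with the
  swap.\<close>

lemma pair_coord_C11_at:
  assumes adm': "admissible (U', \<phi>') (V', \<psi>') q' r'" and l: "l < 2 * n" and w: "w \<in> Eu (2 * n)"
    and S: "(S, \<alpha>) \<in> \<A>" "(R, \<beta>) \<in> \<A>"
    and G: "\<And>j. j < n \<Longrightarrow> C11_at (2 * n) (\<lambda>x. G x j) w" "\<And>x. G x \<in> Eu n" "G w \<in> \<alpha> ` S" "inv_into S \<alpha> (G w) \<in> U'"
    and H: "\<And>j. j < n \<Longrightarrow> C11_at (2 * n) (\<lambda>x. H x j) w" "\<And>x. H x \<in> Eu n" "H w \<in> \<beta> ` R" "inv_into R \<beta> (H w) \<in> V'"
  shows "C11_at (2 * n) (\<lambda>x. pair_coord \<phi>' \<psi>' q' r' (inv_into S \<alpha> (G x), inv_into R \<beta> (H x)) l) w"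
proof (cases "l < n")
  case True
  then show ?thesis
    using transition_C11_at[OF S(1) admissible_facts(1)[OF adm'] True w G] by (simp add: pair_coord_def)
next
  case False
  then have "l - n < n" using l by linarith
  from transition_C11_at[OF S(2) admissible_facts(2)[OF adm'] this w H]
  show ?thesis using False l by (simp add: pair_coord_def)
qed

lemma pair_charts_cube_atlas: "cube_atlas (2 * n) (conf2 X) prod.swap pair_charts"
proof
  show "second_countable (conf2 X)"
    using M by (intro second_countable_conf2) (simp add: smooth_manifold_def)
  have "Hausdorff_space X" using M by (simp add: smooth_manifold_def)
  then show "Hausdorff_space (conf2 X)"
    unfolding conf2_def by (intro Hausdorff_space_subtopology) (simp add: Hausdorff_space_prod_topology)
  show "continuous_map (conf2 X) (conf2 X) prod.swap" by (rule continuous_map_swap_conf2)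
  show "prod.swap (prod.swap z) = z" for z :: "'a \<times> 'a" by simp
  fix c e assume "(c, e) \<in> pair_charts"
  then obtain U \<phi> V \<psi> q r where ce: "c = pair_coord \<phi> \<psi> q r" "e = pair_param (U, \<phi>) (V, \<psi>) q r"
    and adm: "admissible (U, \<phi>) (V, \<psi>) q r"
    unfolding pair_charts_def by auto
  note f = admissible_facts[OF adm]
  show "openin (conf2 X) (e ` ocub (2 * n) 3)" unfolding ce by (rule pair_param_image_open[OF adm])
  show "homeomorphic_maps (subtopology (conf2 X) (e ` ocub (2 * n) 3)) (top_of_set (ocub (2 * n) 3)) c e"
    unfolding ce by (rule pair_chart_homeo[OF adm])
  show "prod.swap (e y) \<notin> e ` ocub (2 * n) 3" if y: "y \<in> ocub (2 * n) 3" for y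
  proof
    assume "prod.swap (e y) \<in> e ` ocub (2 * n) 3"
    then obtain y' where "y' \<in> ocub (2 * n) 3" "prod.swap (e y) = e y'" by blast
    then have "fst (e y) = snd (e y')" by (metis snd_swap)
    then show False using adm y \<open>y' \<in> ocub (2 * n) 3\<close> unfolding admissible_def ce by blast
  qed
  fix c' e' assume "(c', e') \<in> pair_charts"
  then obtain U' \<phi>' V' \<psi>' q' r' where ce': "c' = pair_coord \<phi>' \<psi>' q' r'" "e' = pair_param (U', \<phi>') (V', \<psi>') q' r'"
    and adm': "admissible (U', \<phi>') (V', \<psi>') q' r'"
    unfolding pair_charts_def by auto
  have img: "e' ` ocub (2 * n) 3 \<subseteq> U' \<times> V'" using pair_param_image[OF adm'] unfolding ce' by blast
  fix y l assume y: "y \<in> ocub (2 * n) 3" and l: "l < 2 * n"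
  have yE: "y \<in> Eu (2 * n)" using y by (simp add: ocub_def)
  show "C11_at (2 * n) (\<lambda>x. c' (e x) l) y" if "e y \<in> e' ` ocub (2 * n) 3"
  proof -
    have "e y \<in> U' \<times> V'" using that img by blast
    then show ?thesis
      unfolding ce ce' pair_param_def[abs_def] fst_conv snd_conv
      using f(4)[OF y] by (intro pair_coord_C11_at[OF adm' l yE f(1,2)] C11_at_half half_Eu) (auto simp: ce pair_param_def)
  qed
  show "C11_at (2 * n) (\<lambda>x. c' (prod.swap (e x)) l) y" if "prod.swap (e y) \<in> e' ` ocub (2 * n) 3"
  proof -
    have "prod.swap (e y) \<in> U' \<times> V'" using that img by blast
    then show ?thesis
      unfolding ce ce' pair_param_def[abs_def] fst_conv snd_conv prod.swap_def
      using f(4)[OF y] by (intro pair_coord_C11_at[OF adm' l yE f(2,1)] C11_at_half half_Eu) (auto simp: ce pair_param_def)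
  qed
next
  show "\<exists>(c, e)\<in>pair_charts. z \<in> e ` ocub (2 * n) 1 \<and> e ` ocub (2 * n) 3 \<subseteq> N"
    if "openin (conf2 X) N" "z \<in> N" for N z
    using pair_chart_cover[OF that] .
qed

end

section \<open>The theorem\<close>

text \<open>The retract is reported through g because the shrinking argument needs both the closed
  set {g \<le> 0} and the open set {g < 0}. Points with g < 0 are interior and take the constant
  push; zeros of g are pushed along their descent direction.\<close>

lemma ndr_between_closed_and_open:
  assumes M: "smooth_manifold n X \<A>"
    and C: "closedin (conf2 X) C" "prod.swap ` C \<subseteq> C"
    and U: "openin (conf2 X) U" "prod.swap ` U \<subseteq> U" and CU: "C \<subseteq> U"
  shows "\<exists>g. continuous_map (conf2 X) euclideanreal g \<and>
    (\<forall>z\<in>topspace (conf2 X). g (prod.swap z) = g z) \<and> (\<forall>z\<in>C. g z < 0) \<and>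
    {z \<in> topspace (conf2 X). g z \<le> 0} \<subseteq> U \<and>
    (\<forall>W. openin (conf2 X) W \<longrightarrow> prod.swap ` W \<subseteq> W \<longrightarrow>
      equivariant_ndr X ({z \<in> topspace (conf2 X). g z \<le> 0} \<inter> W))"
proof -
  interpret cube_atlas "2 * n" "conf2 X" prod.swap "pair_charts n \<A>"
    by (rule pair_charts_cube_atlas[OF M])
  obtain g where "continuous_map (conf2 X) euclideanreal g \<and> (\<forall>z\<in>topspace (conf2 X). g (prod.swap z) = g z) \<and>
    (\<forall>z\<in>C. g z < 0) \<and> (\<forall>z\<in>topspace (conf2 X) - U. 0 < g z) \<and>
    (\<forall>z\<in>topspace (conf2 X). g z = 0 \<longrightarrow>
      (\<exists>(c, e)\<in>pair_charts n \<A>. \<exists>y\<in>ocub (2 * n) 1. z = e y \<and> (\<exists>\<delta>>0. descent (2 * n) (\<lambda>y. g (e y)) y \<delta>)))"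
    using generic_separating_function[OF C U CU] by (rule exE)
  then have g: "continuous_map (conf2 X) euclideanreal g" "\<And>z. z \<in> topspace (conf2 X) \<Longrightarrow> g (prod.swap z) = g z"
    "\<And>z. z \<in> C \<Longrightarrow> g z < 0" "\<And>z. z \<in> topspace (conf2 X) - U \<Longrightarrow> 0 < g z"
    "\<And>z. z \<in> topspace (conf2 X) \<Longrightarrow> g z = 0 \<Longrightarrow>
      \<exists>(c, e)\<in>pair_charts n \<A>. \<exists>y\<in>ocub (2 * n) 1. z = e y \<and> (\<exists>\<delta>>0. descent (2 * n) (\<lambda>y. g (e y)) y \<delta>)"
    by simp_all
  define A where "A = {z \<in> topspace (conf2 X). g z \<le> 0}"
  have Asw: "prod.swap ` A \<subseteq> A" using g(2) \<tau>_top by (auto simp: A_def)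
  have push: "\<exists>h N. equivariant_push X A h N \<and> a \<in> N" if a: "a \<in> A" for a
  proof (cases "g a = 0")
    case True
    have aT: "a \<in> topspace (conf2 X)" using a by (simp add: A_def)
    obtain c e y \<delta> where ce: "(c, e) \<in> pair_charts n \<A>" "y \<in> ocub (2 * n) 1" "a = e y" "0 < \<delta>"
      "descent (2 * n) (\<lambda>y. g (e y)) y \<delta>"
      using g(5)[OF aT True] by blast
    have "g (e y) = 0" using True ce(3) by simp
    from local_push[OF ce(1,2) g(1,2) this ce(4,5)]
    obtain h N where "continuous_map (prod_topology (top_of_set {0..1::real}) (conf2 X)) (conf2 X) h \<and>
     (\<forall>z\<in>topspace (conf2 X). h (0, z) = z) \<and>
     (\<forall>t\<in>{0..1}. \<forall>z\<in>topspace (conf2 X). h (t, prod.swap z) = prod.swap (h (t, z))) \<and>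
     (\<forall>t\<in>{0..1}. \<forall>a\<in>A. h (t, a) = a) \<and>
     openin (conf2 X) N \<and> prod.swap ` N \<subseteq> N \<and> (\<forall>z\<in>N. h (1, z) \<in> A) \<and> e y \<in> N"
      unfolding A_def by blast
    then show ?thesis unfolding equivariant_push_def ce(3) by blast
  next
    case False
    let ?N = "{z \<in> topspace (conf2 X). g z \<in> {..<0}}"
    have "openin (conf2 X) ?N" by (rule openin_continuous_map_preimage[OF g(1)]) simp
    moreover have "prod.swap ` ?N \<subseteq> ?N" using g(2) \<tau>_top by auto
    moreover have "continuous_map (prod_topology (top_of_set {0..1::real}) (conf2 X)) (conf2 X) snd"
      by (rule continuous_map_snd)
    ultimately have "equivariant_push X A snd ?N" unfolding equivariant_push_def by (auto simp: A_def)
    moreover have "a \<in> ?N" using a False by (auto simp: A_def)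
    ultimately show ?thesis by blast
  qed
  have "equivariant_ndr X (A \<inter> W)" if "openin (conf2 X) W" "prod.swap ` W \<subseteq> W" for W
    by (rule equivariant_ndr_of_local_pushes[OF second_countable _ Asw push that]) (auto simp: A_def)
  moreover have "A \<subseteq> U" using g(4) unfolding A_def by force
  ultimately show ?thesis using g(1-3) unfolding A_def by blast
qed

section \<open>Covers of the orbit space by sections versus motion planners\<close>

definition section_cover :: "'a topology \<Rightarrow> nat \<Rightarrow> bool" where
  "section_cover X k \<longleftrightarrow> (\<exists>U :: nat \<Rightarrow> ('a \<times> 'a) set set.
     (\<Union>i\<le>k. U i) = topspace (uconf2 X) \<and>
     (\<forall>i\<le>k. openin (uconf2 X) (U i) \<and>
        (\<exists>s. continuous_map (subtopology (uconf2 X) (U i)) (path_space2 X) s \<and> (\<forall>b\<in>U i. ev2 (s b) = b))))"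

lemma section_cover_of_planner:
  assumes "symmetric_motion_planner X k F s"
  shows "section_cover X (k - 1)"
proof -
  have k: "1 \<le> k" and cov: "(\<Union>i\<in>{1..k}. F i) = topspace (conf2 X)"
    and ndr: "\<And>i. i \<in> {1..k} \<Longrightarrow> equivariant_ndr X (F i)"
    and s: "\<And>i. i \<in> {1..k} \<Longrightarrow> continuous_map (subtopology (conf2 X) (F i)) (path_space1 X) (s i)"
      "\<And>i z. i \<in> {1..k} \<Longrightarrow> z \<in> F i \<Longrightarrow> ev1 (s i z) = z"
      "\<And>i z. i \<in> {1..k} \<Longrightarrow> z \<in> F i \<Longrightarrow> s i (prod.swap z) = rev_path (s i z)"
    using assms unfolding symmetric_motion_planner_def by auto
  have "\<exists>U s'. openin (conf2 X) U \<and> F i \<subseteq> U \<and> prod.swap ` U \<subseteq> U \<and>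
      continuous_map (subtopology (conf2 X) U) (path_space1 X) s' \<and>
      (\<forall>z\<in>U. ev1 (s' z) = z \<and> s' (prod.swap z) = rev_path (s' z))" if "i \<in> {1..k}" for i
    by (rule extend_section_over_ndr[OF ndr[OF that] s(1)[OF that] s(2)[OF that] s(3)[OF that]])
  then obtain U s' where U: "\<And>i. i \<in> {1..k} \<Longrightarrow> openin (conf2 X) (U i) \<and> F i \<subseteq> U i \<and> prod.swap ` U i \<subseteq> U i \<and>
      continuous_map (subtopology (conf2 X) (U i)) (path_space1 X) (s' i) \<and>
      (\<forall>z\<in>U i. ev1 (s' i z) = z \<and> s' i (prod.swap z) = rev_path (s' i z))"
    by metis
  \<comment> \<open>Local rules are numbered from 1 to k, the members of a cover from 0 to k -
    1.\<close>
  define V where "V i = (\<lambda>z. {z, prod.swap z}) ` U (Suc i)" for i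
  have ik: "Suc i \<in> {1..k}" if "i \<le> k - 1" for i using that k by auto
  have "openin (uconf2 X) (V i)"
    "\<exists>\<sigma>. continuous_map (subtopology (uconf2 X) (V i)) (path_space2 X) \<sigma> \<and> (\<forall>b\<in>V i. ev2 (\<sigma> b) = b)"
    if "i \<le> k - 1" for i
    unfolding V_def using U[OF ik[OF that]] equivariant_section_descends[of X "U (Suc i)" "s' (Suc i)"] by blast+
  moreover have "(\<Union>i\<le>k - 1. V i) = topspace (uconf2 X)"
  proof
    show "(\<Union>i\<le>k - 1. V i) \<subseteq> topspace (uconf2 X)" using calculation(1) openin_subset by blast
    show "topspace (uconf2 X) \<subseteq> (\<Union>i\<le>k - 1. V i)"
    proof
      fix b assume "b \<in> topspace (uconf2 X)"
      then obtain z where z: "z \<in> topspace (conf2 X)" "b = {z, prod.swap z}" by (auto simp: uconf2_def)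
      then obtain i where i: "i \<in> {1..k}" "z \<in> F i" using cov by blast
      then have "z \<in> U i" using U by blast
      moreover have i1: "Suc (i - 1) = i" "i - 1 \<in> {..k - 1}" using i(1) by auto
      ultimately have "b \<in> V (i - 1)" using z(2) by (simp add: V_def)
      then show "b \<in> (\<Union>i\<le>k - 1. V i)" using i1(2) by (rule UN_I[rotated])
    qed
  qed
  ultimately show ?thesis unfolding section_cover_def by blast
qed

text \<open>The sets V are shrunk one at a time. After i steps the sets {g j < 0} for j < i and the
  untouched V j still cover; the strict inequality is carried along because these sets must be open.
  The points that only V i covers form a closed invariant subset of it, to which the next g is
  fitted.\<close>

lemma planner_of_section_cover:
  assumes M: "smooth_manifold n X \<A>" and cover: "section_cover X k"
  shows "\<exists>F s. symmetric_motion_planner X (Suc k) F s"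
proof -
  let ?M = "topspace (conf2 X)"
  have H: "Hausdorff_space X" using M by (simp add: smooth_manifold_def)
  obtain U \<sigma> where U: "(\<Union>i\<le>k. U i) = topspace (uconf2 X)" "\<And>i. i \<le> k \<Longrightarrow> openin (uconf2 X) (U i)"
    "\<And>i. i \<le> k \<Longrightarrow> continuous_map (subtopology (uconf2 X) (U i)) (path_space2 X) (\<sigma> i)"
    "\<And>i b. i \<le> k \<Longrightarrow> b \<in> U i \<Longrightarrow> ev2 (\<sigma> i b) = b"
    using cover unfolding section_cover_def by metis
  define V where "V i = {z \<in> ?M. {z, prod.swap z} \<in> U i}" for i
  have V: "openin (conf2 X) (V i)" "prod.swap ` V i \<subseteq> V i"
    "\<exists>s. continuous_map (subtopology (conf2 X) (V i)) (path_space1 X) s \<and>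
       (\<forall>z\<in>V i. ev1 (s z) = z \<and> s (prod.swap z) = rev_path (s z))" if "i \<le> k" for i
    using section_lifts[OF H U(2)[OF that] U(3)[OF that] U(4)[OF that]] unfolding V_def by blast+
  then obtain s where s: "\<And>i. i \<le> k \<Longrightarrow> continuous_map (subtopology (conf2 X) (V i)) (path_space1 X) (s i)"
    "\<And>i z. i \<le> k \<Longrightarrow> z \<in> V i \<Longrightarrow> ev1 (s i z) = z \<and> s i (prod.swap z) = rev_path (s i z)"
    by metis
  have Vcov: "?M \<subseteq> (\<Union>i\<le>k. V i)"
  proof
    fix z assume z: "z \<in> ?M"
    then have "{z, prod.swap z} \<in> (\<Union>i\<le>k. U i)" unfolding U(1) by (simp add: uconf2_def)
    then show "z \<in> (\<Union>i\<le>k. V i)" using z unfolding V_def by blast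
  qed
  have swM: "prod.swap z \<in> ?M" if "z \<in> ?M" for z using that by (auto simp: topspace_conf2)
  define good where "good g W \<longleftrightarrow> continuous_map (conf2 X) euclideanreal g \<and>
    (\<forall>z\<in>?M. g (prod.swap z) = g z) \<and> {z \<in> ?M. g z \<le> 0} \<subseteq> W \<and>
    (\<forall>W. openin (conf2 X) W \<longrightarrow> prod.swap ` W \<subseteq> W \<longrightarrow> equivariant_ndr X ({z \<in> ?M. g z \<le> 0} \<inter> W))"
    for g :: "'a \<times> 'a \<Rightarrow> real" and W
  have "\<exists>g. (\<forall>j<i. good (g j) (V j)) \<and> ?M \<subseteq> (\<Union>j<i. {z \<in> ?M. g j z < 0}) \<union> (\<Union>j\<in>{i..k}. V j)"
    if "i \<le> Suc k" for i
    using that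
  proof (induction i)
    case 0
    have "{..k} = {0..k}" by auto
    then show ?case using Vcov by simp
  next
    case (Suc i)
    then obtain g where g: "\<And>j. j < i \<Longrightarrow> good (g j) (V j)"
      "?M \<subseteq> (\<Union>j<i. {z \<in> ?M. g j z < 0}) \<union> (\<Union>j\<in>{i..k}. V j)" by auto
    have ik: "i \<le> k" using Suc.prems by simp
    define Z where "Z = (\<Union>j<i. {z \<in> ?M. g j z < 0}) \<union> (\<Union>j\<in>{Suc i..k}. V j)"
    have oZ: "openin (conf2 X) Z"
      unfolding Z_def
    proof (intro openin_Un openin_Union ballI)
      fix S assume "S \<in> (\<lambda>j. {z \<in> ?M. g j z < 0}) ` {..<i}"
      then obtain j where j: "j < i" "S = {z \<in> ?M. g j z \<in> {..<0}}" by auto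
      have "continuous_map (conf2 X) euclideanreal (g j)" using g(1)[OF j(1)] by (simp add: good_def)
      then show "openin (conf2 X) S" unfolding j(2) by (rule openin_continuous_map_preimage) simp
    qed (use V(1) in auto)
    have Zsw: "prod.swap z \<in> Z" if z: "z \<in> Z" for z
    proof -
      have zM: "z \<in> ?M" using z openin_subset[OF oZ] by blast
      consider j where "j < i" "g j z < 0" | j where "j \<in> {Suc i..k}" "z \<in> V j"
        using z unfolding Z_def by blast
      then show ?thesis
      proof cases
        case 1
        then have "g j (prod.swap z) < 0" using g(1)[OF 1(1)] zM by (simp add: good_def)
        then have "prod.swap z \<in> {z \<in> ?M. g j z < 0}" using swM[OF zM] by simp
        then show ?thesis using 1(1) unfolding Z_def by blast
      next
        case 2
        then have "prod.swap z \<in> V j" using V(2)[of j] by auto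
        then show ?thesis using 2(1) unfolding Z_def by blast
      qed
    qed
    let ?C = "?M - Z"
    have "closedin (conf2 X) ?C" using oZ by blast
    moreover have "prod.swap ` ?C \<subseteq> ?C"
    proof
      fix w assume "w \<in> prod.swap ` ?C"
      then obtain z where z: "z \<in> ?M" "z \<notin> Z" "w = prod.swap z" by blast
      then have "prod.swap w = z" by simp
      then show "w \<in> ?C" using z swM Zsw[of w] by auto
    qed
    moreover have "{i..k} = insert i {Suc i..k}" using ik by auto
    then have "?C \<subseteq> V i" using g(2) by (auto simp: Z_def)
    ultimately obtain g' where g': "good g' (V i)" "\<forall>z\<in>?C. g' z < 0"
      using ndr_between_closed_and_open[OF M _ _ V(1,2)[OF ik], of ?C] unfolding good_def by blast
    have "\<forall>j<Suc i. good ((g(i := g')) j) (V j)" using g(1) g'(1) by (simp add: less_Suc_eq)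
    moreover have "?M \<subseteq> (\<Union>j<Suc i. {z \<in> ?M. (g(i := g')) j z < 0}) \<union> (\<Union>j\<in>{Suc i..k}. V j)"
    proof
      fix z assume z: "z \<in> ?M"
      show "z \<in> (\<Union>j<Suc i. {z \<in> ?M. (g(i := g')) j z < 0}) \<union> (\<Union>j\<in>{Suc i..k}. V j)"
      proof (cases "z \<in> Z")
        case True
        then consider j where "j < i" "g j z < 0" | j where "j \<in> {Suc i..k}" "z \<in> V j" unfolding Z_def by blast
        then show ?thesis
        proof cases
          case 1
          then have "z \<in> {z \<in> ?M. (g(i := g')) j z < 0}" using z by simp
          then show ?thesis using 1(1) less_SucI by blast
        qed blast
      next
        case False
        then have "z \<in> {z \<in> ?M. (g(i := g')) i z < 0}" using g'(2) z by simp
        then show ?thesis by blast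
      qed
    qed
    ultimately show ?case by blast
  qed
  from this[of "Suc k"]
  obtain g where g: "\<And>j. j \<le> k \<Longrightarrow> good (g j) (V j)" "?M \<subseteq> (\<Union>j<Suc k. {z \<in> ?M. g j z < 0})"
    by (auto simp: less_Suc_eq_le)
  define A where "A j = {z \<in> ?M. g j z \<le> 0}" for j
  \<comment> \<open>Removing the earlier closed sets leaves a relatively open invariant subset of
    \<open>A i\<close>, and \<open>good\<close> provides the retract property for such
    subsets.\<close>
  define W where "W i = ?M - (\<Union>j<i. A j)" for i
  have oW: "openin (conf2 X) (W i)" if "i \<le> k" for i
  proof -
    have "closedin (conf2 X) (A j)" if "j < i" for j
    proof -
      have "continuous_map (conf2 X) euclideanreal (g j)" using g(1)[of j] that \<open>i \<le> k\<close> by (simp add: good_def)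
      then have "closedin (conf2 X) {z \<in> ?M. g j z \<in> {..0}}" by (rule closedin_continuous_map_preimage) simp
      then show ?thesis by (simp add: A_def)
    qed
    then show ?thesis unfolding W_def by (intro openin_diff closedin_Union) auto
  qed
  have Asw: "prod.swap z \<in> A j \<longleftrightarrow> z \<in> A j" if "j \<le> k" "z \<in> ?M" for j z
    using g(1)[OF that(1)] that(2) swM[OF that(2)] by (simp add: A_def good_def)
  have Wsw: "prod.swap ` W i \<subseteq> W i" if "i \<le> k" for i
    using Asw swM that unfolding W_def by force
  define F where "F i = A (i - 1) \<inter> W (i - 1)" for i
  have FV: "F (Suc i) \<subseteq> V i" if "i \<le> k" for i
    using g(1)[OF that] by (auto simp: F_def A_def good_def)
  have ndrF: "equivariant_ndr X (F (Suc i))" if "i \<le> k" for i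
    using g(1)[OF that] oW[OF that] Wsw[OF that] by (simp add: F_def A_def good_def)
  have dj: "F (Suc i) \<inter> F (Suc j) = {}" if "i < j" for i j
    using that by (auto simp: F_def W_def)
  have "symmetric_motion_planner X (Suc k) F (\<lambda>i. s (i - 1))"
    unfolding symmetric_motion_planner_def
  proof (intro conjI ballI)
    show "(\<Union>i\<in>{1..Suc k}. F i) = ?M"
    proof
      show "(\<Union>i\<in>{1..Suc k}. F i) \<subseteq> ?M" by (auto simp: F_def A_def)
      show "?M \<subseteq> (\<Union>i\<in>{1..Suc k}. F i)"
      proof
        fix z assume z: "z \<in> ?M"
        then obtain j where j: "j \<le> k" "z \<in> A j" using g(2) by (force simp: A_def less_Suc_eq_le)
        define i where "i = (LEAST i. z \<in> A i)"
        have i: "z \<in> A i" "i \<le> k"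
          using j Least_le[of "\<lambda>i. z \<in> A i" j] unfolding i_def by (auto intro: LeastI)
        have "z \<notin> A j" if "j < i" for j using that not_less_Least unfolding i_def by blast
        then have "z \<in> F (Suc i)" using i(1) z by (auto simp: F_def W_def)
        then show "z \<in> (\<Union>i\<in>{1..Suc k}. F i)" using i(2) by (intro UN_I[of "Suc i"]) auto
      qed
    qed
    show "disjoint_family_on F {1..Suc k}"
      unfolding disjoint_family_on_def
    proof (intro ballI impI)
      fix i j assume ij: "i \<in> {1..Suc k}" "j \<in> {1..Suc k}" "i \<noteq> j"
      then have "i - 1 < j - 1 \<or> j - 1 < i - 1" "Suc (i - 1) = i" "Suc (j - 1) = j" by auto
      then show "F i \<inter> F j = {}" using dj[of "i - 1" "j - 1"] dj[of "j - 1" "i - 1"] by auto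
    qed
    fix i assume "i \<in> {1..Suc k}"
    then have i: "Suc (i - 1) = i" "i - 1 \<le> k" by auto
    have Fi: "F i \<subseteq> V (i - 1)" using FV[OF i(2)] i(1) by simp
    show "equivariant_ndr X (F i)" using ndrF[OF i(2)] i(1) by simp
    show "continuous_map (subtopology (conf2 X) (F i)) (path_space1 X) (s (i - 1))"
      by (rule continuous_map_from_subtopology_mono[OF s(1)[OF i(2)] Fi])
    fix z assume "z \<in> F i"
    then have "z \<in> V (i - 1)" using Fi by blast
    then show "ev1 (s (i - 1) z) = z" "s (i - 1) (prod.swap z) = rev_path (s (i - 1) z)"
      using s(2)[OF i(2)] by blast+
  qed simp
  then show ?thesis by blast
qed

text \<open>The two index sets differ by a shift of one, and if no k qualifies both sides are
  \<infinity>.\<close>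

lemma INF_enat_shift:
  assumes "\<And>k. P k \<Longrightarrow> Q (Suc k)" "\<And>k. Q k \<Longrightarrow> 1 \<le> k \<and> P (k - 1)"
  shows "(INF k \<in> {k. P k}. enat k) + 1 = (INF k \<in> {k. Q k}. enat k)"
proof (rule antisym)
  show "(INF k \<in> {k. P k}. enat k) + 1 \<le> (INF k \<in> {k. Q k}. enat k)"
  proof (rule INF_greatest)
    fix k assume "k \<in> {k. Q k}"
    then have k: "1 \<le> k" "P (k - 1)" using assms(2) by auto
    then have "(INF k \<in> {k. P k}. enat k) \<le> enat (k - 1)" by (intro INF_lower) simp
    then have "(INF k \<in> {k. P k}. enat k) + 1 \<le> enat (k - 1) + 1" by (rule add_right_mono)
    also have "\<dots> = enat k" using k(1) by (simp add: one_enat_def)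
    finally show "(INF k \<in> {k. P k}. enat k) + 1 \<le> enat k" .
  qed
  show "(INF k \<in> {k. Q k}. enat k) \<le> (INF k \<in> {k. P k}. enat k) + 1"
  proof (cases "\<exists>k. P k")
    case True
    define k where "k = (LEAST k. P k)"
    have "P k" using True unfolding k_def by (rule LeastI_ex)
    have "enat k \<le> (INF k \<in> {k. P k}. enat k)"
      by (rule INF_greatest) (auto simp: k_def intro: Least_le)
    then have "enat k + 1 \<le> (INF k \<in> {k. P k}. enat k) + 1" by (rule add_right_mono)
    moreover have "(INF k \<in> {k. Q k}. enat k) \<le> enat (Suc k)"
      using assms(1)[OF \<open>P k\<close>] by (intro INF_lower) simp
    moreover have "enat (Suc k) = enat k + 1" by (simp add: one_enat_def)
    ultimately show ?thesis by (metis order_trans)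
  next
    case False
    then show ?thesis by (simp add: top_enat_def)
  qed
qed

theorem theorem1p3:
  fixes X :: "'a topology" and n :: nat and \<A> :: "'a chart set"
  assumes "smooth_manifold n X \<A>"
    and "path_connected_space X"
  shows "symmetric_TC X = (INF k \<in> {k. \<exists>F s. symmetric_motion_planner X k F s}. enat k)"
proof -
  have "symmetric_TC X = (INF k \<in> {k. section_cover X k}. enat k) + 1"
    unfolding symmetric_TC_def genus_def section_cover_def ..
  also have "\<dots> = (INF k \<in> {k. \<exists>F s. symmetric_motion_planner X k F s}. enat k)"
  proof (rule INF_enat_shift)
    show "\<exists>F s. symmetric_motion_planner X (Suc k) F s" if "section_cover X k" for k
      by (rule planner_of_section_cover[OF assms(1) that])
    show "1 \<le> k \<and> section_cover X (k - 1)" if "\<exists>F s. symmetric_motion_planner X k F s" for k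
      using that section_cover_of_planner symmetric_motion_planner_def by metis
  qed
  finally show ?thesis .
qed

end
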